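(* Let $p_0(d)$ be the threshold exponent defined in the context. Then $$p_0(2)<6,\quad p_0(3)<4,\quad p_0(4)<3.48,\quad p_0(5)<3.50,$$ $$p_0(6)<3.58,\quad p_0(7)<3.7,\quad p_0(8)<3.86,\quad p_0(9)<4.06,\quad p_0(10)<4.46.$$ In particular, for $d=2,3$ one has $p_0(d)<p_{\mathrm{st}}(d)$, where $p_{\mathrm{st}}(d):=\frac{2(d+1)}{d-1}$.
   Context: Let $d\ge 2$ be an integer and let $J_\nu$ denote the Bessel function of the first kind of order $\nu$. For a non-negative integer $k$ and $\frac{2d}{d-1}<p<\infty$ define $$\Lambda_{d,p}(k):=\left(\int_0^\infty \left|J_{\frac d2-1+k}(r)\,r^{-\frac d2+1}\right|^p r^{d-1}\,dr\right)^{1/p},$$ and $$\Lambda_{d,\infty}(k):=\sup_{r\ge 0}\left|J_{\frac d2-1+k}(r)\,r^{-\frac d2+1}\right|$$ (the value at $r=0$ being understood as the limit $r\to0^+$). These quantities are finite for $\frac{2d}{d-1}<p\le\infty$. The exponent $p_0(d)$ is the left endpoint of the largest neighborhood of infinity $(p_0(d),\infty]$ of exponents for which $\max_{k\ge0}\Lambda_{d,p}(k)$ is attained at $k=0$ and only at $k=0$; that is, $p_0(d)$ is the infimum of all real $q\ge\frac{2d}{d-1}$ such that for every $p\in(q,\infty]$ and every integer $k\ge1$ one has $\Lambda_{d,p}(k)<\Lambda_{d,p}(0)$. *)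

theory Defs
  imports "HOL-Analysis.Analysis"
begin

text \<open>
  The Bessel function of the first kind \<open>J\<^sub>\<nu>(x)\<close> for real \<open>\<nu> \<ge> 0\<close> and \<open>x \<ge> 0\<close>, by its power series.
  The case \<open>\<nu> = 0\<close> of the prefactor is split off because \<open>0 powr 0 = 0\<close>, whereas \<open>J\<^sub>0(0) = 1\<close>.
\<close>

definition bessel_J :: "real \<Rightarrow> real \<Rightarrow> real" where
  "bessel_J \<nu> x =
     (if \<nu> = 0 then 1 else (x / 2) powr \<nu>) *
     (\<Sum>m. (-1) ^ m / (fact m * Gamma (real m + \<nu> + 1)) * (x / 2) ^ (2 * m))"

definition radial :: "nat \<Rightarrow> nat \<Rightarrow> real \<Rightarrow> real" where
  "radial d k r = bessel_J (real d / 2 - 1 + real k) r * r powr (- real d / 2 + 1)"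

definition radial_ext :: "nat \<Rightarrow> nat \<Rightarrow> real \<Rightarrow> real" where
  "radial_ext d k r = (if r = 0 then Lim (at_right 0) (radial d k) else radial d k r)"

text \<open>
  The exponent ranges over \<open>(2d/(d-1), \<infinity>]\<close>, where the integral converges and the supremum is
  finite, so a real-valued definition suffices.
\<close>

definition Lambda :: "nat \<Rightarrow> ereal \<Rightarrow> nat \<Rightarrow> real" where
  "Lambda d p k =
     (if p = \<infinity> then (SUP r\<in>{0..}. \<bar>radial_ext d k r\<bar>)
      else (LBINT r:{0<..}. \<bar>radial d k r\<bar> powr real_of_ereal p * r ^ (d - 1))
             powr (1 / real_of_ereal p))"

text \<open>
  The infimum is taken in the extended reals, so that it is \<open>\<infinity>\<close> if there is no admissible \<open>q\<close>.
\<close>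

definition p0 :: "nat \<Rightarrow> ereal" where
  "p0 d = Inf (ereal ` {q. q \<ge> 2 * real d / (real d - 1) \<and>
     (\<forall>p::ereal. ereal q < p \<longrightarrow> (\<forall>k\<ge>1. Lambda d p k < Lambda d p 0))})"

definition p_st :: "nat \<Rightarrow> real" where
  "p_st d = 2 * (real d + 1) / (real d - 1)"

end

theory Submission
  imports Defs "HOL-Probability.Sinc_Integral" "HOL-Real_Asymp.Real_Asymp"
begin

text \<open>
  Write \<open>\<mu> = d / 2 - 1 + k\<close> and \<open>f\<^sub>k\<close> for the radial function \<open>J\<^sub>\<mu>(r) r\<^bsup>1 - d / 2\<^esup>\<close>.

  Since \<open>J\<^sub>\<mu>\<^sup>2 / r\<close> has integral \<open>1 / (2 \<mu>)\<close>, the integral of \<open>\<bar>f\<^sub>k\<bar>\<^sup>q r\<^bsup>d - 1\<^esup>\<close> is at most the supremum of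
  \<open>r\<^sup>2 \<bar>f\<^sub>k\<bar>\<^bsup>q - 2\<^esup>\<close> divided by \<open>2 \<mu>\<close>. That supremum is controlled by envelopes of \<open>J\<^sub>\<mu>\<^sup>2\<close>, which come from a Sonin
  type monotone quantity, and by the monotonicity of \<open>J\<^sub>\<mu> r\<^bsup>-\<beta>\<^esup>\<close> before the first maximum.

  For \<open>k = 0\<close> the function \<open>f\<^sub>0\<close> is a convex function of \<open>r\<^sup>2\<close> near the origin, so Jensen's inequality on a few cells
  bounds the integral from below by a finite sum of powers \<open>y\<^sup>q\<close>. If this sum beats the upper bound for one \<open>q\<close>, and
  \<open>\<bar>f\<^sub>k\<bar>\<close> is at most \<open>M f\<^sub>0(0)\<close> for \<open>k \<ge> 1\<close> with \<open>M\<close> below a suitable mean of the heights \<open>y\<close>, then it does so for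
  every larger exponent, because passing from \<open>q\<close> to \<open>p\<close> costs at most \<open>M\<^bsup>p - q\<^esup>\<close> above and gains at least as much below.

  For \<open>d = 2\<close> the integral is instead split at the first maximum of \<open>J\<^sub>\<mu>\<close>. For \<open>d = 3\<close> the supremum is infinite
  if \<open>q < 4\<close>. In both cases the strict inequality at the endpoint is extended to slightly smaller exponents by
  interpolation with a crude bound that is uniform in \<open>k\<close>.
\<close>

section \<open>The hypergeometric series\<close>

text \<open>The weight \<open>r^2 * |f_k|^(q - 2)\<close> behaves like
  \<open>r^(2 - (q - 2) * (d - 1) / 2)\<close> at infinity, so it is bounded exactly when
  \<open>q\<close> is at least \<open>2 * (d + 1) / (d - 1) = p_st d\<close>. For
  \<open>d \<ge> 4\<close> the claimed bounds lie above this exponent and there is room for a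
  smaller \<open>q\<close>; for \<open>d = 2, 3\<close> they coincide with it, which is why these
  two dimensions need a separate step below the endpoint.

  The supremum of the weight may grow with \<open>k\<close>, but the factor
  \<open>1 / (2 * \<mu>)\<close> pays for growth proportional to \<open>\<mu>\<close>. The case
  \<open>k = 1\<close> is therefore the critical competitor and receives the sharpest estimates.

  Every comparison ends in rational arithmetic: \<open>q = 2 + 2 * m / n\<close> turns real powers
  into integer powers, alternating partial sums bound the series from both sides, and dividing by
  \<open>f_0(0)^2\<close> removes the Gamma factors and, for odd \<open>d\<close>, also
  \<open>pi\<close>. In the variable \<open>x = r^2 / 4\<close> the Bessel function without its
  power factor is entire with value 1 at the origin, so that monotonicity, positivity and convexity
  can be read off one linear differential equation.\<close>

text \<open>The hypergeometric function \<open>\<^sub>0F\<^sub>1(; \<mu> + 1; -x)\<close>.\<close>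

definition hyp :: "real \<Rightarrow> real \<Rightarrow> real" where
  "hyp \<mu> x = (\<Sum>m. (-1) ^ m / (fact m * pochhammer (\<mu> + 1) m) * x ^ m)"

lemma pochhammer_ge_1:
  fixes a :: real
  assumes "a \<ge> 1"
  shows "pochhammer a m \<ge> 1"
proof (induction m)
  case (Suc m)
  have "1 * 1 \<le> pochhammer a m * (a + real m)"
    using Suc assms by (intro mult_mono) auto
  then show ?case by (simp add: pochhammer_Suc)
qed simp

lemma summable_hyp:
  fixes \<mu> x :: real
  assumes "\<mu> \<ge> 0"
  shows "summable (\<lambda>m. (-1) ^ m / (fact m * pochhammer (\<mu> + 1) m) * x ^ m)"
proof (rule summable_comparison_test'[where N = 0])
  show "summable (\<lambda>m. inverse (fact m) * \<bar>x\<bar> ^ m)" by (rule summable_exp)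
  fix m :: nat
  have p: "pochhammer (\<mu> + 1) m \<ge> 1" using assms by (intro pochhammer_ge_1) simp
  have "\<bar>x\<bar> ^ m / (fact m * pochhammer (\<mu> + 1) m) \<le> \<bar>x\<bar> ^ m / (fact m * 1)"
    using p by (intro divide_left_mono mult_left_mono) auto
  then show "norm ((-1) ^ m / (fact m * pochhammer (\<mu> + 1) m) * x ^ m) \<le> inverse (fact m) * \<bar>x\<bar> ^ m"
    using p by (simp add: abs_mult power_abs divide_simps)
qed

lemma hyp_0 [simp]: "hyp \<mu> 0 = 1"
  unfolding hyp_def by (subst powser_zero) simp

lemma has_real_derivative_hyp:
  fixes \<mu> x :: real
  assumes "\<mu> \<ge> 0"
  shows "(hyp \<mu> has_real_derivative (- hyp (\<mu> + 1) x / (\<mu> + 1))) (at x)"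
proof -
  let ?c = "\<lambda>m. (-1) ^ m / (fact m * pochhammer (\<mu> + 1) m)"
  have d: "diffs ?c m = (-1 / (\<mu> + 1)) * ((-1) ^ m / (fact m * pochhammer (\<mu> + 1 + 1) m))" for m
  proof -
    have "pochhammer (\<mu> + 1 + 1) m > 0" using assms by (intro pochhammer_pos) simp
    then show ?thesis
      using assms by (simp add: diffs_def pochhammer_rec divide_simps)
  qed
  have "((\<lambda>x. \<Sum>m. ?c m * x ^ m) has_real_derivative (\<Sum>m. diffs ?c m * x ^ m)) (at x)"
    by (rule termdiffs_strong_converges_everywhere) (rule summable_hyp[OF assms])
  also have "(\<lambda>x. \<Sum>m. ?c m * x ^ m) = hyp \<mu>" by (simp add: hyp_def fun_eq_iff)
  also have "(\<Sum>m. diffs ?c m * x ^ m) = (-1 / (\<mu> + 1)) * hyp (\<mu> + 1) x"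
    unfolding hyp_def d using summable_hyp[of "\<mu> + 1" x] assms
    by (subst suminf_mult[symmetric]) (auto simp: mult.assoc)
  finally show ?thesis by simp
qed

lemma has_real_derivative_hyp_add1:
  fixes \<mu> x :: real
  assumes "\<mu> \<ge> 0"
  shows "(hyp (\<mu> + 1) has_real_derivative (- hyp (\<mu> + 2) x / (\<mu> + 2))) (at x)"
  using has_real_derivative_hyp[of "\<mu> + 1" x] assms by (simp add: add.assoc)

lemma isCont_hyp: "\<mu> \<ge> 0 \<Longrightarrow> isCont (hyp \<mu>) x"
  using has_real_derivative_hyp DERIV_isCont by blast

lemma continuous_on_hyp: "\<mu> \<ge> 0 \<Longrightarrow> continuous_on A (hyp \<mu>)"
  using isCont_hyp continuous_at_imp_continuous_on by blast

text \<open>Bessel's equation in the variable \<open>x = r^2 / 4\<close>: differentiation raises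
  \<open>\<mu>\<close> by one, so this relation between three consecutive orders is
  \<open>x * y'' + (\<mu> + 1) * y' + y = 0\<close> for \<open>y = hyp \<mu>\<close>. It holds
  coefficient by coefficient after a shift of the index.\<close>

lemma hyp_contiguous:
  fixes \<mu> x :: real
  assumes "\<mu> \<ge> 0"
  shows "hyp \<mu> x = hyp (\<mu> + 1) x - x / ((\<mu> + 1) * (\<mu> + 2)) * hyp (\<mu> + 2) x"
proof -
  let ?a = "\<lambda>\<mu> m. (-1) ^ m / (fact m * pochhammer (\<mu> + 1) m) * x ^ m :: real"
  have s: "summable (?a \<mu>)" "summable (?a (\<mu> + 1))" "summable (?a (\<mu> + 2))"
    using summable_hyp[of \<mu> x] summable_hyp[of "\<mu> + 1" x] summable_hyp[of "\<mu> + 2" x] assms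
    by simp_all
  have step: "?a \<mu> (Suc m) - ?a (\<mu> + 1) (Suc m) = - (x / ((\<mu> + 1) * (\<mu> + 2))) * ?a (\<mu> + 2) m" for m
  proof -
    have p: "pochhammer (\<mu> + 2 + 1) m > 0" using assms by (intro pochhammer_pos) simp
    have e1: "pochhammer (\<mu> + 1) (Suc m) = (\<mu> + 1) * (\<mu> + 2) * pochhammer (\<mu> + 2 + 1) m / (\<mu> + 2 + real m)"
    proof -
      have "pochhammer (\<mu> + 1) (Suc (Suc m)) = pochhammer (\<mu> + 1) (Suc m) * (\<mu> + 2 + real m)"
        by (subst pochhammer_Suc) (simp add: algebra_simps)
      moreover have "pochhammer (\<mu> + 1) (Suc (Suc m)) = (\<mu> + 1) * ((\<mu> + 2) * pochhammer (\<mu> + 2 + 1) m)"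
        unfolding pochhammer_rec[of "\<mu> + 1"]
        using pochhammer_rec[of "\<mu> + 2" m] by (simp add: algebra_simps)
      ultimately show ?thesis using assms by (simp add: field_simps)
    qed
    have e2: "pochhammer (\<mu> + 1 + 1) (Suc m) = (\<mu> + 2) * pochhammer (\<mu> + 2 + 1) m"
      using pochhammer_rec[of "\<mu> + 2" m] by (simp add: algebra_simps)
    have nz: "\<mu> + 1 \<noteq> 0" "\<mu> + 2 \<noteq> 0" "\<mu> + 2 + real m \<noteq> 0" using assms by auto
    define c where "c = (-1) ^ m * x ^ m / (fact m * pochhammer (\<mu> + 2 + 1) m)"
    have "?a \<mu> (Suc m) = - x * c * ((\<mu> + 2 + real m) / ((1 + real m) * ((\<mu> + 1) * (\<mu> + 2))))"
      unfolding e1 c_def by (simp add: mult.commute mult.left_commute)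
    moreover have "?a (\<mu> + 1) (Suc m) = - x * c * (1 / ((1 + real m) * (\<mu> + 2)))"
      unfolding e2 c_def by (simp add: mult.commute mult.left_commute)
    moreover have "(\<mu> + 2 + real m) / ((1 + real m) * ((\<mu> + 1) * (\<mu> + 2)))
        - 1 / ((1 + real m) * (\<mu> + 2)) = 1 / ((\<mu> + 1) * (\<mu> + 2))"
      using nz by (simp add: divide_simps)
    ultimately have "?a \<mu> (Suc m) - ?a (\<mu> + 1) (Suc m) = - x * c * (1 / ((\<mu> + 1) * (\<mu> + 2)))"
      by (metis right_diff_distrib)
    then show ?thesis by (simp add: c_def)
  qed
  have "hyp \<mu> x - hyp (\<mu> + 1) x = (\<Sum>m. ?a \<mu> m - ?a (\<mu> + 1) m)"
    unfolding hyp_def by (rule suminf_diff[OF s(1,2)])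
  also have "\<dots> = (\<Sum>m. ?a \<mu> (Suc m) - ?a (\<mu> + 1) (Suc m))"
    by (subst suminf_split_head[OF summable_diff[OF s(1,2)]]) simp
  also have "\<dots> = - (x / ((\<mu> + 1) * (\<mu> + 2))) * hyp (\<mu> + 2) x"
    unfolding step hyp_def by (rule suminf_mult[OF s(3)])
  finally show ?thesis by simp
qed

text \<open>Energy argument: along a solution of \<open>x * y'' + (\<mu> + 1) * y' + y = 0\<close>
  the quantity \<open>y^2 + x * y'^2\<close> has derivative \<open>- (2 * \<mu> + 1) * y'^2\<close>,
  and it starts at 1.\<close>

lemma abs_hyp_le_1:
  fixes \<mu> x :: real
  assumes "\<mu> \<ge> 0" "x \<ge> 0"
  shows "\<bar>hyp \<mu> x\<bar> \<le> 1"
proof -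
  define E where "E = (\<lambda>x. (hyp \<mu> x)\<^sup>2 + x * (hyp (\<mu> + 1) x / (\<mu> + 1))\<^sup>2)"
  have "E x \<le> E 0"
  proof (rule DERIV_nonpos_imp_nonincreasing[OF assms(2)])
    fix t assume t: "0 \<le> t" "t \<le> x"
    let ?h = "hyp \<mu> t" and ?h1 = "hyp (\<mu> + 1) t" and ?h2 = "hyp (\<mu> + 2) t"
    have "(E has_real_derivative
        (2 * ?h * (- ?h1 / (\<mu> + 1)) + ((?h1 / (\<mu> + 1))\<^sup>2
          + t * (2 * (?h1 / (\<mu> + 1)) * (- ?h2 / (\<mu> + 2) / (\<mu> + 1)))))) (at t)"
      unfolding E_def using assms(1)
      by (auto intro!: derivative_eq_intros has_real_derivative_hyp has_real_derivative_hyp_add1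
            simp: power2_eq_square diff_divide_distrib mult.commute mult.assoc mult.left_commute)
    moreover have "2 * ?h * (- ?h1 / (\<mu> + 1)) + ((?h1 / (\<mu> + 1))\<^sup>2
          + t * (2 * (?h1 / (\<mu> + 1)) * (- ?h2 / (\<mu> + 2) / (\<mu> + 1))))
        = - (2 * \<mu> + 1) * (?h1 / (\<mu> + 1))\<^sup>2"
    proof -
      have nz: "\<mu> + 1 > 0" "\<mu> + 2 > 0" using assms(1) by auto
      show ?thesis unfolding hyp_contiguous[OF assms(1), of t] using nz
        by (simp add: divide_simps power2_eq_square) (simp add: algebra_simps)
    qed
    ultimately show "\<exists>y. (E has_real_derivative y) (at t) \<and> y \<le> 0"
      using assms(1) by (intro exI[of _ "- (2 * \<mu> + 1) * (?h1 / (\<mu> + 1))\<^sup>2"])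
        (auto intro!: mult_nonpos_nonneg)
  qed
  then have "(hyp \<mu> x)\<^sup>2 \<le> 1" using assms by (simp add: E_def add_increasing2 order_trans[rotated])
  then show ?thesis by (simp add: abs_square_le_1)
qed

section \<open>Partial sums as alternating lower and upper bounds\<close>

definition hyp_partial :: "real \<Rightarrow> nat \<Rightarrow> real \<Rightarrow> real" where
  "hyp_partial \<mu> n x = (\<Sum>m<n. (-1) ^ m / (fact m * pochhammer (\<mu> + 1) m) * x ^ m)"

lemma has_real_derivative_hyp_partial:
  assumes "\<mu> \<ge> 0"
  shows "(hyp_partial \<mu> (Suc n) has_real_derivative (- hyp_partial (\<mu> + 1) n x / (\<mu> + 1))) (at x)"
proof -
  have e: "hyp_partial \<mu> (Suc n) = (\<lambda>x. 1 + (\<Sum>m<n. (-1) ^ Suc m / (fact (Suc m) * pochhammer (\<mu> + 1) (Suc m)) * x ^ Suc m))"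
    unfolding hyp_partial_def sum.lessThan_Suc_shift by simp
  have d: "(-1) ^ Suc m / (fact (Suc m) * pochhammer (\<mu> + 1) (Suc m)) * (real (Suc m) * x ^ m)
      = (-1 / (\<mu> + 1)) * ((-1) ^ m / (fact m * pochhammer (\<mu> + 1 + 1) m) * x ^ m)" for m
  proof -
    have "pochhammer (\<mu> + 1 + 1) m > 0" using assms by (intro pochhammer_pos) simp
    then show ?thesis using assms by (simp add: pochhammer_rec divide_simps)
  qed
  have "(hyp_partial \<mu> (Suc n) has_real_derivative
     (\<Sum>m<n. (-1) ^ Suc m / (fact (Suc m) * pochhammer (\<mu> + 1) (Suc m)) * (real (Suc m) * x ^ m))) (at x)"
    unfolding e
    by (rule derivative_eq_intros refl | simp)+ (simp add: mult.commute)
  then show ?thesis unfolding d sum_distrib_left[symmetric] by (simp add: hyp_partial_def)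
qed

text \<open>The Taylor remainder of order \<open>n\<close> has the derivative of order \<open>n - 1\<close> for \<open>\<mu> + 1\<close>,
  so its sign propagates from \<open>\<bar>hyp \<mu> x\<bar> \<le> 1\<close>.\<close>

lemma hyp_enveloping:
  assumes "\<mu> \<ge> 0" "x \<ge> 0"
  shows "(-1) ^ n * (hyp \<mu> x - hyp_partial \<mu> (Suc n) x) \<le> 0"
  using assms
proof (induction n arbitrary: \<mu> x)
  case 0
  then show ?case using abs_hyp_le_1[of \<mu> x] by (simp add: hyp_partial_def)
next
  case (Suc n)
  define R where "R = (\<lambda>x. (-1) ^ Suc n * (hyp \<mu> x - hyp_partial \<mu> (Suc (Suc n)) x))"
  have "R x \<le> R 0"
  proof (rule DERIV_nonpos_imp_nonincreasing[OF Suc.prems(2)])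
    fix t assume t: "0 \<le> t" "t \<le> x"
    let ?D = "(-1) ^ n * (hyp (\<mu> + 1) t - hyp_partial (\<mu> + 1) (Suc n) t) / (\<mu> + 1)"
    have "(R has_real_derivative ?D) (at t)"
      unfolding R_def using Suc.prems(1)
      by (intro DERIV_cong[OF DERIV_cmult[OF DERIV_diff[OF has_real_derivative_hyp has_real_derivative_hyp_partial]]])
         (simp_all add: diff_divide_distrib right_diff_distrib)
    moreover have "?D \<le> 0"
      using Suc.IH[of "\<mu> + 1" t] Suc.prems t by (intro divide_nonpos_pos) auto
    ultimately show "\<exists>y. (R has_real_derivative y) (at t) \<and> y \<le> 0" by blast
  qed
  moreover have "R 0 = 0" unfolding R_def hyp_partial_def
    by (subst sum.lessThan_Suc_shift) simp
  ultimately show ?case by (simp add: R_def)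
qed

lemma hyp_partial_le_hyp:
  assumes "\<mu> \<ge> 0" "x \<ge> 0" "even n" "n > 0"
  shows "hyp_partial \<mu> n x \<le> hyp \<mu> x"
proof (cases n)
  case (Suc m)
  then show ?thesis using hyp_enveloping[of \<mu> x m] assms by (auto simp: uminus_power_if)
qed (use assms in simp)

lemma hyp_le_hyp_partial:
  assumes "\<mu> \<ge> 0" "x \<ge> 0" "odd n"
  shows "hyp \<mu> x \<le> hyp_partial \<mu> n x"
proof (cases n)
  case (Suc m)
  then show ?thesis using hyp_enveloping[of \<mu> x m] assms by auto
qed (use assms in simp)

section \<open>Logarithmic derivative, positivity and exponential decay\<close>

definition hyp' :: "real \<Rightarrow> real \<Rightarrow> real" where
  "hyp' \<mu> x = hyp (\<mu> + 1) x / (\<mu> + 1)"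

lemma has_real_derivative_hyp_hyp':
  "\<mu> \<ge> 0 \<Longrightarrow> (hyp \<mu> has_real_derivative - hyp' \<mu> x) (at x)"
  using has_real_derivative_hyp[of \<mu> x] by (simp add: hyp'_def)

lemma has_real_derivative_hyp':
  assumes "\<mu> \<ge> 0" "x \<noteq> 0"
  shows "(hyp' \<mu> has_real_derivative (hyp \<mu> x - (\<mu> + 1) * hyp' \<mu> x) / x) (at x)"
proof -
  have "(hyp' \<mu> has_real_derivative - hyp (\<mu> + 2) x / (\<mu> + 2) / (\<mu> + 1)) (at x)"
    unfolding hyp'_def using assms(1)
    by (intro DERIV_cdivide has_real_derivative_hyp_add1)
  moreover have "- hyp (\<mu> + 2) x / (\<mu> + 2) / (\<mu> + 1) = (hyp \<mu> x - (\<mu> + 1) * hyp' \<mu> x) / x"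
  proof -
    have "\<mu> + 1 > 0" "\<mu> + 2 > 0" using assms(1) by auto
    then show ?thesis using assms(2) unfolding hyp'_def hyp_contiguous[OF assms(1), of x]
      by (simp add: divide_simps)
  qed
  ultimately show ?thesis by simp
qed

text \<open>A linear barrier for the logarithmic derivative: multiplied by the integrating factor
  \<open>x powr (\<mu> + 1) * exp (- 2 * x / a)\<close>, the left-hand side is nondecreasing.\<close>

lemma hyp_barrier:
  assumes \<mu>: "\<mu> \<ge> 0" and a: "a > 0" and X: "4 * X \<le> a * (2 * \<mu> + 2 - a)"
    and pos: "\<And>x. 0 < x \<Longrightarrow> x < X \<Longrightarrow> hyp \<mu> x \<ge> 0" and x: "0 \<le> x" "x \<le> X"
  shows "a * hyp' \<mu> x \<le> 2 * hyp \<mu> x"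
proof (cases "x = 0")
  case True
  then have "0 \<le> a * (2 * \<mu> + 2 - a)" using X x by simp
  then have "a \<le> 2 * \<mu> + 2" using a by (simp add: zero_le_mult_iff)
  then show ?thesis using \<mu> True by (simp add: hyp'_def divide_simps)
next
  case False
  then have x0: "x > 0" using x by simp
  define Z where "Z = (\<lambda>t. 2 * hyp \<mu> t - a * hyp' \<mu> t)"
  define K where "K = (\<lambda>t. t powr (\<mu> + 1) * exp (- 2 * t / a) * Z t)"
  have "K 0 \<le> K x"
  proof (rule DERIV_nonneg_imp_increasing_open[of 0 x K])
    fix t assume t: "0 < t" "t < x"
    have dZ: "(Z has_real_derivative 2 * (- hyp' \<mu> t) - a * ((hyp \<mu> t - (\<mu> + 1) * hyp' \<mu> t) / t)) (at t)"
      unfolding Z_def using \<mu> t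
      by (intro DERIV_diff DERIV_cmult has_real_derivative_hyp_hyp' has_real_derivative_hyp') auto
    have dp: "((\<lambda>t. t powr (\<mu> + 1)) has_real_derivative (\<mu> + 1) * t powr \<mu>) (at t)"
      using has_real_derivative_powr[of t "\<mu> + 1"] t by simp
    have de: "((\<lambda>t. exp (- 2 * t / a)) has_real_derivative exp (- 2 * t / a) * (- 2 / a)) (at t)"
      using a by (auto intro!: derivative_eq_intros)
    let ?p = "t powr \<mu>" and ?e = "exp (- 2 * t / a)"
    have tp: "t powr (\<mu> + 1) = t * ?p" using t by (simp add: powr_add)
    have "(K has_real_derivative ((\<mu> + 1) * ?p * ?e + ?e * (- 2 / a) * t powr (\<mu> + 1)) * Z t
        + (2 * (- hyp' \<mu> t) - a * ((hyp \<mu> t - (\<mu> + 1) * hyp' \<mu> t) / t)) * (t powr (\<mu> + 1) * ?e)) (at t)"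
      unfolding K_def by (intro DERIV_mult dp de dZ)
    moreover have "((\<mu> + 1) * ?p * ?e + ?e * (- 2 / a) * t powr (\<mu> + 1)) * Z t
        + (2 * (- hyp' \<mu> t) - a * ((hyp \<mu> t - (\<mu> + 1) * hyp' \<mu> t) / t)) * (t powr (\<mu> + 1) * ?e)
        = ?p * ?e * hyp \<mu> t * (2 * \<mu> + 2 - a - 4 * t / a)"
      unfolding tp Z_def using t a by (simp add: divide_simps) (simp add: algebra_simps)
    moreover have "?p * ?e * hyp \<mu> t * (2 * \<mu> + 2 - a - 4 * t / a) \<ge> 0"
    proof -
      have "4 * t \<le> a * (2 * \<mu> + 2 - a)" using t x X by linarith
      then have "2 * \<mu> + 2 - a - 4 * t / a \<ge> 0" using a by (simp add: field_simps)
      moreover have "hyp \<mu> t \<ge> 0" using t x by (intro pos) auto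
      ultimately show ?thesis by simp
    qed
    ultimately show "\<exists>y. (K has_real_derivative y) (at t) \<and> 0 \<le> y" by metis
  next
    have "continuous_on {0..x} (\<lambda>t. t powr (\<mu> + 1))"
      using \<mu> by (intro continuous_on_powr') (auto intro: continuous_intros)
    moreover have "continuous_on {0..x} Z"
      unfolding Z_def hyp'_def using \<mu> by (intro continuous_intros continuous_on_hyp) auto
    moreover have "continuous_on {0..x} (\<lambda>t. exp (- 2 * t / a))"
      using a by (intro continuous_intros) auto
    ultimately show "continuous_on {0..x} K"
      unfolding K_def by (intro continuous_on_mult)
  qed (use x0 in simp)
  then have "x powr (\<mu> + 1) * exp (- 2 * x / a) * Z x \<ge> 0" by (simp add: K_def)
  moreover have "x powr (\<mu> + 1) * exp (- 2 * x / a) > 0" using x0 by simp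
  ultimately have "Z x \<ge> 0" by (metis zero_le_mult_iff not_less)
  then show ?thesis by (simp add: Z_def)
qed

text \<open>Up to a first zero \<open>z\<close> the barrier applies with
  \<open>a = \<mu> + 1\<close>, the value that maximises \<open>a * (2 * \<mu> + 2 - a)\<close>. It
  makes \<open>hyp \<mu> t * exp (2 * t / a)\<close> nondecreasing on \<open>{0..z}\<close>, so the
  value at \<open>z\<close> cannot be zero. In terms of \<open>r\<close> the range is
  \<open>r \<le> \<mu> + 1\<close>.\<close>

lemma hyp_pos:
  assumes \<mu>: "\<mu> \<ge> 0" and x: "0 \<le> x" "4 * x \<le> (\<mu> + 1)\<^sup>2"
  shows "hyp \<mu> x > 0"
proof (rule ccontr)
  assume "\<not> hyp \<mu> x > 0"
  then have neg: "hyp \<mu> x \<le> 0" by simp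
  define a where "a = \<mu> + 1"
  have a: "a > 0" using \<mu> by (simp add: a_def)
  let ?S = "{t \<in> {0..x}. hyp \<mu> t \<le> 0}"
  define z where "z = Inf ?S"
  have ne: "?S \<noteq> {}" using neg x by auto
  have bd: "bdd_below ?S" by (rule bdd_belowI[of _ 0]) auto
  have "?S = {0..x} \<inter> {t. hyp \<mu> t \<le> 0}" by auto
  then have "closed ?S"
    using closed_Collect_le[OF continuous_on_hyp[OF \<mu>] continuous_on_const] by auto
  then have z: "z \<in> ?S" unfolding z_def using ne bd by (intro closed_contains_Inf)
  have lt: "hyp \<mu> t > 0" if "0 \<le> t" "t < z" for t
    using cInf_lower[OF _ bd, of t] that z unfolding z_def[symmetric] by force
  have z0: "z > 0" using z by (cases "z = 0") auto
  have zX: "4 * z \<le> a * (2 * \<mu> + 2 - a)" using z x by (simp add: a_def power2_eq_square)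
  have bar: "a * hyp' \<mu> t \<le> 2 * hyp \<mu> t" if "0 \<le> t" "t \<le> z" for t
    by (rule hyp_barrier[OF \<mu> a zX _ that]) (use lt in \<open>auto intro: less_imp_le\<close>)
  have "hyp \<mu> 0 * exp (2 * 0 / a) \<le> hyp \<mu> z * exp (2 * z / a)"
  proof (rule DERIV_nonneg_imp_nondecreasing[of 0 z "\<lambda>t. hyp \<mu> t * exp (2 * t / a)"])
    fix t assume t: "0 \<le> t" "t \<le> z"
    have "((\<lambda>t. hyp \<mu> t * exp (2 * t / a)) has_real_derivative
        (- hyp' \<mu> t * exp (2 * t / a) + exp (2 * t / a) * (2 / a) * hyp \<mu> t)) (at t)"
      using \<mu> a by (intro DERIV_mult has_real_derivative_hyp_hyp') (auto intro!: derivative_eq_intros)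
    moreover have "- hyp' \<mu> t * exp (2 * t / a) + exp (2 * t / a) * (2 / a) * hyp \<mu> t
        = exp (2 * t / a) * (2 * hyp \<mu> t - a * hyp' \<mu> t) / a"
      using a by (simp add: field_simps)
    moreover have "\<dots> \<ge> 0" using bar[OF t] a by simp
    ultimately show "\<exists>y. ((\<lambda>t. hyp \<mu> t * exp (2 * t / a)) has_real_derivative y) (at t) \<and> 0 \<le> y" by metis
  qed (use z0 in simp)
  then have "0 < hyp \<mu> z * exp (2 * z / a)" by simp
  then have "hyp \<mu> z > 0" by (simp add: zero_less_mult_iff)
  then show False using z by simp
qed

text \<open>Since \<open>a * (2 * \<mu> + 2 - a) \<le> (\<mu> + 1)^2\<close> for every
  \<open>a\<close>, the positivity premise of the barrier is supplied by
  \<open>hyp_pos\<close>.\<close>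

lemma hyp_barrier':
  assumes \<mu>: "\<mu> \<ge> 0" and a: "a > 0" and x: "0 \<le> x" "4 * x \<le> a * (2 * \<mu> + 2 - a)"
  shows "a * hyp' \<mu> x \<le> 2 * hyp \<mu> x"
proof (rule hyp_barrier[OF \<mu> a x(2) _ x(1) order_refl])
  fix t assume t: "0 < t" "t < x"
  have "a * (2 * \<mu> + 2 - a) = (\<mu> + 1)\<^sup>2 - (a - (\<mu> + 1))\<^sup>2"
    by (simp add: power2_eq_square algebra_simps)
  then have "4 * t \<le> (\<mu> + 1)\<^sup>2" using t x by (smt (verit) zero_le_power2)
  then show "hyp \<mu> t \<ge> 0" using hyp_pos[OF \<mu>, of t] t by simp
qed

text \<open>By the contiguous relation the derivative of
  \<open>hyp \<mu> x * exp (x / (\<mu> + 1))\<close> is a negative multiple of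
  \<open>x * hyp (\<mu> + 2) x\<close>. The range \<open>4 * x \<le> (\<mu> + 3)^2\<close> is that
  of \<open>hyp_pos\<close> for the order \<open>\<mu> + 2\<close>.\<close>

lemma hyp_le_exp:
  assumes \<mu>: "\<mu> \<ge> 0" and x: "0 \<le> x" "4 * x \<le> (\<mu> + 3)\<^sup>2"
  shows "hyp \<mu> x \<le> exp (- x / (\<mu> + 1))"
proof -
  have "hyp \<mu> x * exp (x / (\<mu> + 1)) \<le> hyp \<mu> 0 * exp (0 / (\<mu> + 1))"
  proof (rule DERIV_nonpos_imp_nonincreasing[of 0 x "\<lambda>t. hyp \<mu> t * exp (t / (\<mu> + 1))"])
    fix t assume t: "0 \<le> t" "t \<le> x"
    have "((\<lambda>t. hyp \<mu> t * exp (t / (\<mu> + 1))) has_real_derivative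
        (- hyp' \<mu> t * exp (t / (\<mu> + 1)) + exp (t / (\<mu> + 1)) * (1 / (\<mu> + 1)) * hyp \<mu> t)) (at t)"
      using \<mu> by (intro DERIV_mult has_real_derivative_hyp_hyp') (auto intro!: derivative_eq_intros)
    moreover have "- hyp' \<mu> t * exp (t / (\<mu> + 1)) + exp (t / (\<mu> + 1)) * (1 / (\<mu> + 1)) * hyp \<mu> t
        = - (t / ((\<mu> + 1) * (\<mu> + 2)) * hyp (\<mu> + 2) t) * exp (t / (\<mu> + 1)) / (\<mu> + 1)"
    proof -
      have "\<mu> + 1 > 0" "\<mu> + 2 > 0" using \<mu> by auto
      then show ?thesis unfolding hyp'_def hyp_contiguous[OF \<mu>, of t] by (simp add: divide_simps) (simp add: algebra_simps)
    qed
    moreover have "\<dots> \<le> 0"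
    proof -
      have "hyp (\<mu> + 2) t > 0" using \<mu> t x by (intro hyp_pos) (auto simp: add.commute)
      then show ?thesis using \<mu> t by (intro divide_nonpos_pos mult_nonpos_nonneg) auto
    qed
    ultimately show "\<exists>y. ((\<lambda>t. hyp \<mu> t * exp (t / (\<mu> + 1))) has_real_derivative y) (at t) \<and> y \<le> 0" by metis
  qed (use x in simp)
  then show ?thesis by (simp add: exp_minus field_simps)
qed

text \<open>The offset \<open>j\<close> stands for the shift of both Pochhammer symbols: the tail of
  the nested form is the same form with \<open>j + 1\<close>. The partial sums of the series are the
  case \<open>j = 1\<close>, and evaluation needs neither factorials nor Pochhammer symbols.\<close>

fun hyp_horner :: "real \<Rightarrow> real \<Rightarrow> real \<Rightarrow> nat \<Rightarrow> real" where
  "hyp_horner \<mu> x j 0 = 0"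
| "hyp_horner \<mu> x j (Suc n) = 1 - x / (j * (\<mu> + j)) * hyp_horner \<mu> x (j + 1) n"

lemma hyp_horner_eq:
  "hyp_horner \<mu> x j n = (\<Sum>m<n. (-1) ^ m / (pochhammer j m * pochhammer (\<mu> + j) m) * x ^ m)"
proof (induction n arbitrary: j)
  case (Suc n)
  have "(\<Sum>m<n. (-1) ^ Suc m / (pochhammer j (Suc m) * pochhammer (\<mu> + j) (Suc m)) * x ^ Suc m)
      = - (x / (j * (\<mu> + j))) * (\<Sum>m<n. (-1) ^ m / (pochhammer (j + 1) m * pochhammer (\<mu> + (j + 1)) m) * x ^ m)"
    unfolding sum_distrib_left
    by (intro sum.cong refl) (simp add: pochhammer_rec add.assoc mult.commute mult.left_commute)
  then show ?case by (subst sum.lessThan_Suc_shift) (simp add: Suc.IH)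
qed simp

lemma hyp_partial_eq_horner: "hyp_partial \<mu> n x = hyp_horner \<mu> x 1 n"
  by (simp add: hyp_partial_def hyp_horner_eq pochhammer_fact)

section \<open>Bessel functions\<close>

lemma bessel_J_eq:
  assumes "\<mu> \<ge> 0" "r > 0"
  shows "bessel_J \<mu> r = (r / 2) powr \<mu> / Gamma (\<mu> + 1) * hyp \<mu> (r\<^sup>2 / 4)"
proof -
  have e: "(-1) ^ m / (fact m * Gamma (real m + \<mu> + 1)) * (r / 2) ^ (2 * m)
      = (1 / Gamma (\<mu> + 1)) * ((-1) ^ m / (fact m * pochhammer (\<mu> + 1) m) * (r\<^sup>2 / 4) ^ m)" for m
  proof -
    have "\<mu> + 1 \<notin> \<int>\<^sub>\<le>\<^sub>0" using assms by (auto elim!: nonpos_Ints_cases)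
    then have "pochhammer (\<mu> + 1) m = Gamma (real m + \<mu> + 1) / Gamma (\<mu> + 1)"
      by (subst pochhammer_Gamma) (auto simp: algebra_simps)
    moreover have "Gamma (\<mu> + 1) > 0" using assms by (intro Gamma_real_pos) auto
    moreover have "(r / 2) ^ (2 * m) = (r\<^sup>2 / 4) ^ m"
      by (simp add: power_mult power_divide)
    ultimately show ?thesis by simp
  qed
  have s: "(\<Sum>m. (-1) ^ m / (fact m * Gamma (real m + \<mu> + 1)) * (r / 2) ^ (2 * m))
      = (1 / Gamma (\<mu> + 1)) * hyp \<mu> (r\<^sup>2 / 4)"
    unfolding e hyp_def by (rule suminf_mult[OF summable_hyp[OF assms(1)]])
  have "(if \<mu> = 0 then 1 else (r / 2) powr \<mu>) = (r / 2) powr \<mu>" using assms by simp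
  then show ?thesis unfolding bessel_J_def s by simp
qed

lemma bessel_J_add1_eq:
  assumes "\<mu> \<ge> 0" "r > 0"
  shows "bessel_J (\<mu> + 1) r = (r / 2) powr \<mu> / Gamma (\<mu> + 1) * (r / 2) * hyp' \<mu> (r\<^sup>2 / 4)"
proof -
  have "Gamma (\<mu> + 1 + 1) = (\<mu> + 1) * Gamma (\<mu> + 1)"
    using assms by (intro Gamma_plus1) (auto elim!: nonpos_Ints_cases)
  then show ?thesis using assms by (simp add: bessel_J_eq hyp'_def powr_add)
qed

lemma has_real_derivative_bessel_J:
  assumes "\<mu> \<ge> 0" "r > 0"
  shows "(bessel_J \<mu> has_real_derivative \<mu> / r * bessel_J \<mu> r - bessel_J (\<mu> + 1) r) (at r)"
proof -
  let ?G = "Gamma (\<mu> + 1)"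
  have "((\<lambda>r. (r / 2) powr \<mu> / ?G * hyp \<mu> (r\<^sup>2 / 4)) has_real_derivative
     (\<mu> * (r / 2) powr (\<mu> - 1) * (1 / 2)) / ?G * hyp \<mu> (r\<^sup>2 / 4)
      + (- hyp' \<mu> (r\<^sup>2 / 4) * (r / 2)) * ((r / 2) powr \<mu> / ?G)) (at r)"
    using assms
    by (intro DERIV_mult DERIV_cdivide DERIV_chain2[OF has_real_derivative_hyp_hyp']
          DERIV_chain2[OF has_real_derivative_powr])
       (auto intro!: derivative_eq_intros)
  moreover have "(\<mu> * (r / 2) powr (\<mu> - 1) * (1 / 2)) / ?G * hyp \<mu> (r\<^sup>2 / 4)
      + (- hyp' \<mu> (r\<^sup>2 / 4) * (r / 2)) * ((r / 2) powr \<mu> / ?G)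
      = \<mu> / r * bessel_J \<mu> r - bessel_J (\<mu> + 1) r"
  proof -
    have "(r / 2) powr (\<mu> - 1) = (r / 2) powr \<mu> * 2 / r"
      using assms by (simp add: powr_diff)
    then show ?thesis unfolding bessel_J_add1_eq[OF assms] bessel_J_eq[OF assms]
      by (simp add: mult.commute mult.left_commute)
  qed
  ultimately have "((\<lambda>r. (r / 2) powr \<mu> / ?G * hyp \<mu> (r\<^sup>2 / 4)) has_real_derivative
     \<mu> / r * bessel_J \<mu> r - bessel_J (\<mu> + 1) r) (at r)" by simp
  moreover have "\<forall>\<^sub>F s in nhds r. bessel_J \<mu> s = (s / 2) powr \<mu> / ?G * hyp \<mu> (s\<^sup>2 / 4)"
    using eventually_nhds_in_open[of "{0<..}" r] assms
    by (auto elim!: eventually_mono simp: bessel_J_eq)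
  ultimately show ?thesis
    by (subst DERIV_cong_ev[OF refl _ refl]) auto
qed

lemma bessel_J_add2_eq:
  assumes "\<mu> \<ge> 0" "r > 0"
  shows "bessel_J (\<mu> + 2) r = (r / 2) powr \<mu> / Gamma (\<mu> + 1)
    * (r\<^sup>2 / 4 / ((\<mu> + 1) * (\<mu> + 2)) * hyp (\<mu> + 2) (r\<^sup>2 / 4))"
proof -
  have "bessel_J (\<mu> + 1 + 1) r = (r / 2) powr (\<mu> + 1) / Gamma (\<mu> + 1 + 1) * (r / 2) * hyp' (\<mu> + 1) (r\<^sup>2 / 4)"
    using assms by (intro bessel_J_add1_eq) auto
  moreover have "Gamma (\<mu> + 1 + 1) = (\<mu> + 1) * Gamma (\<mu> + 1)"
    using assms by (intro Gamma_plus1) (auto elim!: nonpos_Ints_cases)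
  moreover have "(r / 2) powr (\<mu> + 1) = (r / 2) powr \<mu> * (r / 2)"
    using assms by (simp add: powr_add)
  ultimately show ?thesis
    by (simp add: hyp'_def add.assoc power2_eq_square mult.commute mult.left_commute)
qed

lemma bessel_J_rec:
  assumes "\<mu> \<ge> 0" "r > 0"
  shows "bessel_J \<mu> r + bessel_J (\<mu> + 2) r = 2 * (\<mu> + 1) / r * bessel_J (\<mu> + 1) r"
proof -
  let ?c = "(r / 2) powr \<mu> / Gamma (\<mu> + 1)"
  have "bessel_J \<mu> r + bessel_J (\<mu> + 2) r = ?c * hyp (\<mu> + 1) (r\<^sup>2 / 4)"
    unfolding bessel_J_eq[OF assms] bessel_J_add2_eq[OF assms] hyp_contiguous[OF assms(1), of "r\<^sup>2 / 4"]
    by (simp add: right_diff_distrib)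
  also have "\<dots> = 2 * (\<mu> + 1) / r * bessel_J (\<mu> + 1) r"
  proof -
    have "\<mu> + 1 \<noteq> 0" using assms by simp
    then have "hyp (\<mu> + 1) (r\<^sup>2 / 4) = (\<mu> + 1) * hyp' \<mu> (r\<^sup>2 / 4)" by (simp add: hyp'_def)
    moreover have "2 * (\<mu> + 1) / r * (c * (r / 2) * h) = c * ((\<mu> + 1) * h)" for c h
      using assms(2) by (simp add: field_simps)
    ultimately show ?thesis unfolding bessel_J_add1_eq[OF assms] by metis
  qed
  finally show ?thesis .
qed

lemma has_real_derivative_bessel_J_add1:
  assumes "\<mu> \<ge> 0" "r > 0"
  shows "(bessel_J (\<mu> + 1) has_real_derivative bessel_J \<mu> r - (\<mu> + 1) / r * bessel_J (\<mu> + 1) r) (at r)"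
proof -
  have "(\<mu> + 1) / r * bessel_J (\<mu> + 1) r - bessel_J (\<mu> + 1 + 1) r
      = bessel_J \<mu> r - (\<mu> + 1) / r * bessel_J (\<mu> + 1) r"
    using bessel_J_rec[OF assms] by (simp add: add.assoc field_simps)
  then show ?thesis
    using has_real_derivative_bessel_J[of "\<mu> + 1" r] assms by (metis add_nonneg_nonneg zero_le_one)
qed

text \<open>\<open>r\<close> times the derivative of \<open>bessel_J \<mu>\<close>, see \<open>has_real_derivative_bessel_J_theta\<close>.\<close>

definition bessel_D :: "real \<Rightarrow> real \<Rightarrow> real" where
  "bessel_D \<mu> r = \<mu> * bessel_J \<mu> r - r * bessel_J (\<mu> + 1) r"

lemma has_real_derivative_bessel_J_theta:
  assumes "\<mu> \<ge> 0" "r > 0"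
  shows "(bessel_J \<mu> has_real_derivative bessel_D \<mu> r / r) (at r)"
  using has_real_derivative_bessel_J[OF assms] assms(2) by (simp add: bessel_D_def diff_divide_distrib)

text \<open>With \<open>has_real_derivative_bessel_J_theta\<close> this writes Bessel's equation as
  a first-order system for the derivation \<open>r * d/dr\<close>, the form used by all later
  monotone quantities.\<close>

lemma has_real_derivative_bessel_D:
  assumes "\<mu> \<ge> 0" "r > 0"
  shows "(bessel_D \<mu> has_real_derivative - (r\<^sup>2 - \<mu>\<^sup>2) * bessel_J \<mu> r / r) (at r)"
proof -
  have "(bessel_D \<mu> has_real_derivative \<mu> * (\<mu> / r * bessel_J \<mu> r - bessel_J (\<mu> + 1) r)
     - (1 * bessel_J (\<mu> + 1) r + (bessel_J \<mu> r - (\<mu> + 1) / r * bessel_J (\<mu> + 1) r) * r)) (at r)"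
    unfolding bessel_D_def
    by (intro DERIV_diff DERIV_cmult DERIV_mult DERIV_ident has_real_derivative_bessel_J
          has_real_derivative_bessel_J_add1 assms)
  moreover have "\<mu> * (\<mu> / r * bessel_J \<mu> r - bessel_J (\<mu> + 1) r)
     - (1 * bessel_J (\<mu> + 1) r + (bessel_J \<mu> r - (\<mu> + 1) / r * bessel_J (\<mu> + 1) r) * r)
     = - (r\<^sup>2 - \<mu>\<^sup>2) * bessel_J \<mu> r / r"
    using assms by (simp add: field_simps power2_eq_square)
  ultimately show ?thesis by simp
qed

text \<open>\<open>amp \<mu> L\<close>: the amplitude of \<open>sqrt r * bessel_J \<mu> r\<close> tends to \<open>sqrt L\<close>.
  The true value is \<open>L = 2 / \<pi>\<close>, but an upper bound on it is enough.\<close>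

definition amp :: "real \<Rightarrow> real \<Rightarrow> bool" where
  "amp \<mu> L \<longleftrightarrow> ((\<lambda>r. r * ((bessel_J \<mu> r)\<^sup>2 + (bessel_J (\<mu> + 1) r)\<^sup>2)) \<longlongrightarrow> L) at_top"

section \<open>Decay at infinity and the common limit of the amplitudes\<close>

lemma tendsto_0_of_weighted_bounded:
  fixes f :: "real \<Rightarrow> real"
  assumes "\<forall>\<^sub>F r in at_top. r * (f r)\<^sup>2 \<le> C"
  shows "(f \<longlongrightarrow> 0) at_top"
proof -
  have "((\<lambda>r. (f r)\<^sup>2) \<longlongrightarrow> 0) at_top"
  proof (rule tendsto_sandwich)
    show "\<forall>\<^sub>F r in at_top. 0 \<le> (f r)\<^sup>2" by simp
    show "\<forall>\<^sub>F r in at_top. (f r)\<^sup>2 \<le> C / r"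
      using assms eventually_gt_at_top[of 0]
      by eventually_elim (simp add: field_simps)
    show "((\<lambda>r. C / r) \<longlongrightarrow> 0) at_top" by real_asymp
  qed auto
  then have "((\<lambda>r. sqrt ((f r)\<^sup>2)) \<longlongrightarrow> sqrt 0) at_top" by (rule tendsto_real_sqrt)
  then have "((\<lambda>r. \<bar>f r\<bar>) \<longlongrightarrow> 0) at_top" by simp
  then show ?thesis by (simp add: tendsto_rabs_zero_iff)
qed

lemma amp_tendsto_0:
  assumes "amp \<mu> L"
  shows "(bessel_J \<mu> \<longlongrightarrow> 0) at_top" "(bessel_J (\<mu> + 1) \<longlongrightarrow> 0) at_top"
proof -
  have b: "\<forall>\<^sub>F r in at_top. r * ((bessel_J \<mu> r)\<^sup>2 + (bessel_J (\<mu> + 1) r)\<^sup>2) < L + 1"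
    using assms unfolding amp_def by (rule order_tendstoD) simp
  show "(bessel_J \<mu> \<longlongrightarrow> 0) at_top"
    by (rule tendsto_0_of_weighted_bounded[where C = "L + 1"])
       (use b eventually_gt_at_top[of 0] in eventually_elim,
        smt (verit) mult_nonneg_nonneg zero_le_power2 ring_class.ring_distribs(1))
  show "(bessel_J (\<mu> + 1) \<longlongrightarrow> 0) at_top"
    by (rule tendsto_0_of_weighted_bounded[where C = "L + 1"])
       (use b eventually_gt_at_top[of 0] in eventually_elim,
        smt (verit) mult_nonneg_nonneg zero_le_power2 ring_class.ring_distribs(1))
qed

text \<open>The recurrence gives
  \<open>J_(\<mu>+2) = 2 * (\<mu> + 1) / r * J_(\<mu>+1) - J_\<mu>\<close>, so
  \<open>r * J_(\<mu>+2)^2\<close> and \<open>r * J_\<mu>^2\<close> differ only by terms that vanish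
  at infinity. One limit \<open>L\<close> thus serves all orders that differ by integers.\<close>

lemma amp_add1:
  assumes "\<mu> \<ge> 0" "amp \<mu> L"
  shows "amp (\<mu> + 1) L"
proof -
  let ?X = "bessel_J \<mu>" and ?Y = "bessel_J (\<mu> + 1)" and ?Z = "bessel_J (\<mu> + 2)"
  note t = amp_tendsto_0[OF assms(2)]
  have "((\<lambda>r. r * ((?X r)\<^sup>2 + (?Y r)\<^sup>2) + (4 * (\<mu> + 1)\<^sup>2 * (1 / r) * (?Y r)\<^sup>2 - 4 * (\<mu> + 1) * (?Y r * ?X r)))
      \<longlongrightarrow> L + (4 * (\<mu> + 1)\<^sup>2 * 0 * 0\<^sup>2 - 4 * (\<mu> + 1) * (0 * 0))) at_top"
    using assms(2) unfolding amp_def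
    by (intro tendsto_add tendsto_diff tendsto_mult tendsto_power tendsto_const t) (assumption | real_asymp)+
  then have l: "((\<lambda>r. r * ((?X r)\<^sup>2 + (?Y r)\<^sup>2) + (4 * (\<mu> + 1)\<^sup>2 * (1 / r) * (?Y r)\<^sup>2 - 4 * (\<mu> + 1) * (?Y r * ?X r)))
      \<longlongrightarrow> L) at_top" by simp
  have "\<forall>\<^sub>F r in at_top. r * ((?X r)\<^sup>2 + (?Y r)\<^sup>2) + (4 * (\<mu> + 1)\<^sup>2 * (1 / r) * (?Y r)\<^sup>2 - 4 * (\<mu> + 1) * (?Y r * ?X r))
      = r * ((?Y r)\<^sup>2 + (?Z r)\<^sup>2)"
    using eventually_gt_at_top[of 0]
  proof eventually_elim
    case (elim r)
    have z: "?Z r = 2 * (\<mu> + 1) / r * ?Y r - ?X r" using bessel_J_rec[OF assms(1) elim] by simp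
    have "(?Z r)\<^sup>2 = 4 * (\<mu> + 1)\<^sup>2 / r\<^sup>2 * (?Y r)\<^sup>2 - 4 * (\<mu> + 1) / r * (?Y r * ?X r) + (?X r)\<^sup>2"
      unfolding z using elim by (simp add: power2_eq_square field_simps)
    then have "r * (?Z r)\<^sup>2 = 4 * (\<mu> + 1)\<^sup>2 * (1 / r) * (?Y r)\<^sup>2 - 4 * (\<mu> + 1) * (?Y r * ?X r) + r * (?X r)\<^sup>2"
      using elim by (simp add: distrib_left right_diff_distrib power2_eq_square)
    then show ?case by (simp add: distrib_left)
  qed
  from Lim_transform_eventually[OF l this] show ?thesis by (simp add: amp_def add.assoc)
qed

lemma amp_add_nat:
  assumes "\<mu> \<ge> 0" "amp \<mu> L"
  shows "amp (\<mu> + real n) L"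
proof (induction n)
  case (Suc n)
  then show ?case using amp_add1[of "\<mu> + real n" L] assms by (simp add: algebra_simps)
qed (use assms in simp)

lemma isCont_tendsto_at_right:
  fixes f :: "real \<Rightarrow> real"
  shows "isCont f a \<Longrightarrow> (f \<longlongrightarrow> f a) (at_right a)"
  by (simp add: isCont_def filterlim_at_split)

lemma tendsto_bessel_J_at_0:
  assumes "\<mu> > 0"
  shows "(bessel_J \<mu> \<longlongrightarrow> 0) (at_right 0)"
proof -
  have "((\<lambda>r. (r / 2) powr \<mu> / Gamma (\<mu> + 1) * hyp \<mu> (r\<^sup>2 / 4)) \<longlongrightarrow> 0 / Gamma (\<mu> + 1) * hyp \<mu> (0\<^sup>2 / 4)) (at_right 0)"
  proof (intro tendsto_mult tendsto_divide tendsto_const)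
    show "((\<lambda>r. (r / 2) powr \<mu>) \<longlongrightarrow> 0) (at_right 0)" using assms by real_asymp
    have "isCont (\<lambda>r. hyp \<mu> (r\<^sup>2 / 4)) 0"
      using assms by (intro isCont_o2[OF _ isCont_hyp] continuous_intros) auto
    then show "((\<lambda>r. hyp \<mu> (r\<^sup>2 / 4)) \<longlongrightarrow> hyp \<mu> (0\<^sup>2 / 4)) (at_right 0)"
      by (rule isCont_tendsto_at_right)
    show "Gamma (\<mu> + 1) \<noteq> 0" using assms by (intro order.strict_implies_not_eq[OF Gamma_real_pos, symmetric]) simp
  qed
  moreover have "\<forall>\<^sub>F r in at_right 0. (r / 2) powr \<mu> / Gamma (\<mu> + 1) * hyp \<mu> (r\<^sup>2 / 4) = bessel_J \<mu> r"
    using eventually_at_right_less[of 0] by eventually_elim (use assms in \<open>simp add: bessel_J_eq\<close>)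
  ultimately show ?thesis by (auto intro: Lim_transform_eventually)
qed

section \<open>Closed forms for half-integer order and the amplitudes of orders 1/2 and 0\<close>

lemma Gamma_3_half: "Gamma (3 / 2 :: real) = sqrt pi / 2"
  using Gamma_plus1[of "1 / 2 :: real"] Gamma_one_half_real by (force elim!: nonpos_Ints_cases)

text \<open>\<open>u r = sqrt r * bessel_J (1 / 2) r\<close> solves \<open>u'' + u = 0\<close>.\<close>

lemma bessel_J_half:
  assumes "r > 0"
  shows "bessel_J (1 / 2) r = sqrt (2 / pi) * sin r / sqrt r"
proof -
  define u where "u = (\<lambda>r. sqrt r * bessel_J (1 / 2) r)"
  define v where "v = (\<lambda>r. bessel_J (1 / 2) r / sqrt r - sqrt r * bessel_J (3 / 2) r)"
  have du: "(u has_real_derivative v r) (at r)" if "r > 0" for r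
  proof -
    have "(u has_real_derivative (inverse (sqrt r) / 2 * bessel_J (1 / 2) r
        + (1 / 2 / r * bessel_J (1 / 2) r - bessel_J (1 / 2 + 1) r) * sqrt r)) (at r)"
      unfolding u_def using that
      by (intro DERIV_mult has_real_derivative_bessel_J DERIV_real_sqrt) auto
    moreover have "inverse (sqrt r) / 2 * bessel_J (1 / 2) r
        + (1 / 2 / r * bessel_J (1 / 2) r - bessel_J (1 / 2 + 1) r) * sqrt r = v r"
      using that real_sqrt_mult_self[of r] by (simp add: v_def field_simps)
    ultimately show ?thesis by simp
  qed
  have dv: "(v has_real_derivative - u r) (at r)" if "r > 0" for r
  proof -
    have "(v has_real_derivative ((1 / 2 / r * bessel_J (1 / 2) r - bessel_J (1 / 2 + 1) r) * sqrt r
          - bessel_J (1 / 2) r * (inverse (sqrt r) / 2)) / (sqrt r * sqrt r)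
        - (inverse (sqrt r) / 2 * bessel_J (3 / 2) r
          + (bessel_J (1 / 2) r - (1 / 2 + 1) / r * bessel_J (3 / 2) r) * sqrt r)) (at r)"
      unfolding v_def using that has_real_derivative_bessel_J_add1[of "1 / 2" r]
      by (intro DERIV_diff DERIV_divide DERIV_mult has_real_derivative_bessel_J DERIV_real_sqrt) auto
    moreover have "((1 / 2 / r * bessel_J (1 / 2) r - bessel_J (1 / 2 + 1) r) * sqrt r
          - bessel_J (1 / 2) r * (inverse (sqrt r) / 2)) / (sqrt r * sqrt r)
        - (inverse (sqrt r) / 2 * bessel_J (3 / 2) r
          + (bessel_J (1 / 2) r - (1 / 2 + 1) / r * bessel_J (3 / 2) r) * sqrt r) = - u r"
    proof -
      have "((1 / 2 / (s * s) * a - b) * s - a * (inverse s / 2)) / (s * s)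
          - (inverse s / 2 * b + (a - (1 / 2 + 1) / (s * s) * b) * s) = - (s * a)" if "s > 0" for a b s :: real
        using that by (simp add: field_simps)
      from this[of "sqrt r" "bessel_J (1 / 2) r" "bessel_J (3 / 2) r"] show ?thesis
        using that by (simp add: u_def)
    qed
    ultimately show ?thesis by simp
  qed
  have lu: "(u \<longlongrightarrow> 0) (at_right 0)"
  proof -
    have "((\<lambda>r. sqrt r * bessel_J (1 / 2) r) \<longlongrightarrow> sqrt 0 * 0) (at_right 0)"
      by (intro tendsto_mult tendsto_bessel_J_at_0 tendsto_real_sqrt) auto
    then show ?thesis by (simp add: u_def)
  qed
  have lv: "(v \<longlongrightarrow> sqrt (2 / pi)) (at_right 0)"
  proof -
    have "isCont (\<lambda>r. hyp (1 / 2) (r\<^sup>2 / 4)) 0"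
      by (intro isCont_o2[OF _ isCont_hyp] continuous_intros) auto
    then have h: "((\<lambda>r. hyp (1 / 2) (r\<^sup>2 / 4)) \<longlongrightarrow> 1) (at_right 0)"
      using isCont_tendsto_at_right by force
    have "((\<lambda>r. sqrt (2 / pi) * hyp (1 / 2) (r\<^sup>2 / 4) - sqrt r * bessel_J (3 / 2) r)
        \<longlongrightarrow> sqrt (2 / pi) * 1 - sqrt 0 * 0) (at_right 0)"
      by (intro tendsto_intros h tendsto_bessel_J_at_0) auto
    moreover have "\<forall>\<^sub>F r in at_right 0. sqrt (2 / pi) * hyp (1 / 2) (r\<^sup>2 / 4) - sqrt r * bessel_J (3 / 2) r = v r"
      using eventually_at_right_less[of 0]
      by eventually_elim
        (simp add: v_def bessel_J_eq Gamma_3_half powr_half_sqrt real_sqrt_divide field_simps)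
    ultimately show ?thesis by (auto intro: Lim_transform_eventually)
  qed
  \<comment> \<open>Variation of constants: \<open>u = p * cos + q * sin\<close> and
    \<open>v = q * cos - p * sin\<close>, so \<open>p\<close> and \<open>q\<close> are constant and
    are determined by their limits at 0.\<close>
  define p where "p = (\<lambda>r. u r * cos r - v r * sin r)"
  define q where "q = (\<lambda>r. u r * sin r + v r * cos r)"
  have const: "f r = c" if "\<And>r. r > 0 \<Longrightarrow> (f has_real_derivative 0) (at r)"
    "(f \<longlongrightarrow> c) (at_right 0)" for f :: "real \<Rightarrow> real" and c
  proof -
    have "\<exists>c'. \<forall>x\<in>{0<..}. f x = c'"
      by (rule has_field_derivative_zero_constant) (use that in \<open>auto intro: has_field_derivative_at_within\<close>)
    then obtain c' where c': "\<And>x. x > 0 \<Longrightarrow> f x = c'" by auto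
    have "\<forall>\<^sub>F x in at_right 0. f x = c'" using eventually_at_right_less[of 0] by eventually_elim (simp add: c')
    then have "(f \<longlongrightarrow> c') (at_right 0)" by (rule tendsto_eventually)
    then have "c' = c" using that(2) by (intro tendsto_unique[of "at_right (0::real)" f]) auto
    then show ?thesis using c' assms by simp
  qed
  have "p r = 0"
  proof (rule const[of p])
    fix r :: real assume r: "r > 0"
    show "(p has_real_derivative 0) (at r)" unfolding p_def
      by (rule DERIV_cong[OF DERIV_diff[OF DERIV_mult[OF du[OF r] DERIV_cos] DERIV_mult[OF dv[OF r] DERIV_sin]]])
        (simp add: algebra_simps)
  next
    show "(p \<longlongrightarrow> 0) (at_right 0)" unfolding p_def
      using tendsto_diff[OF tendsto_mult[OF lu tendsto_cos[OF tendsto_ident_at]] tendsto_mult[OF lv tendsto_sin[OF tendsto_ident_at]]]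
      by simp
  qed
  moreover have "q r = sqrt (2 / pi)"
  proof (rule const[of q])
    fix r :: real assume r: "r > 0"
    show "(q has_real_derivative 0) (at r)" unfolding q_def
      by (rule DERIV_cong[OF DERIV_add[OF DERIV_mult[OF du[OF r] DERIV_sin] DERIV_mult[OF dv[OF r] DERIV_cos]]])
        (simp add: algebra_simps)
  next
    show "(q \<longlongrightarrow> sqrt (2 / pi)) (at_right 0)" unfolding q_def
      using tendsto_add[OF tendsto_mult[OF lu tendsto_sin[OF tendsto_ident_at]] tendsto_mult[OF lv tendsto_cos[OF tendsto_ident_at]]]
      by simp
  qed
  ultimately have "u r * (cos r * cos r + sin r * sin r) = sqrt (2 / pi) * sin r"
    unfolding p_def q_def by algebra
  then have "u r = sqrt (2 / pi) * sin r"
    using sin_cos_squared_add3[of r] by simp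
  then show ?thesis using assms by (simp add: u_def field_simps)
qed

lemma bessel_J_3_half:
  assumes "r > 0"
  shows "bessel_J (3 / 2) r = sqrt (2 / pi) * (sin r / r - cos r) / sqrt r"
proof -
  have d: "(bessel_J (1 / 2) has_real_derivative 1 / 2 / r * bessel_J (1 / 2) r - bessel_J (3 / 2) r) (at r)"
    using has_real_derivative_bessel_J[of "1 / 2" r] assms by simp
  have "((\<lambda>r. sqrt (2 / pi) * sin r / sqrt r) has_real_derivative
      ((sqrt (2 / pi) * cos r) * sqrt r - sqrt (2 / pi) * sin r * (inverse (sqrt r) / 2)) / (sqrt r * sqrt r)) (at r)"
    using assms by (intro DERIV_divide DERIV_cmult DERIV_sin DERIV_real_sqrt) auto
  moreover have "\<forall>\<^sub>F s in nhds r. bessel_J (1 / 2) s = sqrt (2 / pi) * sin s / sqrt s"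
    using eventually_nhds_in_open[of "{0<..}" r] assms
    by (auto elim!: eventually_mono simp: bessel_J_half)
  ultimately have "(bessel_J (1 / 2) has_real_derivative
      ((sqrt (2 / pi) * cos r) * sqrt r - sqrt (2 / pi) * sin r * (inverse (sqrt r) / 2)) / (sqrt r * sqrt r)) (at r)"
    by (subst DERIV_cong_ev[OF refl _ refl]) auto
  with d have "1 / 2 / r * bessel_J (1 / 2) r - bessel_J (3 / 2) r
      = ((sqrt (2 / pi) * cos r) * sqrt r - sqrt (2 / pi) * sin r * (inverse (sqrt r) / 2)) / (sqrt r * sqrt r)"
    by (rule DERIV_unique)
  moreover have "sqrt r * (sqrt r * x) = r * x" for x using assms by (simp add: mult.assoc[symmetric])
  ultimately show ?thesis using assms by (simp add: bessel_J_half field_simps)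
qed

lemma amp_half: "amp (1 / 2) (2 / pi)"
proof -
  have "((\<lambda>r. 2 / pi * (1 + (sin r / r)\<^sup>2 - 2 * cos r * (sin r / r))) \<longlongrightarrow> 2 / pi * (1 + 0\<^sup>2 - 0)) at_top"
  proof (intro tendsto_intros)
    show s: "((\<lambda>r. sin r / r) \<longlongrightarrow> 0) (at_top :: real filter)" by real_asymp
    show "((\<lambda>r. 2 * cos r * (sin r / r)) \<longlongrightarrow> 0) (at_top :: real filter)" by real_asymp
  qed
  moreover have "\<forall>\<^sub>F r in at_top. 2 / pi * (1 + (sin r / r)\<^sup>2 - 2 * cos r * (sin r / r))
     = r * ((bessel_J (1 / 2) r)\<^sup>2 + (bessel_J (1 / 2 + 1) r)\<^sup>2)"
    using eventually_gt_at_top[of 0]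
  proof eventually_elim
    case (elim r)
    have "r * ((bessel_J (1 / 2) r)\<^sup>2 + (bessel_J (1 / 2 + 1) r)\<^sup>2)
        = 2 / pi * ((sin r)\<^sup>2 + (sin r / r - cos r)\<^sup>2)"
      using elim by (simp add: bessel_J_half bessel_J_3_half power_mult_distrib power_divide distrib_left)
    also have "(sin r)\<^sup>2 + (sin r / r - cos r)\<^sup>2 = 1 + (sin r / r)\<^sup>2 - 2 * cos r * (sin r / r)"
      by (simp add: power2_diff sin_squared_eq)
    finally show ?case by simp
  qed
  ultimately show ?thesis unfolding amp_def by (auto intro: Lim_transform_eventually)
qed

lemma bessel_J_0_eq: "r > 0 \<Longrightarrow> bessel_J 0 r = hyp 0 (r\<^sup>2 / 4)"
  by (simp add: bessel_J_eq)

lemma bessel_J_1_eq: "r > 0 \<Longrightarrow> bessel_J 1 r = r / 2 * hyp 1 (r\<^sup>2 / 4)"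
  using Gamma_fact[of 1, where 'a = real] by (simp add: bessel_J_eq)

text \<open>The energy \<open>u'\<^sup>2 + (1 + 1 / (4 * r\<^sup>2)) * u\<^sup>2\<close> of \<open>u = sqrt r * bessel_J 0 r\<close> decreases to \<open>L\<close>,
  so its value at \<open>r = 5\<close> is an upper bound for \<open>L\<close>.\<close>

lemma amp_0: obtains L where "amp 0 L" "L \<le> 16 / 25"
proof -
  define E where "E = (\<lambda>r. r * ((bessel_J 0 r)\<^sup>2 + (bessel_J 1 r)\<^sup>2) - bessel_J 0 r * bessel_J 1 r + (bessel_J 0 r)\<^sup>2 / (2 * r))"
  have E_alt: "E r = r * (bessel_J 1 r - bessel_J 0 r / (2 * r))\<^sup>2 + (r + 1 / (4 * r)) * (bessel_J 0 r)\<^sup>2" if "r > 0" for r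
    using that by (simp add: E_def field_simps power2_eq_square)
  have E_lower: "r * (bessel_J 0 r)\<^sup>2 \<le> E r" "r * (bessel_J 1 r - bessel_J 0 r / (2 * r))\<^sup>2 \<le> E r" "0 \<le> E r" if "r > 0" for r
    using that by (auto simp: E_alt add_nonneg_nonneg distrib_right)
  have dE: "(E has_real_derivative - (bessel_J 0 r)\<^sup>2 / (2 * r\<^sup>2)) (at r)" if "r > 0" for r
  proof -
    let ?a = "bessel_J 0 r" and ?b = "bessel_J 1 r"
    have d0: "(bessel_J 0 has_real_derivative - ?b) (at r)"
      using has_real_derivative_bessel_J[of 0 r] that by simp
    have d1: "(bessel_J 1 has_real_derivative ?a - ?b / r) (at r)"
      using has_real_derivative_bessel_J_add1[of 0 r] that by simp
    have alg: "(1 * (a\<^sup>2 + b\<^sup>2) + (2 * (- b * a) + 2 * ((a - b / r) * b)) * r)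
        - (- b * b + (a - b / r) * a) + (2 * (- b * a) * (2 * r) - a\<^sup>2 * 2) / (2 * r * (2 * r))
        = - a\<^sup>2 / (2 * r\<^sup>2)" for a b :: real
      using that by (simp add: divide_simps power2_eq_square) (simp add: algebra_simps)
    have "(E has_real_derivative (1 * (?a\<^sup>2 + ?b\<^sup>2) + (2 * (- ?b * ?a) + 2 * ((?a - ?b / r) * ?b)) * r)
        - (- ?b * ?b + (?a - ?b / r) * ?a) + (2 * (- ?b * ?a) * (2 * r) - ?a\<^sup>2 * 2) / (2 * r * (2 * r))) (at r)"
      unfolding E_def using that DERIV_power[OF d0, of 2] DERIV_power[OF d1, of 2]
      by (intro DERIV_add DERIV_diff DERIV_mult DERIV_divide d0 d1 DERIV_ident DERIV_cmult_Id) simp_all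
    then show ?thesis unfolding alg .
  qed
  have anti: "E s \<le> E r" if "0 < r" "r \<le> s" for r s
  proof (rule DERIV_nonpos_imp_nonincreasing[OF that(2)])
    fix t assume "r \<le> t" "t \<le> s"
    then show "\<exists>y. (E has_real_derivative y) (at t) \<and> y \<le> 0" using dE[of t] that
      by (intro exI[of _ "- (bessel_J 0 t)\<^sup>2 / (2 * t\<^sup>2)"]) auto
  qed
  define L where "L = Inf (E ` {5..})"
  have bb: "bdd_below (E ` {5..})" by (rule bdd_belowI[of _ 0]) (auto intro: E_lower)
  have "(E \<longlongrightarrow> L) at_top"
  proof (rule decreasing_tendsto)
    show "\<forall>\<^sub>F r in at_top. L \<le> E r"
      using eventually_ge_at_top[of 5] by eventually_elim (auto simp: L_def intro!: cInf_lower bb)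
    fix x assume "L < x"
    then obtain r where r: "r \<ge> 5" "E r < x" unfolding L_def using bb by (auto simp: cInf_less_iff)
    show "\<forall>\<^sub>F s in at_top. E s < x"
      using eventually_ge_at_top[of r]
    proof eventually_elim
      case (elim s)
      then show ?case using anti[of r s] r by linarith
    qed
  qed
  have b: "\<forall>\<^sub>F r in at_top. r * (bessel_J 0 r)\<^sup>2 \<le> E 5"
    using eventually_ge_at_top[of 5]
  proof eventually_elim
    case (elim s)
    then show ?case using anti[of 5 s] E_lower(1)[of s] by linarith
  qed
  then have j0: "(bessel_J 0 \<longlongrightarrow> 0) at_top" by (rule tendsto_0_of_weighted_bounded)
  have b': "\<forall>\<^sub>F r in at_top. r * (bessel_J 1 r - bessel_J 0 r / (2 * r))\<^sup>2 \<le> E 5"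
    using eventually_ge_at_top[of 5]
  proof eventually_elim
    case (elim s)
    then show ?case using anti[of 5 s] E_lower(2)[of s] by linarith
  qed
  have "((\<lambda>r. bessel_J 1 r - bessel_J 0 r / (2 * r)) \<longlongrightarrow> 0) at_top"
    using b' by (rule tendsto_0_of_weighted_bounded)
  moreover have "((\<lambda>r. bessel_J 0 r * (1 / (2 * r))) \<longlongrightarrow> 0 * 0) at_top"
    by (intro tendsto_mult j0) real_asymp
  ultimately have "((\<lambda>r. (bessel_J 1 r - bessel_J 0 r / (2 * r)) + bessel_J 0 r * (1 / (2 * r))) \<longlongrightarrow> 0 + 0 * 0) at_top"
    by (rule tendsto_add)
  then have j1: "(bessel_J 1 \<longlongrightarrow> 0) at_top" by simp
  have "((\<lambda>r. E r + bessel_J 0 r * bessel_J 1 r - (bessel_J 0 r)\<^sup>2 * (1 / (2 * r))) \<longlongrightarrow> L + 0 * 0 - 0\<^sup>2 * 0) at_top"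
    by (intro tendsto_add tendsto_diff tendsto_mult tendsto_power j0 j1 \<open>(E \<longlongrightarrow> L) at_top\<close>) real_asymp
  then have "amp 0 L" unfolding amp_def E_def by simp
  moreover have "L \<le> 16 / 25"
  proof -
    \<comment> \<open>The point 5 corresponds to \<open>x = 25 / 4\<close>, where 13 and 14 terms
      enclose both series closely enough. \<open>E 5\<close> is about 0.6392, between
      \<open>2 / pi\<close> and \<open>16 / 25\<close>.\<close>
    let ?x = "25 / 4 :: real"
    have "hyp 0 ?x \<ge> hyp_partial 0 14 ?x" "hyp 0 ?x \<le> hyp_partial 0 13 ?x"
      "hyp 1 ?x \<ge> hyp_partial 1 14 ?x" "hyp 1 ?x \<le> hyp_partial 1 13 ?x"
      by (auto intro: hyp_partial_le_hyp hyp_le_hyp_partial)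
    then have h: "- 1777 / 10000 \<le> hyp 0 ?x" "hyp 0 ?x \<le> - 1775 / 10000"
       "- 1311 / 10000 \<le> hyp 1 ?x" "hyp 1 ?x \<le> - 1310 / 10000"
      by (simp_all add: hyp_partial_eq_horner eval_nat_numeral)
    have j: "bessel_J 0 5 = hyp 0 ?x" "bessel_J 1 5 = 5 / 2 * hyp 1 ?x"
      by (simp_all add: bessel_J_0_eq bessel_J_1_eq power2_eq_square)
    have "(- hyp 0 ?x)\<^sup>2 \<le> (1777 / 10000)\<^sup>2" using h by (intro power_mono) auto
    moreover have "(- bessel_J 1 5 + bessel_J 0 5 / 10)\<^sup>2 \<le> (32775 / 100000 - 1775 / 100000)\<^sup>2"
      using h unfolding j by (intro power_mono) auto
    ultimately have "E 5 \<le> 16 / 25" unfolding E_alt[of 5, simplified] j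
      by (simp add: power2_commute power2_eq_square algebra_simps)
    moreover have "L \<le> E 5" unfolding L_def by (intro cInf_lower bb) auto
    ultimately show ?thesis by simp
  qed
  ultimately show ?thesis by (rule that)
qed

section \<open>Upper bounds for Bessel functions\<close>

lemma amp_nonneg:
  assumes "amp \<mu> L"
  shows "L \<ge> 0"
proof (rule tendsto_lowerbound)
  show "((\<lambda>r. r * ((bessel_J \<mu> r)\<^sup>2 + (bessel_J (\<mu> + 1) r)\<^sup>2)) \<longlongrightarrow> L) at_top"
    using assms by (simp add: amp_def)
  show "\<forall>\<^sub>F r in at_top. 0 \<le> r * ((bessel_J \<mu> r)\<^sup>2 + (bessel_J (\<mu> + 1) r)\<^sup>2)"
    using eventually_ge_at_top[of 0] by eventually_elim simp
qed simp

text \<open>Sonin's argument for \<open>v = J / sqrt A\<close> in the variable \<open>\<theta>\<close> with \<open>d\<theta> = dr / (r * A)\<close>: there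
  \<open>v'' + \<kappa> * v = 0\<close>, and \<open>v\<^sup>2 + v'\<^sup>2 / \<kappa>\<close> increases to \<open>L\<close> because \<open>\<kappa>\<close> decreases.\<close>

lemma bessel_modulus_bound:
  fixes A A1 A2 A3 :: "real \<Rightarrow> real"
  assumes \<mu>: "\<mu> \<ge> 0" and amp: "amp \<mu> L" and R: "R \<ge> 0"
    and pos: "\<And>r. r > R \<Longrightarrow> A r > 0"
    and dA: "\<And>r. r > R \<Longrightarrow> (A has_real_derivative A1 r / r) (at r)"
    and dA1: "\<And>r. r > R \<Longrightarrow> (A1 has_real_derivative A2 r / r) (at r)"
    and dA2: "\<And>r. r > R \<Longrightarrow> (A2 has_real_derivative A3 r / r) (at r)"
    and le: "\<And>r. r > R \<Longrightarrow> 2 * r\<^sup>2 * A r + 2 * (r\<^sup>2 - \<mu>\<^sup>2) * A1 r + A3 r / 2 \<le> 0"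
    and lA: "((\<lambda>r. r * A r) \<longlongrightarrow> 1) at_top"
    and lA1: "((\<lambda>r. r * A1 r) \<longlongrightarrow> -1) at_top"
    and lA2: "((\<lambda>r. r * A2 r) \<longlongrightarrow> 1) at_top"
    and r: "r > R"
  shows "(bessel_J \<mu> r)\<^sup>2 \<le> L * A r"
proof -
  \<comment> \<open>\<open>A1\<close>, \<open>A2\<close>, \<open>A3\<close> arise from
    \<open>A\<close> by repeated application of \<open>r * d/dr\<close>. In these terms
    \<open>\<kappa>\<close> is the potential of the transformed equation, \<open>\<kappa>'\<close>
    is \<open>r * d/dr\<close> of it, and the premise \<open>le\<close> says that
    \<open>\<kappa>' / A\<close> is nonpositive.\<close>
  define \<kappa> where "\<kappa> = (\<lambda>r. (r\<^sup>2 - \<mu>\<^sup>2) * (A r)\<^sup>2 + A r * A2 r / 2 - (A1 r)\<^sup>2 / 4)"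
  define \<kappa>' where "\<kappa>' = (\<lambda>r. A r * (2 * r\<^sup>2 * A r + 2 * (r\<^sup>2 - \<mu>\<^sup>2) * A1 r + A3 r / 2))"
  have d\<kappa>: "(\<kappa> has_real_derivative \<kappa>' r / r) (at r)" if "r > R" for r
  proof -
    have "((\<lambda>r. r\<^sup>2 - \<mu>\<^sup>2) has_real_derivative 2 * r) (at r)" by (auto intro!: derivative_eq_intros)
    then have "(\<kappa> has_real_derivative
        (2 * r * (A r)\<^sup>2 + 2 * (A1 r / r * A r) * (r\<^sup>2 - \<mu>\<^sup>2) + (A1 r / r * A2 r + A3 r / r * A r) / 2
          - 2 * (A2 r / r * A1 r) / 4)) (at r)"
      unfolding \<kappa>_def using \<open>r > R\<close> that DERIV_power[OF dA, of r 2] DERIV_power[OF dA1, of r 2]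
      by (intro DERIV_add DERIV_diff DERIV_mult DERIV_cdivide dA dA1 dA2) simp_all
    moreover have "2 * r * (A r)\<^sup>2 + 2 * (A1 r / r * A r) * (r\<^sup>2 - \<mu>\<^sup>2) + (A1 r / r * A2 r + A3 r / r * A r) / 2
          - 2 * (A2 r / r * A1 r) / 4 = \<kappa>' r / r"
      using that R by (simp add: \<kappa>'_def field_simps power2_eq_square)
    ultimately show ?thesis by simp
  qed
  have \<kappa>'_le: "\<kappa>' r \<le> 0" if "r > R" for r
    unfolding \<kappa>'_def using pos[OF that] le[OF that] by (intro mult_nonneg_nonpos) auto
  have \<kappa>_anti: "\<kappa> s \<le> \<kappa> r" if "R < r" "r \<le> s" for r s
  proof (rule DERIV_nonpos_imp_nonincreasing[OF that(2)])
    fix t assume t: "r \<le> t" "t \<le> s"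
    then show "\<exists>y. (\<kappa> has_real_derivative y) (at t) \<and> y \<le> 0"
      using d\<kappa>[of t] \<kappa>'_le[of t] that R by (intro exI[of _ "\<kappa>' t / t"]) (auto intro!: divide_nonpos_nonneg)
  qed
  have linv: "((\<lambda>r. 1 / r) \<longlongrightarrow> 0) (at_top :: real filter)" by real_asymp
  have l\<kappa>: "(\<kappa> \<longlongrightarrow> 1) at_top"
  proof -
    have "((\<lambda>r. (1 - (\<mu> * (1 / r))\<^sup>2) * (r * A r)\<^sup>2 + (r * A r) * (r * A2 r) * (1 / r)\<^sup>2 / 2 - (r * A1 r)\<^sup>2 * (1 / r)\<^sup>2 / 4)
        \<longlongrightarrow> (1 - (\<mu> * 0)\<^sup>2) * 1\<^sup>2 + 1 * 1 * 0\<^sup>2 / 2 - (-1)\<^sup>2 * 0\<^sup>2 / 4) at_top"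
      by (intro tendsto_intros lA lA1 lA2 linv) auto
    then have l: "((\<lambda>r. (1 - (\<mu> * (1 / r))\<^sup>2) * (r * A r)\<^sup>2 + (r * A r) * (r * A2 r) * (1 / r)\<^sup>2 / 2 - (r * A1 r)\<^sup>2 * (1 / r)\<^sup>2 / 4)
        \<longlongrightarrow> 1) at_top" by simp
    have "\<forall>\<^sub>F r in at_top. (1 - (\<mu> * (1 / r))\<^sup>2) * (r * A r)\<^sup>2 + (r * A r) * (r * A2 r) * (1 / r)\<^sup>2 / 2 - (r * A1 r)\<^sup>2 * (1 / r)\<^sup>2 / 4 = \<kappa> r"
      using eventually_gt_at_top[of 0]
      by eventually_elim (simp add: \<kappa>_def power_mult_distrib power_divide divide_simps power2_eq_square)
    with l show ?thesis by (rule Lim_transform_eventually)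
  qed
  \<comment> \<open>A decreasing function stays above its limit; in particular
    \<open>\<kappa>\<close> may be divided by.\<close>
  have \<kappa>1: "\<kappa> r \<ge> 1" if "r > R" for r
    by (rule tendsto_upperbound[OF l\<kappa> eventually_mono[OF eventually_ge_at_top[of r]]]) (use \<kappa>_anti[OF that] in auto)
  \<comment> \<open>With \<open>v = J / sqrt A\<close>, the derivative of \<open>v\<close> in
    \<open>\<theta>\<close> is \<open>Q / sqrt A\<close>. Hence \<open>G\<close> is the Sonin
    quantity \<open>v^2 + v'^2 / \<kappa>\<close>.\<close>
  define Q where "Q = (\<lambda>r. A r * bessel_D \<mu> r - A1 r * bessel_J \<mu> r / 2)"
  define G where "G = (\<lambda>r. (bessel_J \<mu> r)\<^sup>2 / A r + (Q r)\<^sup>2 / (A r * \<kappa> r))"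
  have dG: "(G has_real_derivative - ((Q r)\<^sup>2 * \<kappa>' r) / (A r * (\<kappa> r)\<^sup>2) / r) (at r)" if "r > R" for r
  proof -
    have r0: "r > 0" using that R by simp
    have nz: "A r \<noteq> 0" "\<kappa> r \<noteq> 0" "r \<noteq> 0" using pos[OF that] \<kappa>1[OF that] r0 by auto
    let ?X = "bessel_J \<mu> r" and ?Y = "bessel_D \<mu> r"
    have dX: "(bessel_J \<mu> has_real_derivative ?Y / r) (at r)"
      by (rule has_real_derivative_bessel_J_theta[OF \<mu> r0])
    have dY: "(bessel_D \<mu> has_real_derivative - (r\<^sup>2 - \<mu>\<^sup>2) * ?X / r) (at r)"
      by (rule has_real_derivative_bessel_D[OF \<mu> r0])
    have "(Q has_real_derivative ((A1 r / r * ?Y + (- (r\<^sup>2 - \<mu>\<^sup>2) * ?X / r) * A r)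
        - (A2 r / r * ?X + ?Y / r * A1 r) / 2)) (at r)"
      unfolding Q_def by (intro DERIV_diff DERIV_mult DERIV_cdivide dX dY dA dA1 that)
    also have "(A1 r / r * ?Y + (- (r\<^sup>2 - \<mu>\<^sup>2) * ?X / r) * A r) - (A2 r / r * ?X + ?Y / r * A1 r) / 2
        = (A1 r * Q r / (2 * A r) - \<kappa> r * ?X / A r) / r"
      using nz by (simp add: Q_def \<kappa>_def divide_simps power2_eq_square) (simp add: algebra_simps)
    finally have dQ: "(Q has_real_derivative (A1 r * Q r / (2 * A r) - \<kappa> r * ?X / A r) / r) (at r)" .
    have "(G has_real_derivative
        ((2 * (?Y / r * ?X)) * A r - ?X\<^sup>2 * (A1 r / r)) / (A r * A r)
        + ((2 * ((A1 r * Q r / (2 * A r) - \<kappa> r * ?X / A r) / r * Q r)) * (A r * \<kappa> r)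
           - (Q r)\<^sup>2 * (A1 r / r * \<kappa> r + \<kappa>' r / r * A r)) / ((A r * \<kappa> r) * (A r * \<kappa> r))) (at r)"
      unfolding G_def using nz DERIV_power[OF dX, of 2] DERIV_power[OF dQ, of 2]
      by (intro DERIV_add DERIV_mult DERIV_divide dA d\<kappa> that) simp_all
    also have "((2 * (?Y / r * ?X)) * A r - ?X\<^sup>2 * (A1 r / r)) / (A r * A r)
         = 2 * ?X * Q r / (A r)\<^sup>2 / r"
      using nz by (simp add: Q_def divide_simps power2_eq_square) (simp add: algebra_simps)
    also have "((2 * ((A1 r * q / (2 * A r) - \<kappa> r * ?X / A r) / r * q)) * (A r * \<kappa> r)
           - q\<^sup>2 * (A1 r / r * \<kappa> r + \<kappa>' r / r * A r)) / ((A r * \<kappa> r) * (A r * \<kappa> r))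
         = - (2 * ?X * q / (A r)\<^sup>2 / r) - (q\<^sup>2 * \<kappa>' r) / (A r * (\<kappa> r)\<^sup>2) / r" for q
      using nz by (simp add: divide_simps power2_eq_square) (simp add: algebra_simps)
    finally show ?thesis by simp
  qed
  have G_mono: "G r \<le> G s" if "R < r" "r \<le> s" for r s
  proof (rule DERIV_nonneg_imp_nondecreasing[OF that(2)])
    fix t assume t: "r \<le> t" "t \<le> s"
    have "- ((Q t)\<^sup>2 * \<kappa>' t) / (A t * (\<kappa> t)\<^sup>2) / t \<ge> 0"
    proof -
      have "(Q t)\<^sup>2 * \<kappa>' t \<le> 0" using \<kappa>'_le[of t] t that by (intro mult_nonneg_nonpos) auto
      moreover have "A t * (\<kappa> t)\<^sup>2 \<ge> 0" using pos[of t] t that by simp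
      ultimately show ?thesis using t that R by (intro divide_nonneg_nonneg) auto
    qed
    then show "\<exists>y. (G has_real_derivative y) (at t) \<and> 0 \<le> y" using dG[of t] t that by fastforce
  qed
  have "(G \<longlongrightarrow> L) at_top"
  proof -
    let ?X = "bessel_J \<mu>" and ?Y = "bessel_J (\<mu> + 1)"
    let ?\<alpha> = "\<lambda>r. r * A r" and ?\<beta> = "\<lambda>r. r * A1 r"
    note J0 = amp_tendsto_0[OF amp]
    have lim: "((\<lambda>r. r * ((?X r)\<^sup>2 + (?Y r)\<^sup>2)) \<longlongrightarrow> L) at_top" using amp by (simp add: amp_def)
    have ev: "\<forall>\<^sub>F r in at_top. r * ((?X r)\<^sup>2 + (?Y r)\<^sup>2) < L + 1"
      using lim by (rule order_tendstoD) simp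
    have "((\<lambda>r. ((?\<alpha> r)\<^sup>2 / \<kappa> r - 1) * (r * (?Y r)\<^sup>2)) \<longlongrightarrow> 0) at_top"
    proof (rule lim_null_mult_right_bounded)
      have "((\<lambda>r. (?\<alpha> r)\<^sup>2 / \<kappa> r - 1) \<longlongrightarrow> 1\<^sup>2 / 1 - 1) at_top"
        by (intro tendsto_intros lA l\<kappa>) auto
      then show "((\<lambda>r. (?\<alpha> r)\<^sup>2 / \<kappa> r - 1) \<longlongrightarrow> 0) at_top" by simp
      show "\<forall>\<^sub>F r in at_top. norm (r * (?Y r)\<^sup>2) \<le> L + 1"
        using ev eventually_gt_at_top[of 0]
      proof eventually_elim
        case (elim r)
        have "0 \<le> r * (?X r)\<^sup>2" "0 \<le> r * (?Y r)\<^sup>2" using elim by simp_all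
        then show ?case using elim(1) unfolding real_norm_def distrib_left by linarith
      qed
    qed
    then have "((\<lambda>r. (r * ((?X r)\<^sup>2 + (?Y r)\<^sup>2) + ((?\<alpha> r)\<^sup>2 / \<kappa> r - 1) * (r * (?Y r)\<^sup>2)
          + (((?\<alpha> r * \<mu> - ?\<beta> r / 2) * ?X r)\<^sup>2 * (1 / r) - 2 * ?\<alpha> r * (?\<alpha> r * \<mu> - ?\<beta> r / 2) * ?X r * ?Y r) / \<kappa> r) / ?\<alpha> r)
        \<longlongrightarrow> (L + 0 + (((1 * \<mu> - (-1) / 2) * 0)\<^sup>2 * 0 - 2 * 1 * (1 * \<mu> - (-1) / 2) * 0 * 0) / 1) / 1) at_top"
      by (intro tendsto_add tendsto_diff tendsto_mult tendsto_divide tendsto_power tendsto_const lim lA lA1 l\<kappa> J0 linv) auto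
    then have l: "((\<lambda>r. (r * ((?X r)\<^sup>2 + (?Y r)\<^sup>2) + ((?\<alpha> r)\<^sup>2 / \<kappa> r - 1) * (r * (?Y r)\<^sup>2)
          + (((?\<alpha> r * \<mu> - ?\<beta> r / 2) * ?X r)\<^sup>2 * (1 / r) - 2 * ?\<alpha> r * (?\<alpha> r * \<mu> - ?\<beta> r / 2) * ?X r * ?Y r) / \<kappa> r) / ?\<alpha> r)
        \<longlongrightarrow> L) at_top" by simp
    have "\<forall>\<^sub>F r in at_top. (r * ((?X r)\<^sup>2 + (?Y r)\<^sup>2) + ((?\<alpha> r)\<^sup>2 / \<kappa> r - 1) * (r * (?Y r)\<^sup>2)
          + (((?\<alpha> r * \<mu> - ?\<beta> r / 2) * ?X r)\<^sup>2 * (1 / r) - 2 * ?\<alpha> r * (?\<alpha> r * \<mu> - ?\<beta> r / 2) * ?X r * ?Y r) / \<kappa> r) / ?\<alpha> r = G r"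
      using eventually_gt_at_top[of R] eventually_gt_at_top[of 0]
    proof eventually_elim
      case (elim r)
      have nz: "A r \<noteq> 0" "\<kappa> r \<noteq> 0" "r \<noteq> 0" using pos[of r] \<kappa>1[of r] elim by auto
      have alg: "(r * (x\<^sup>2 + y\<^sup>2) + ((r * a)\<^sup>2 / k - 1) * (r * y\<^sup>2)
          + (((r * a * \<mu> - r * b / 2) * x)\<^sup>2 * (1 / r) - 2 * (r * a) * (r * a * \<mu> - r * b / 2) * x * y) / k) / (r * a)
          = x\<^sup>2 / a + (a * (\<mu> * x - r * y) - b * x / 2)\<^sup>2 / (a * k)"
        if "a \<noteq> 0" "k \<noteq> 0" for a k b x y :: real
        using that nz(3) by (simp add: divide_simps power2_eq_square) (simp add: algebra_simps)
      show ?case unfolding G_def Q_def bessel_D_def by (rule alg[OF nz(1,2)])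
    qed
    with l show ?thesis by (rule Lim_transform_eventually)
  qed
  then have "G r \<le> L"
    by (rule tendsto_lowerbound[OF _ eventually_mono[OF eventually_ge_at_top[of r]]]) (use G_mono[OF r] in auto)
  moreover have "(bessel_J \<mu> r)\<^sup>2 / A r \<le> G r"
    unfolding G_def using pos[OF r] \<kappa>1[OF r] by simp
  ultimately have "(bessel_J \<mu> r)\<^sup>2 / A r \<le> L" by simp
  then show ?thesis using pos[OF r] by (simp add: pos_divide_le_eq)
qed

text \<open>The choice \<open>A = 1 / sqrt (r^2 - \<mu>^2)\<close> is the WKB amplitude: it cancels
  the two leading terms of the monotonicity condition. What remains is \<open>A3 / 2\<close>, which
  is negative because of the factor \<open>r^4 + 10 * r^2 * \<mu>^2 + 4 * \<mu>^4\<close>.\<close>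

lemma bessel_J_square_le:
  assumes \<mu>: "\<mu> \<ge> 0" and amp: "amp \<mu> L" and r: "r > \<mu>"
  shows "(bessel_J \<mu> r)\<^sup>2 \<le> L / sqrt (r\<^sup>2 - \<mu>\<^sup>2)"
proof -
  define s where "s = (\<lambda>r. sqrt (r\<^sup>2 - \<mu>\<^sup>2))"
  have s: "s r > 0" "(s r)\<^sup>2 = r\<^sup>2 - \<mu>\<^sup>2" if "r > \<mu>" for r
  proof -
    have "\<mu>\<^sup>2 < r\<^sup>2" using that \<mu> by (intro power_strict_mono) auto
    then show "s r > 0" "(s r)\<^sup>2 = r\<^sup>2 - \<mu>\<^sup>2" by (auto simp: s_def)
  qed
  have ds: "(s has_real_derivative r / s r) (at r)" if "r > \<mu>" for r
    unfolding s_def using s[OF that]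
    by (auto intro!: derivative_eq_intros simp: s_def inverse_eq_divide)
  have "(bessel_J \<mu> r)\<^sup>2 \<le> L * (1 / s r)"
  proof (rule bessel_modulus_bound[where ?A1.0 = "\<lambda>r. - (r ^ 2) / s r ^ 3" and ?A2.0 = "\<lambda>r. - 2 * r ^ 2 / s r ^ 3 + 3 * r ^ 4 / s r ^ 5"
        and ?A3.0 = "\<lambda>r. - 4 * r ^ 2 / s r ^ 3 + 18 * r ^ 4 / s r ^ 5 - 15 * r ^ 6 / s r ^ 7", OF \<mu> amp \<mu> _ _ _ _ _ _ _ _ r])
    fix r assume r: "r > \<mu>"
    note s' = s[OF r] and ds' = ds[OF r]
    have r0: "r > 0" using r \<mu> by simp
    show "1 / s r > 0" using s' by simp
    show "((\<lambda>r. 1 / s r) has_real_derivative - (r ^ 2) / s r ^ 3 / r) (at r)"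
      by (rule derivative_eq_intros ds' refl | use s' r0 in \<open>simp add: field_simps eval_nat_numeral\<close>)+
    show "((\<lambda>r. - (r ^ 2) / s r ^ 3) has_real_derivative (- 2 * r ^ 2 / s r ^ 3 + 3 * r ^ 4 / s r ^ 5) / r) (at r)"
      by (rule derivative_eq_intros ds' refl | use s' r0 in \<open>simp add: field_simps eval_nat_numeral\<close>)+
    show "((\<lambda>r. - 2 * r ^ 2 / s r ^ 3 + 3 * r ^ 4 / s r ^ 5) has_real_derivative
       (- 4 * r ^ 2 / s r ^ 3 + 18 * r ^ 4 / s r ^ 5 - 15 * r ^ 6 / s r ^ 7) / r) (at r)"
      by (rule derivative_eq_intros ds' refl | use s' r0 in \<open>simp add: field_simps eval_nat_numeral\<close>)+
    have "2 * r\<^sup>2 * (1 / s r) + 2 * (r\<^sup>2 - \<mu>\<^sup>2) * (- (r ^ 2) / s r ^ 3) = 0"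
      unfolding s'(2)[symmetric] using s'(1) by (simp add: field_simps eval_nat_numeral)
    moreover have "- 4 * r ^ 2 / s r ^ 3 + 18 * r ^ 4 / s r ^ 5 - 15 * r ^ 6 / s r ^ 7
       = - (r ^ 2 / s r ^ 7) * (4 * ((s r)\<^sup>2)\<^sup>2 - 18 * r\<^sup>2 * (s r)\<^sup>2 + 15 * r ^ 4)"
      using s'(1) by (simp add: field_simps eval_nat_numeral)
    moreover have "4 * ((s r)\<^sup>2)\<^sup>2 - 18 * r\<^sup>2 * (s r)\<^sup>2 + 15 * r ^ 4 = r ^ 4 + 10 * r\<^sup>2 * \<mu>\<^sup>2 + 4 * \<mu> ^ 4"
      unfolding s'(2) by (simp add: algebra_simps eval_nat_numeral)
    moreover have "(r ^ 2 / s r ^ 7) * (r ^ 4 + 10 * r\<^sup>2 * \<mu>\<^sup>2 + 4 * \<mu> ^ 4) \<ge> 0"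
      using s'(1) \<mu> by (intro mult_nonneg_nonneg) auto
    ultimately show "2 * r\<^sup>2 * (1 / s r) + 2 * (r\<^sup>2 - \<mu>\<^sup>2) * (- (r ^ 2) / s r ^ 3) +
         (- 4 * r ^ 2 / s r ^ 3 + 18 * r ^ 4 / s r ^ 5 - 15 * r ^ 6 / s r ^ 7) / 2 \<le> 0"
      by (metis (no_types, lifting) add_0 divide_nonpos_pos mult_minus_left neg_le_0_iff_le zero_less_numeral)
  next
    show "((\<lambda>r. r * (1 / s r)) \<longlongrightarrow> 1) at_top" unfolding s_def by real_asymp
    show "((\<lambda>r. r * (- (r ^ 2) / s r ^ 3)) \<longlongrightarrow> - 1) at_top" unfolding s_def by real_asymp
    show "((\<lambda>r. r * (- 2 * r ^ 2 / s r ^ 3 + 3 * r ^ 4 / s r ^ 5)) \<longlongrightarrow> 1) at_top" unfolding s_def by real_asymp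
  qed
  then show ?thesis by (simp add: s_def)
qed

text \<open>Here \<open>A\<close> consists of the leading terms of Nicholson's expansion of \<open>J\<^sup>2 + Y\<^sup>2\<close>.\<close>

lemma bessel_J_square_le':
  assumes \<mu>: "\<mu> \<ge> 0" and amp: "amp \<mu> L" and c: "c = \<mu>\<^sup>2 - 1 / 4" "2 \<le> c" "c \<le> 6" and r: "r > 0"
  shows "r * (bessel_J \<mu> r)\<^sup>2 \<le> L * (1 + c / (2 * r\<^sup>2) + 3 * c * (c - 2) / (8 * r ^ 4))"
proof -
  \<comment> \<open>These coefficients annihilate the terms in \<open>1 / r\<close> and
    \<open>1 / r^3\<close> of the monotonicity condition. The remaining term
    \<open>b * (10 * c - 60) / r^5\<close> has the right sign for \<open>2 \<le> c \<le> 6\<close>,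
    that is, for \<open>3 / 2 \<le> \<mu> \<le> 5 / 2\<close>.\<close>
  define a b where "a = c / 2" and "b = 3 * c * (c - 2) / 8"
  have b: "b \<ge> 0" and a: "a \<ge> 0" using c by (auto simp: a_def b_def)
  have "(bessel_J \<mu> r)\<^sup>2 \<le> L * (1 / r + a / r ^ 3 + b / r ^ 5)"
  proof (rule bessel_modulus_bound[where ?A1.0 = "\<lambda>r. - 1 / r - 3 * a / r ^ 3 - 5 * b / r ^ 5"
      and ?A2.0 = "\<lambda>r. 1 / r + 9 * a / r ^ 3 + 25 * b / r ^ 5"
      and ?A3.0 = "\<lambda>r. - 1 / r - 27 * a / r ^ 3 - 125 * b / r ^ 5", OF \<mu> amp order_refl _ _ _ _ _ _ _ _ r])
    fix r :: real assume r: "r > 0"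
    show "1 / r + a / r ^ 3 + b / r ^ 5 > 0" using r a b by (simp add: add_pos_nonneg)
    show "((\<lambda>r. 1 / r + a / r ^ 3 + b / r ^ 5) has_real_derivative (- 1 / r - 3 * a / r ^ 3 - 5 * b / r ^ 5) / r) (at r)"
      by (rule derivative_eq_intros refl | use r in \<open>simp add: field_simps eval_nat_numeral\<close>)+
    show "((\<lambda>r. - 1 / r - 3 * a / r ^ 3 - 5 * b / r ^ 5) has_real_derivative (1 / r + 9 * a / r ^ 3 + 25 * b / r ^ 5) / r) (at r)"
      by (rule derivative_eq_intros refl | use r in \<open>simp add: field_simps eval_nat_numeral\<close>)+
    show "((\<lambda>r. 1 / r + 9 * a / r ^ 3 + 25 * b / r ^ 5) has_real_derivative (- 1 / r - 27 * a / r ^ 3 - 125 * b / r ^ 5) / r) (at r)"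
      by (rule derivative_eq_intros refl | use r in \<open>simp add: field_simps eval_nat_numeral\<close>)+
    have "2 * r\<^sup>2 * (1 / r + a / r ^ 3 + b / r ^ 5) + 2 * (r\<^sup>2 - \<mu>\<^sup>2) * (- 1 / r - 3 * a / r ^ 3 - 5 * b / r ^ 5)
       + (- 1 / r - 27 * a / r ^ 3 - 125 * b / r ^ 5) / 2 
       = (2 * c - 4 * a) / r + (a * (6 * c - 12) - 8 * b) / r ^ 3 + b * (10 * c - 60) / r ^ 5"
      using r unfolding c(1) by (simp add: field_simps eval_nat_numeral)
    also have "\<dots> = b * (10 * c - 60) / r ^ 5" by (simp add: a_def b_def field_simps)
    also have "\<dots> \<le> 0" using r b c by (intro divide_nonpos_pos mult_nonneg_nonpos) auto
    finally show "2 * r\<^sup>2 * (1 / r + a / r ^ 3 + b / r ^ 5) + 2 * (r\<^sup>2 - \<mu>\<^sup>2) * (- 1 / r - 3 * a / r ^ 3 - 5 * b / r ^ 5)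
       + (- 1 / r - 27 * a / r ^ 3 - 125 * b / r ^ 5) / 2 \<le> 0" .
  next
    show "((\<lambda>r. r * (1 / r + a / r ^ 3 + b / r ^ 5)) \<longlongrightarrow> 1) at_top" by real_asymp
    show "((\<lambda>r. r * (- 1 / r - 3 * a / r ^ 3 - 5 * b / r ^ 5)) \<longlongrightarrow> - 1) at_top" by real_asymp
    show "((\<lambda>r. r * (1 / r + 9 * a / r ^ 3 + 25 * b / r ^ 5)) \<longlongrightarrow> 1) at_top" by real_asymp
  qed
  then have "r * (bessel_J \<mu> r)\<^sup>2 \<le> r * (L * (1 / r + a / r ^ 3 + b / r ^ 5))" using r by simp
  also have "\<dots> = L * (1 + c / (2 * r\<^sup>2) + 3 * c * (c - 2) / (8 * r ^ 4))"
    using r by (simp add: a_def b_def field_simps eval_nat_numeral)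
  finally show ?thesis .
qed

section \<open>Growth before the first maximum and the resulting supremum bound\<close>

lemma bessel_J_pos:
  assumes "\<mu> \<ge> 0" "0 < r" "r \<le> \<mu> + 1"
  shows "bessel_J \<mu> r > 0"
proof -
  have "r\<^sup>2 \<le> (\<mu> + 1)\<^sup>2" using assms by (intro power_mono) auto
  then have "hyp \<mu> (r\<^sup>2 / 4) > 0" using assms by (intro hyp_pos) auto
  then show ?thesis using assms by (simp add: bessel_J_eq Gamma_real_pos)
qed

text \<open>The barrier with \<open>a = \<mu> + 2 + \<beta>\<close>, for which
  \<open>2 * \<mu> + 2 - a = \<mu> - \<beta>\<close>. It bounds the logarithmic derivative
  \<open>bessel_D / bessel_J\<close> below by \<open>\<beta>\<close>, so
  \<open>J * r powr (- \<beta>)\<close> still increases on this range.\<close>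

lemma bessel_D_ge:
  assumes \<mu>: "\<mu> \<ge> 0" and \<beta>: "- 1 \<le> \<beta>" "\<beta> \<le> \<mu>" and t: "0 < t" "t\<^sup>2 \<le> (\<mu> - \<beta>) * (\<mu> + 2 + \<beta>)"
  shows "\<beta> * bessel_J \<mu> t \<le> bessel_D \<mu> t"
proof -
  define a where "a = \<mu> + 2 + \<beta>"
  have a: "a > 0" using \<mu> \<beta> by (simp add: a_def)
  let ?x = "t\<^sup>2 / 4"
  have "(\<mu> - \<beta>) * (\<mu> + 2 + \<beta>) = (\<mu> + 1)\<^sup>2 - (\<beta> + 1)\<^sup>2" by (simp add: power2_eq_square algebra_simps)
  then have "t\<^sup>2 \<le> (\<mu> + 1)\<^sup>2" using t zero_le_power2[of "\<beta> + 1"] by linarith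
  then have h: "hyp \<mu> ?x > 0" using \<mu> by (intro hyp_pos) auto
  have "a * hyp' \<mu> ?x \<le> 2 * hyp \<mu> ?x"
    by (rule hyp_barrier'[OF \<mu> a]) (use t in \<open>auto simp: a_def mult.commute\<close>)
  then have "t\<^sup>2 / 2 * hyp' \<mu> ?x \<le> t\<^sup>2 / a * hyp \<mu> ?x"
    using a t by (simp add: field_simps)
  also have "\<dots> \<le> (\<mu> - \<beta>) * hyp \<mu> ?x"
    using h a t by (intro mult_right_mono) (auto simp: a_def field_simps)
  finally have "(\<mu> - \<beta>) * hyp \<mu> ?x - t\<^sup>2 / 2 * hyp' \<mu> ?x \<ge> 0" by simp
  moreover have "Gamma (\<mu> + 1) > 0" using \<mu> by (intro Gamma_real_pos) simp
  ultimately have "(t / 2) powr \<mu> / Gamma (\<mu> + 1) * ((\<mu> - \<beta>) * hyp \<mu> ?x - t\<^sup>2 / 2 * hyp' \<mu> ?x) \<ge> 0" by simp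
  also have "(t / 2) powr \<mu> / Gamma (\<mu> + 1) * ((\<mu> - \<beta>) * hyp \<mu> ?x - t\<^sup>2 / 2 * hyp' \<mu> ?x)
      = bessel_D \<mu> t - \<beta> * bessel_J \<mu> t"
    unfolding bessel_D_def bessel_J_add1_eq[OF \<mu> t(1)] bessel_J_eq[OF \<mu> t(1)]
    by (simp add: power2_eq_square algebra_simps)
  finally show ?thesis by simp
qed

lemma bessel_J_powr_mono:
  assumes \<mu>: "\<mu> \<ge> 0" and \<beta>: "- 1 \<le> \<beta>" "\<beta> \<le> \<mu>" and s: "0 < s" "s \<le> r" and r: "r\<^sup>2 \<le> (\<mu> - \<beta>) * (\<mu> + 2 + \<beta>)"
  shows "bessel_J \<mu> s * s powr (- \<beta>) \<le> bessel_J \<mu> r * r powr (- \<beta>)"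
proof (rule DERIV_nonneg_imp_nondecreasing[OF s(2)])
  fix t assume t: "s \<le> t" "t \<le> r"
  have t0: "t > 0" using s t by simp
  have t2: "t\<^sup>2 \<le> (\<mu> - \<beta>) * (\<mu> + 2 + \<beta>)"
    using power_mono[of t r 2] t t0 r by linarith
  have nn: "bessel_D \<mu> t - \<beta> * bessel_J \<mu> t \<ge> 0"
    using bessel_D_ge[OF \<mu> \<beta> t0 t2] by simp
  have "((\<lambda>t. bessel_J \<mu> t * t powr (- \<beta>)) has_real_derivative
      bessel_D \<mu> t / t * t powr (- \<beta>) + (- \<beta> * t powr (- \<beta> - 1)) * bessel_J \<mu> t) (at t)"
    using t0 by (intro DERIV_mult has_real_derivative_bessel_J_theta has_real_derivative_powr \<mu>)
  moreover have "bessel_D \<mu> t / t * t powr (- \<beta>) + (- \<beta> * t powr (- \<beta> - 1)) * bessel_J \<mu> t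
      = t powr (- \<beta> - 1) * (bessel_D \<mu> t - \<beta> * bessel_J \<mu> t)"
    using t0 by (simp add: powr_diff field_simps)
  ultimately show "\<exists>y. ((\<lambda>t. bessel_J \<mu> t * t powr (- \<beta>)) has_real_derivative y) (at t) \<and> 0 \<le> y"
    using nn by (metis mult_nonneg_nonneg powr_ge_zero)
qed

text \<open>With \<open>\<beta> = 0\<close> the function increases up to
  \<open>r0 = sqrt (\<mu> * (\<mu> + 2))\<close>, where \<open>r0^2 - \<mu>^2 = 2 * \<mu>\<close>.
  From there on the decreasing envelope \<open>L / sqrt (r^2 - \<mu>^2)\<close> is at most its value
  at \<open>r0\<close>.\<close>

lemma bessel_J_square_le_sup:
  assumes \<mu>: "\<mu> > 0" and amp: "amp \<mu> L" and r: "r > 0"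
  shows "(bessel_J \<mu> r)\<^sup>2 \<le> L / sqrt (2 * \<mu>)"
proof -
  define r0 where "r0 = sqrt (\<mu> * (\<mu> + 2))"
  have r0: "r0\<^sup>2 = \<mu> * (\<mu> + 2)" "r0\<^sup>2 - \<mu>\<^sup>2 = 2 * \<mu>" "r0 > 0" 
    using \<mu> by (auto simp: r0_def power2_eq_square algebra_simps add_pos_pos)
  have r0': "r0 > \<mu>" using \<mu> r0 by (intro power2_less_imp_less[of \<mu> r0]) (auto simp: power2_eq_square algebra_simps)
  have L: "L \<ge> 0" by (rule amp_nonneg[OF amp])
  show ?thesis
  proof (cases "r \<le> r0")
    case True
    have m: "bessel_J \<mu> r \<le> bessel_J \<mu> r0"
      using bessel_J_powr_mono[of \<mu> 0 r r0] \<mu> r True r0 by simp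
    have "r0\<^sup>2 \<le> (\<mu> + 1)\<^sup>2" unfolding r0(1) by (simp add: power2_eq_square algebra_simps)
    then have "r0 \<le> \<mu> + 1" using \<mu> by (intro power2_le_imp_le[of r0]) auto
    then have "bessel_J \<mu> r > 0" using \<mu> r True by (intro bessel_J_pos) auto
    then have "(bessel_J \<mu> r)\<^sup>2 \<le> (bessel_J \<mu> r0)\<^sup>2" using m by (intro power_mono) auto
    also have "\<dots> \<le> L / sqrt (2 * \<mu>)" using bessel_J_square_le[OF _ amp r0'] \<mu> r0 by simp
    finally show ?thesis .
  next
    case False
    then have "(bessel_J \<mu> r)\<^sup>2 \<le> L / sqrt (r\<^sup>2 - \<mu>\<^sup>2)" using bessel_J_square_le[OF _ amp] \<mu> r0' by simp
    also have "\<dots> \<le> L / sqrt (2 * \<mu>)"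
      using power_mono[of r0 r 2] False r0 L \<mu> by (intro divide_left_mono mult_pos_pos) auto
    finally show ?thesis .
  qed
qed

section \<open>Integrals of radial functions\<close>

text \<open>\<open>half_mass \<mu>\<close>: the improper integral of \<open>bessel_J \<mu> * bessel_J (\<mu> + 1)\<close> over \<open>{0<..}\<close> is \<open>1 / 2\<close>.\<close>

definition half_mass :: "real \<Rightarrow> bool" where
  "half_mass \<mu> \<longleftrightarrow> (\<exists>W. (\<forall>r>0. (W has_real_derivative bessel_J \<mu> r * bessel_J (\<mu> + 1) r) (at r))
     \<and> (W \<longlongrightarrow> 0) (at_right 0) \<and> (W \<longlongrightarrow> 1 / 2) at_top)"

lemma half_mass_0: "half_mass 0"
proof -
  obtain L where L: "amp 0 L" by (rule amp_0)
  define W where "W = (\<lambda>r. 1 / 2 - (bessel_J 0 r)\<^sup>2 / 2)"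
  have "(W has_real_derivative bessel_J 0 r * bessel_J (0 + 1) r) (at r)" if "r > 0" for r
  proof -
    have "(bessel_J 0 has_real_derivative - bessel_J 1 r) (at r)"
      using has_real_derivative_bessel_J[of 0 r] that by simp
    from DERIV_diff[OF DERIV_const[of "1 / 2"] DERIV_cdivide[OF DERIV_power[OF this, of 2], of 2]]
    show ?thesis unfolding W_def by (simp add: mult.commute)
  qed
  moreover have "(W \<longlongrightarrow> 0) (at_right 0)"
  proof -
    have "isCont (\<lambda>r. hyp 0 (r\<^sup>2 / 4)) 0"
      by (intro isCont_o2[OF _ isCont_hyp] continuous_intros) auto
    then have "((\<lambda>r. hyp 0 (r\<^sup>2 / 4)) \<longlongrightarrow> 1) (at_right 0)"
      using isCont_tendsto_at_right by force
    moreover have "\<forall>\<^sub>F r in at_right 0. hyp 0 (r\<^sup>2 / 4) = bessel_J 0 r"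
      using eventually_at_right_less[of 0] by eventually_elim (simp add: bessel_J_0_eq)
    ultimately have "(bessel_J 0 \<longlongrightarrow> 1) (at_right 0)" by (rule Lim_transform_eventually)
    then have "(W \<longlongrightarrow> 1 / 2 - 1\<^sup>2 / 2) (at_right 0)" unfolding W_def by (intro tendsto_intros) auto
    then show ?thesis by simp
  qed
  moreover have "(W \<longlongrightarrow> 1 / 2 - 0\<^sup>2 / 2) at_top"
    unfolding W_def by (intro tendsto_intros amp_tendsto_0[OF L]) auto
  ultimately show ?thesis unfolding half_mass_def by auto
qed

text \<open>The product of the two closed forms is \<open>J_(1/2)^2 / r\<close> minus a multiple of
  \<open>sin (2 * r) / r\<close>. The sine integral is a primitive of the latter, and the Dirichlet
  integral \<open>pi / 2\<close> produces the limit \<open>1 / 2\<close>.\<close>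

lemma half_mass_half: "half_mass (1 / 2)"
proof -
  define W where "W = (\<lambda>r. Si (2 * r) / pi - (bessel_J (1 / 2) r)\<^sup>2)"
  have "(W has_real_derivative bessel_J (1 / 2) r * bessel_J (1 / 2 + 1) r) (at r)" if r: "r > 0" for r
  proof -
    let ?X = "bessel_J (1 / 2) r" and ?Y = "bessel_J (3 / 2) r"
    have "(bessel_J (1 / 2) has_real_derivative 1 / 2 / r * ?X - ?Y) (at r)"
      using has_real_derivative_bessel_J[of "1 / 2" r] r by simp
    from DERIV_power[OF this, of 2]
    have "((\<lambda>r. (bessel_J (1 / 2) r)\<^sup>2) has_real_derivative 2 * ((1 / 2 / r * ?X - ?Y) * ?X)) (at r)" by simp
    moreover have "((\<lambda>r. Si (2 * r)) has_real_derivative sinc (2 * r) * 2) (at r)"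
      by (rule DERIV_chain2[OF DERIV_Si]) (auto intro!: derivative_eq_intros)
    ultimately have "(W has_real_derivative sinc (2 * r) * 2 / pi - 2 * ((1 / 2 / r * ?X - ?Y) * ?X)) (at r)"
      unfolding W_def by (intro DERIV_diff DERIV_cdivide)
    moreover have "sinc (2 * r) * 2 / pi - 2 * ((1 / 2 / r * ?X - ?Y) * ?X) = ?X * ?Y"
    proof -
      have x: "?X = sqrt (2 / pi) * sin r / sqrt r" and y: "?Y = sqrt (2 / pi) * (sin r / r - cos r) / sqrt r"
        using r by (rule bessel_J_half, intro bessel_J_3_half)
      have sq: "(sqrt (2 / pi) * a / sqrt r) * (sqrt (2 / pi) * b / sqrt r) = 2 / pi * (a * b) / r" for a b
      proof -
        have "(sqrt (2 / pi) * a / sqrt r) * (sqrt (2 / pi) * b / sqrt r)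
            = (sqrt (2 / pi) * sqrt (2 / pi)) * (a * b) / (sqrt r * sqrt r)"
          by (simp only: times_divide_times_eq mult.assoc mult.left_commute)
        also have "\<dots> = 2 / pi * (a * b) / r"
        proof -
          have "sqrt (2 / pi) * sqrt (2 / pi) = 2 / pi" "sqrt r * sqrt r = r" using r by simp_all
          then show ?thesis by (simp only:)
        qed
        finally show ?thesis .
      qed
      have "?X * ?Y = ?X * ?X / r - 2 / pi * (sin r * cos r) / r"
        unfolding x y sq by (simp add: right_diff_distrib diff_divide_distrib)
      moreover have "sinc (2 * r) * 2 / pi = 2 / pi * (sin r * cos r) / r"
        using r sin_double[of r] by (simp add: mult.commute)
      moreover have "sinc (2 * r) * 2 / pi - 2 * ((1 / 2 / r * ?X - ?Y) * ?X)
          = sinc (2 * r) * 2 / pi - ?X * ?X / r + 2 * (?X * ?Y)" by (simp add: algebra_simps)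
      ultimately show ?thesis by linarith
    qed
    ultimately show ?thesis by simp
  qed
  moreover have "(W \<longlongrightarrow> Si (2 * 0) / pi - 0\<^sup>2) (at_right 0)"
  proof -
    have "isCont (\<lambda>r. Si (2 * r)) 0" by (intro isCont_o2[OF _ isCont_Si] continuous_intros)
    then have "((\<lambda>r. Si (2 * r)) \<longlongrightarrow> Si (2 * 0)) (at_right 0)"
      by (rule isCont_tendsto_at_right)
    then show ?thesis unfolding W_def by (intro tendsto_intros tendsto_bessel_J_at_0) auto
  qed
  moreover have "Si (2 * 0) / pi - 0\<^sup>2 = 0"
    using interval_integral_endpoints_same[of "ereal 0"] by (simp add: Si_def zero_ereal_def)
  moreover have "(W \<longlongrightarrow> (pi / 2) / pi - 0\<^sup>2) at_top"
  proof -
    have "((\<lambda>r. Si (2 * r)) \<longlongrightarrow> pi / 2) at_top"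
      by (rule filterlim_compose[OF Si_at_top]) real_asymp
    then show ?thesis unfolding W_def by (intro tendsto_intros amp_tendsto_0[OF amp_half]) auto
  qed
  ultimately show ?thesis unfolding half_mass_def by auto
qed

text \<open>Write \<open>X, Y, Z\<close> for the orders \<open>\<mu>, \<mu> + 1, \<mu> + 2\<close>.
  From \<open>Y' = (X - Z) / 2\<close>, a primitive of \<open>X * Y\<close> minus \<open>Y^2\<close>
  is a primitive of \<open>Y * Z\<close>, and \<open>Y^2\<close> vanishes at both ends. From
  \<open>X + Z = 2 * (\<mu> + 1) * Y / r\<close>, the integrand \<open>Y^2 / r\<close> is
  \<open>(X * Y + Y * Z) / (2 * (\<mu> + 1))\<close>, with total integral
  \<open>(1 / 2 + 1 / 2) / (2 * (\<mu> + 1))\<close>.\<close>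

lemma half_mass_add1:
  assumes "\<mu> \<ge> 0" "half_mass \<mu>" "amp \<mu> L"
  shows "half_mass (\<mu> + 1)"
    and "set_integrable lborel {0<..} (\<lambda>r. (bessel_J (\<mu> + 1) r)\<^sup>2 / r)"
    and "(LBINT r:{0<..}. (bessel_J (\<mu> + 1) r)\<^sup>2 / r) = 1 / (2 * (\<mu> + 1))"
proof -
  obtain W where dW: "\<And>r. r > 0 \<Longrightarrow> (W has_real_derivative bessel_J \<mu> r * bessel_J (\<mu> + 1) r) (at r)"
    and W0: "(W \<longlongrightarrow> 0) (at_right 0)" and W1: "(W \<longlongrightarrow> 1 / 2) at_top"
    using assms(2) unfolding half_mass_def by auto
  let ?X = "bessel_J \<mu>" and ?Y = "bessel_J (\<mu> + 1)" and ?Z = "bessel_J (\<mu> + 2)"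
  define V where "V = (\<lambda>r. W r - (?Y r)\<^sup>2)"
  have dV: "(V has_real_derivative ?Y r * ?Z r) (at r)" if r: "r > 0" for r
  proof -
    have "?X r - (\<mu> + 1) / r * ?Y r = (?X r - ?Z r) / 2"
      using bessel_J_rec[OF assms(1) r] r by (simp add: field_simps)
    then have "(?Y has_real_derivative (?X r - ?Z r) / 2) (at r)"
      using has_real_derivative_bessel_J_add1[OF assms(1) r] by metis
    from DERIV_power[OF this, of 2]
    have "(V has_real_derivative ?X r * ?Y r - 2 * ((?X r - ?Z r) / 2 * ?Y r)) (at r)"
      unfolding V_def by (intro DERIV_diff dW r) simp
    moreover have "?X r * ?Y r - 2 * ((?X r - ?Z r) / 2 * ?Y r) = ?Y r * ?Z r"
      by (simp add: field_simps)
    ultimately show ?thesis by metis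
  qed
  have Y0: "(?Y \<longlongrightarrow> 0) (at_right 0)" using assms(1) by (intro tendsto_bessel_J_at_0) simp
  have "(V \<longlongrightarrow> 0 - 0\<^sup>2) (at_right 0)" unfolding V_def by (intro tendsto_intros W0 Y0)
  then have V0: "(V \<longlongrightarrow> 0) (at_right 0)" by simp
  have "(V \<longlongrightarrow> 1 / 2 - 0\<^sup>2) at_top" unfolding V_def
    by (intro tendsto_intros W1 amp_tendsto_0[OF assms(3)])
  then have V1: "(V \<longlongrightarrow> 1 / 2) at_top" by simp
  have "\<mu> + 1 + 1 = \<mu> + 2" by simp
  then show "half_mass (\<mu> + 1)" unfolding half_mass_def using dV V0 V1 by metis
  define P where "P = (\<lambda>r. (W r + V r) / (2 * (\<mu> + 1)))"
  have dP: "(P has_real_derivative (?Y r)\<^sup>2 / r) (at r)" if r: "r > 0" for r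
  proof -
    have "(P has_real_derivative (?X r * ?Y r + ?Y r * ?Z r) / (2 * (\<mu> + 1))) (at r)"
      unfolding P_def by (intro DERIV_cdivide DERIV_add dW dV r)
    also have "?X r * ?Y r + ?Y r * ?Z r = (?X r + ?Z r) * ?Y r" by (simp add: algebra_simps)
    also have "\<dots> / (2 * (\<mu> + 1)) = (?Y r)\<^sup>2 / r"
    proof -
      have "m / r * y * y / m = y\<^sup>2 / r" if "m \<noteq> 0" for m y :: real
        using that by (simp add: power2_eq_square)
      from this[of "2 * (\<mu> + 1)" "?Y r"] show ?thesis unfolding bessel_J_rec[OF assms(1) r] using assms(1) by simp
    qed
    finally show ?thesis .
  qed
  have P0: "((P \<circ> real_of_ereal) \<longlongrightarrow> (0 + 0) / (2 * (\<mu> + 1))) (at_right 0)"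
    unfolding zero_ereal_def ereal_tendsto_simps P_def
    using assms(1) by (intro tendsto_intros W0 V0) auto
  have P1: "((P \<circ> real_of_ereal) \<longlongrightarrow> (1 / 2 + 1 / 2) / (2 * (\<mu> + 1))) (at_left \<infinity>)"
    unfolding ereal_tendsto_simps P_def
    using assms(1) by (intro tendsto_intros W1 V1) auto
  have cont: "isCont (\<lambda>r. (?Y r)\<^sup>2 / r) r" if "r > 0" for r
    using that DERIV_isCont[OF has_real_derivative_bessel_J[of "\<mu> + 1" r]] assms(1)
    by (intro continuous_intros) auto
  have prem: "(0 :: ereal) < \<infinity>"
    "\<And>x. 0 < ereal x \<Longrightarrow> ereal x < \<infinity> \<Longrightarrow> (P has_real_derivative (?Y x)\<^sup>2 / x) (at x)"
    "\<And>x. 0 < ereal x \<Longrightarrow> ereal x < \<infinity> \<Longrightarrow> isCont (\<lambda>r. (?Y r)\<^sup>2 / r) x"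
    "AE x in lborel. 0 < ereal x \<longrightarrow> ereal x < \<infinity> \<longrightarrow> 0 \<le> (?Y x)\<^sup>2 / x"
    using dP cont by auto
  note ftc = interval_integral_FTC_nonneg[OF prem P0 P1]
  have "einterval 0 \<infinity> = {0<..}" by (auto simp: einterval_def)
  with ftc show "set_integrable lborel {0<..} (\<lambda>r. (?Y r)\<^sup>2 / r)"
    "(LBINT r:{0<..}. (?Y r)\<^sup>2 / r) = 1 / (2 * (\<mu> + 1))"
    by (simp_all add: interval_lebesgue_integral_def)
qed

text \<open>For odd \<open>d\<close> this is the exact limit, known from \<open>bessel_J (1 / 2)\<close>; for even \<open>d\<close> it is the bound of \<open>amp_0\<close>.\<close>

definition amp_bound :: "nat \<Rightarrow> real" where
  "amp_bound d = (if even d then 16 / 25 else 2 / pi)"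

lemma amp_bound_nonneg: "amp_bound d \<ge> 0"
  by (simp add: amp_bound_def)

section \<open>Bounds for all orders that belong to one dimension\<close>

definition bindex :: "nat \<Rightarrow> nat \<Rightarrow> real" where
  "bindex d k = real d / 2 - 1 + real k"

lemma bindex_nonneg: "d \<ge> 2 \<Longrightarrow> bindex d k \<ge> 0"
  and bindex_pos: "d \<ge> 2 \<Longrightarrow> k \<ge> 1 \<Longrightarrow> bindex d k > 0"
  by (auto simp: bindex_def)

lemma bindex_Suc: "bindex d (Suc k) = bindex d k + 1"
  by (simp add: bindex_def)

text \<open>The amplitude and the half mass propagate in integer steps of the order; the starting
  order is 0 for even \<open>d\<close> and 1/2 for odd \<open>d\<close>.\<close>

lemma bindex_cases:
  assumes "d \<ge> 2"
  obtains n where "even d" "\<And>k. bindex d k = 0 + real (n + k)" | n where "odd d" "\<And>k. bindex d k = 1 / 2 + real (n + k)"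
proof (cases "even d")
  case True
  then obtain m where "d = 2 * m" by (auto elim: evenE)
  then show ?thesis using True assms by (intro that(1)[of "m - 1"]) (auto simp: bindex_def of_nat_diff)
next
  case False
  then obtain m where "d = 2 * m + 1" by (auto elim: oddE)
  then show ?thesis using False assms by (intro that(2)[of "m - 1"]) (auto simp: bindex_def of_nat_diff field_simps)
qed

lemma ex_amp_bindex:
  assumes "d \<ge> 2"
  obtains L where "0 \<le> L" "L \<le> amp_bound d" "\<And>k. amp (bindex d k) L"
  using assms
proof (cases rule: bindex_cases)
  case (1 n)
  obtain L where L: "amp 0 L" "L \<le> 16 / 25" by (rule amp_0)
  then show ?thesis using 1 amp_nonneg[OF L(1)] amp_add_nat[OF order_refl L(1)]
    by (intro that[of L]) (simp_all add: amp_bound_def del: of_nat_add)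
next
  case (2 n)
  then show ?thesis using amp_add_nat[OF _ amp_half]
    by (intro that[of "2 / pi"]) (simp_all add: amp_bound_def del: of_nat_add)
qed

lemma half_mass_add_nat:
  assumes "\<mu> \<ge> 0" "half_mass \<mu>" "amp \<mu> L"
  shows "half_mass (\<mu> + real n)"
proof (induction n)
  case (Suc n)
  then show ?case using half_mass_add1(1)[of "\<mu> + real n" L] amp_add_nat[OF assms(1,3), of n] assms(1)
    by (simp add: algebra_simps)
qed (use assms in simp)

lemma half_mass_bindex:
  assumes "d \<ge> 2"
  shows "half_mass (bindex d k)"
  using assms
proof (cases rule: bindex_cases)
  case (1 n)
  obtain L where "amp 0 L" by (rule amp_0)
  then show ?thesis unfolding 1 by (intro half_mass_add_nat[OF order_refl half_mass_0])
next
  case (2 n)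
  then show ?thesis unfolding 2 by (intro half_mass_add_nat[OF _ half_mass_half amp_half]) simp
qed

lemma bessel_mass:
  assumes "d \<ge> 2" "k \<ge> 1"
  shows "set_integrable lborel {0<..} (\<lambda>r. (bessel_J (bindex d k) r)\<^sup>2 / r)"
    and "(LBINT r:{0<..}. (bessel_J (bindex d k) r)\<^sup>2 / r) = 1 / (2 * bindex d k)"
proof -
  obtain j where k: "k = Suc j" using assms(2) by (cases k) auto
  obtain L where L: "\<And>k. amp (bindex d k) L" using ex_amp_bindex[OF assms(1)] by metis
  note * = half_mass_add1(2,3)[OF bindex_nonneg half_mass_bindex L, OF assms(1) assms(1), of j]
  then show "set_integrable lborel {0<..} (\<lambda>r. (bessel_J (bindex d k) r)\<^sup>2 / r)"
    "(LBINT r:{0<..}. (bessel_J (bindex d k) r)\<^sup>2 / r) = 1 / (2 * bindex d k)"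
    unfolding k bindex_Suc by simp_all
qed

lemma bessel_square_le_bindex:
  assumes "d \<ge> 2" "r > bindex d k"
  shows "(bessel_J (bindex d k) r)\<^sup>2 \<le> amp_bound d / sqrt (r\<^sup>2 - (bindex d k)\<^sup>2)"
proof -
  obtain L where L: "L \<le> amp_bound d" "\<And>k. amp (bindex d k) L" using ex_amp_bindex[OF assms(1)] by metis
  have "(bessel_J (bindex d k) r)\<^sup>2 \<le> L / sqrt (r\<^sup>2 - (bindex d k)\<^sup>2)"
    by (rule bessel_J_square_le[OF bindex_nonneg[OF assms(1)] L(2) assms(2)])
  also have "\<dots> \<le> amp_bound d / sqrt (r\<^sup>2 - (bindex d k)\<^sup>2)"
    using power_mono[of "bindex d k" r 2] assms bindex_nonneg[OF assms(1), of k] L by (intro divide_right_mono) auto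
  finally show ?thesis .
qed

lemma bessel_square_le_bindex_sup:
  assumes "d \<ge> 2" "k \<ge> 1" "r > 0"
  shows "(bessel_J (bindex d k) r)\<^sup>2 \<le> amp_bound d / sqrt (2 * bindex d k)"
proof -
  obtain L where L: "L \<le> amp_bound d" "\<And>k. amp (bindex d k) L" using ex_amp_bindex[OF assms(1)] by metis
  have "(bessel_J (bindex d k) r)\<^sup>2 \<le> L / sqrt (2 * bindex d k)"
    by (rule bessel_J_square_le_sup[OF bindex_pos[OF assms(1,2)] L(2) assms(3)])
  also have "\<dots> \<le> amp_bound d / sqrt (2 * bindex d k)"
    using bindex_nonneg[OF assms(1), of k] L by (intro divide_right_mono) auto
  finally show ?thesis .
qed

lemma bessel_square_le_bindex_nicholson:
  assumes "d \<ge> 2" "c = (bindex d k)\<^sup>2 - 1 / 4" "2 \<le> c" "c \<le> 6" "r > 0"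
  shows "r * (bessel_J (bindex d k) r)\<^sup>2 \<le> amp_bound d * (1 + c / (2 * r\<^sup>2) + 3 * c * (c - 2) / (8 * r ^ 4))"
proof -
  obtain L where L: "L \<le> amp_bound d" "\<And>k. amp (bindex d k) L" using ex_amp_bindex[OF assms(1)] by metis
  have "r * (bessel_J (bindex d k) r)\<^sup>2 \<le> L * (1 + c / (2 * r\<^sup>2) + 3 * c * (c - 2) / (8 * r ^ 4))"
    by (rule bessel_J_square_le'[OF bindex_nonneg[OF assms(1)] L(2) assms(2-5)])
  also have "\<dots> \<le> amp_bound d * (1 + c / (2 * r\<^sup>2) + 3 * c * (c - 2) / (8 * r ^ 4))"
    using assms L by (intro mult_right_mono add_nonneg_nonneg divide_nonneg_nonneg mult_nonneg_nonneg) auto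
  finally show ?thesis .
qed

text \<open>\<open>radial_0 d\<close> is the value \<open>radial_ext d 0 0\<close>.\<close>

definition radial_0 :: "nat \<Rightarrow> real" where
  "radial_0 d = 1 / (2 powr (real d / 2 - 1) * Gamma (real d / 2))"

lemma radial_0_pos: "d \<ge> 2 \<Longrightarrow> radial_0 d > 0"
  by (simp add: radial_0_def Gamma_real_pos)

lemma radial_eq:
  assumes "d \<ge> 2" "r > 0"
  shows "radial d k r = radial_0 d * (r / 2) ^ k / pochhammer (real d / 2) k * hyp (bindex d k) (r\<^sup>2 / 4)"
proof -
  let ?\<nu> = "real d / 2 - 1"
  have "pochhammer (real d / 2) k = Gamma (real d / 2 + real k) / Gamma (real d / 2)"
    using assms by (intro pochhammer_Gamma) (auto elim!: nonpos_Ints_cases)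
  moreover have "Gamma (real d / 2) > 0" "Gamma (real d / 2 + real k) > 0" using assms by (auto intro!: Gamma_real_pos)
  ultimately have G: "Gamma (bindex d k + 1) = pochhammer (real d / 2) k * Gamma (real d / 2)"
    by (simp add: bindex_def)
  have "(r / 2) powr bindex d k = (r / 2) powr (?\<nu> + real k)" by (simp add: bindex_def)
  also have "\<dots> = r powr ?\<nu> / 2 powr ?\<nu> * (r / 2) ^ k"
    using assms by (simp add: powr_add powr_realpow powr_divide power_divide)
  finally have p: "(r / 2) powr bindex d k = r powr ?\<nu> / 2 powr ?\<nu> * (r / 2) ^ k" .
  have q: "r powr (- real d / 2 + 1) = inverse (r powr ?\<nu>)"
    by (subst powr_minus[symmetric]) simp
  have "radial d k r = bessel_J (bindex d k) r * r powr (- real d / 2 + 1)"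
    by (simp add: radial_def bindex_def)
  also have "\<dots> = (r powr ?\<nu> / 2 powr ?\<nu> * (r / 2) ^ k) / (pochhammer (real d / 2) k * Gamma (real d / 2))
      * hyp (bindex d k) (r\<^sup>2 / 4) * inverse (r powr ?\<nu>)"
    unfolding q bessel_J_eq[OF bindex_nonneg[OF assms(1)] assms(2)] p G ..
  also have "\<dots> = radial_0 d * (r / 2) ^ k / pochhammer (real d / 2) k * hyp (bindex d k) (r\<^sup>2 / 4)"
  proof -
    have "r powr ?\<nu> \<noteq> 0" using assms(2) by simp
    then show ?thesis by (simp add: radial_0_def field_simps)
  qed
  finally show ?thesis .
qed

lemma radial_square:
  assumes "d \<ge> 2" "r > 0"
  shows "(bessel_J (bindex d k) r)\<^sup>2 = (radial d k r)\<^sup>2 * r ^ (d - 2)"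
proof -
  have "(r powr (- real d / 2 + 1))\<^sup>2 * r ^ (d - 2) = r powr (2 * (- real d / 2 + 1)) * r powr (real d - 2)"
    using assms by (simp add: powr_realpow[symmetric] of_nat_diff powr_add[symmetric] power2_eq_square)
  also have "\<dots> = 1" using assms by (simp add: powr_add[symmetric])
  finally have "(bessel_J (bindex d k) r)\<^sup>2 * ((r powr (- real d / 2 + 1))\<^sup>2 * r ^ (d - 2)) = (bessel_J (bindex d k) r)\<^sup>2"
    by simp
  then show ?thesis by (simp add: radial_def bindex_def power_mult_distrib)
qed

lemma continuous_on_radial:
  assumes "d \<ge> 2"
  shows "continuous_on {0<..} (radial d k)"
proof -
  have "continuous_on {0<..} (\<lambda>r. radial_0 d * (r / 2) ^ k / pochhammer (real d / 2) k * hyp (bindex d k) (r\<^sup>2 / 4))"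
    using assms bindex_nonneg[OF assms, of k] pochhammer_pos[of "real d / 2" k]
    by (intro continuous_intros continuous_on_compose2[OF continuous_on_hyp[of _ UNIV]]) auto
  then show ?thesis using radial_eq[OF assms] by (subst continuous_on_cong[OF refl]) auto
qed

lemma set_borel_measurable_radial:
  assumes "d \<ge> 2" "p > 0" "A \<in> sets borel" "A \<subseteq> {0<..}"
  shows "set_borel_measurable lborel A (\<lambda>r. \<bar>radial d k r\<bar> powr p * r ^ (d - 1))"
proof -
  have "continuous_on A (\<lambda>r. \<bar>radial d k r\<bar> powr p * r ^ (d - 1))"
    using assms
    by (intro continuous_on_mult continuous_on_powr' continuous_intros continuous_on_subset[OF continuous_on_radial]) auto
  then show ?thesis unfolding set_borel_measurable_def
    using borel_measurable_continuous_on_indicator[OF assms(3), of "\<lambda>r. \<bar>radial d k r\<bar> powr p * r ^ (d - 1)"] by simp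
qed

lemma set_integral_le_of_nonneg:
  fixes f g :: "real \<Rightarrow> real"
  assumes "set_borel_measurable lborel A f" "set_integrable lborel A g"
    and le: "\<And>r. r \<in> A \<Longrightarrow> 0 \<le> f r" "\<And>r. r \<in> A \<Longrightarrow> f r \<le> g r"
  shows "set_integrable lborel A f" "(LBINT r:A. f r) \<le> (LBINT r:A. g r)"
proof -
  show f: "set_integrable lborel A f"
  proof (rule set_integrable_bound[OF assms(2,1)])
    show "AE r in lborel. r \<in> A \<longrightarrow> norm (f r) \<le> norm (g r)"
    proof (intro AE_I2 impI)
      fix r :: real assume "r \<in> A"
      from le[OF this] show "norm (f r) \<le> norm (g r)" unfolding real_norm_def by linarith
    qed
  qed
  show "(LBINT r:A. f r) \<le> (LBINT r:A. g r)" by (rule set_integral_mono[OF f assms(2) le(2)])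
qed

lemma radial_integral_le:
  fixes q C :: real
  assumes "d \<ge> 2" "k \<ge> 1" "q > 2" and C: "\<And>r. r > 0 \<Longrightarrow> r\<^sup>2 * \<bar>radial d k r\<bar> powr (q - 2) \<le> C"
  shows "set_integrable lborel {0<..} (\<lambda>r. \<bar>radial d k r\<bar> powr q * r ^ (d - 1))"
    and "(LBINT r:{0<..}. \<bar>radial d k r\<bar> powr q * r ^ (d - 1)) \<le> C / (2 * bindex d k)"
proof -
  let ?f = "\<lambda>r. \<bar>radial d k r\<bar> powr q * r ^ (d - 1)" and ?g = "\<lambda>r. C * ((bessel_J (bindex d k) r)\<^sup>2 / r)"
  have le: "?f r \<le> ?g r" if r: "r > 0" for r
  proof -
    let ?R = "\<bar>radial d k r\<bar>"
    have "?R powr q = ?R powr (q - 2) * ?R\<^sup>2"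
      using assms(3) powr_add[of ?R "q - 2" 2] by simp
    moreover have "r ^ (d - 1) = r * r ^ (d - 2)"
      using assms(1) by (cases d; cases "d - 1") auto
    ultimately have "?f r = (r\<^sup>2 * ?R powr (q - 2)) * ((bessel_J (bindex d k) r)\<^sup>2 / r)"
      unfolding radial_square[OF assms(1) r] using r by (simp add: power2_eq_square)
    also have "\<dots> \<le> C * ((bessel_J (bindex d k) r)\<^sup>2 / r)"
      using C[OF r] r by (intro mult_right_mono) auto
    finally show ?thesis .
  qed
  have g: "set_integrable lborel {0<..} ?g"
    by (intro set_integrable_mult_right impI bessel_mass(1)[OF assms(1,2)])
  have fm: "set_borel_measurable lborel {0<..} ?f" using assms by (intro set_borel_measurable_radial) auto
  show "set_integrable lborel {0<..} ?f"
    by (rule set_integral_le_of_nonneg(1)[OF fm g _ le]) simp_all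
  have "(LBINT r:{0<..}. ?f r) \<le> (LBINT r:{0<..}. ?g r)"
    by (rule set_integral_le_of_nonneg(2)[OF fm g _ le]) simp_all
  also have "\<dots> = C / (2 * bindex d k)"
    using bessel_mass(2)[OF assms(1,2)] by (subst set_integral_mult_right) simp
  finally show "(LBINT r:{0<..}. ?f r) \<le> C / (2 * bindex d k)" .
qed

section \<open>Tail integrals and convergence for the zeroth function\<close>

lemma LBINT_sqrt_tail:
  fixes a \<mu> \<rho> :: real
  assumes a: "a < - 1" and \<rho>: "0 < \<rho>" "\<mu>\<^sup>2 < \<rho>\<^sup>2"
  shows "set_integrable lborel {\<rho><..} (\<lambda>r. (r\<^sup>2 - \<mu>\<^sup>2) powr a * r)"
    "(LBINT r:{\<rho><..}. (r\<^sup>2 - \<mu>\<^sup>2) powr a * r) = (\<rho>\<^sup>2 - \<mu>\<^sup>2) powr (a + 1) / (- (2 * (a + 1)))"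
proof -
  define P where "P = (\<lambda>r. (r\<^sup>2 - \<mu>\<^sup>2) powr (a + 1) / (2 * (a + 1)))"
  have pos: "r\<^sup>2 - \<mu>\<^sup>2 > 0" if "r \<ge> \<rho>" for r using power_mono[OF that, of 2] \<rho> by simp
  have dP: "(P has_real_derivative (r\<^sup>2 - \<mu>\<^sup>2) powr a * r) (at r)" if "r \<ge> \<rho>" for r
  proof -
    have d: "((\<lambda>r. r\<^sup>2 - \<mu>\<^sup>2) has_real_derivative 2 * r) (at r)" by (auto intro!: derivative_eq_intros)
    from DERIV_cdivide[OF DERIV_chain2[OF has_real_derivative_powr[OF pos[OF that], of "a + 1"] d], of "2 * (a + 1)"]
    have "(P has_real_derivative (a + 1) * (r\<^sup>2 - \<mu>\<^sup>2) powr (a + 1 - 1) * (2 * r) / (2 * (a + 1))) (at r)"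
      unfolding P_def .
    moreover have "c * w * (2 * r) / (2 * c) = w * r" if "c \<noteq> 0" for c w :: real using that by simp
    from this[of "a + 1"] have "(a + 1) * w * (2 * r) / (2 * (a + 1)) = w * r" for w using a by simp
    ultimately show ?thesis by simp
  qed
  have "isCont P \<rho>" using dP[of \<rho>] by (auto intro: DERIV_isCont)
  then have P0: "((P \<circ> real_of_ereal) \<longlongrightarrow> P \<rho>) (at_right (ereal \<rho>))"
    unfolding ereal_tendsto_simps by (rule isCont_tendsto_at_right)
  have "filterlim (\<lambda>r :: real. r\<^sup>2 - \<mu>\<^sup>2) at_top at_top" by real_asymp
  then have "(P \<longlongrightarrow> 0 / (2 * (a + 1))) at_top" unfolding P_def
    using a by (intro tendsto_divide tendsto_const tendsto_neg_powr) auto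
  then have P1: "((P \<circ> real_of_ereal) \<longlongrightarrow> 0) (at_left \<infinity>)" unfolding ereal_tendsto_simps by simp
  have cont: "isCont (\<lambda>r. (r\<^sup>2 - \<mu>\<^sup>2) powr a * r) x" if "x \<ge> \<rho>" for x
    using pos[OF that] by (intro continuous_intros) auto
  have prem: "ereal \<rho> < \<infinity>"
    "\<And>x. ereal \<rho> < ereal x \<Longrightarrow> ereal x < \<infinity> \<Longrightarrow> (P has_real_derivative (x\<^sup>2 - \<mu>\<^sup>2) powr a * x) (at x)"
    "\<And>x. ereal \<rho> < ereal x \<Longrightarrow> ereal x < \<infinity> \<Longrightarrow> isCont (\<lambda>r. (r\<^sup>2 - \<mu>\<^sup>2) powr a * r) x"
    "AE x in lborel. ereal \<rho> < ereal x \<longrightarrow> ereal x < \<infinity> \<longrightarrow> 0 \<le> (x\<^sup>2 - \<mu>\<^sup>2) powr a * x"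
    using dP cont \<rho> by auto
  note ftc = interval_integral_FTC_nonneg[OF prem P0 P1]
  have "einterval (ereal \<rho>) \<infinity> = {\<rho><..}" by (auto simp: einterval_def)
  with ftc show "set_integrable lborel {\<rho><..} (\<lambda>r. (r\<^sup>2 - \<mu>\<^sup>2) powr a * r)"
    "(LBINT r:{\<rho><..}. (r\<^sup>2 - \<mu>\<^sup>2) powr a * r) = (\<rho>\<^sup>2 - \<mu>\<^sup>2) powr (a + 1) / (- (2 * (a + 1)))"
    by (simp_all add: interval_lebesgue_integral_def P_def minus_divide_right)
qed

text \<open>The case \<open>\<mu> = 0\<close> of the preceding integral, with exponent
  \<open>(a - 1) / 2\<close> on \<open>r^2\<close>.\<close>

lemma LBINT_powr_tail:
  fixes a R :: real
  assumes "a < - 1" "R > 0"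
  shows "set_integrable lborel {R<..} (\<lambda>r. r powr a)" "(LBINT r:{R<..}. r powr a) = R powr (a + 1) / (- (a + 1))"
proof -
  have sq: "(r\<^sup>2) powr (b / 2) = r powr b" if "r > 0" for r b :: real
  proof -
    have "r\<^sup>2 = r powr 2" using that by simp
    then show ?thesis by (simp only: powr_powr) simp
  qed
  have e: "(r\<^sup>2 - 0\<^sup>2) powr ((a - 1) / 2) * r = r powr a" if "r \<in> {R<..}" for r
    using that assms sq[of r "a - 1"] powr_mult_base[of r "a - 1"] by (simp only: mult.commute) simp
  have a: "(a - 1) / 2 < - 1" "0\<^sup>2 < R\<^sup>2" using assms by auto
  show "set_integrable lborel {R<..} (\<lambda>r. r powr a)"
    using LBINT_sqrt_tail(1)[OF a(1) assms(2) a(2)] by (simp only: set_integrable_cong[OF refl refl e])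
  have "(LBINT r:{R<..}. r powr a) = (LBINT r:{R<..}. (r\<^sup>2 - 0\<^sup>2) powr ((a - 1) / 2) * r)"
    using e by (intro set_lebesgue_integral_cong) auto
  also have "\<dots> = R powr (a + 1) / (- (a + 1))"
  proof -
    have h: "2 * ((a - 1) / 2 + 1) = a + 1" "(a - 1) / 2 + 1 = (a + 1) / 2" by (simp_all add: field_simps)
    show ?thesis unfolding LBINT_sqrt_tail(2)[OF a(1) assms(2) a(2)] h(1) unfolding h(2)
      using sq[OF assms(2), of "a + 1"] by simp
  qed
  finally show "(LBINT r:{R<..}. r powr a) = R powr (a + 1) / (- (a + 1))" .
qed

lemma abs_radial_0_le:
  assumes "d \<ge> 2" "r > 0"
  shows "\<bar>radial d 0 r\<bar> \<le> radial_0 d"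
  using abs_hyp_le_1[OF bindex_nonneg[OF assms(1)], of "r\<^sup>2 / 4" 0] radial_0_pos[OF assms(1)]
  by (simp add: radial_eq[OF assms] abs_mult)

text \<open>For \<open>r \<ge> 2 * \<mu>\<close> one has
  \<open>sqrt (r^2 - \<mu>^2) \<ge> r / 2\<close>, which costs a factor 2 in the envelope; this is
  harmless, because the estimate only serves convergence and a crude uniform bound. The final
  exponent \<open>(d - 1) * (1 - p / 2)\<close> is below \<open>-1\<close> exactly when
  \<open>p > 2 * d / (d - 1)\<close>.\<close>

lemma radial_powr_le_tail:
  assumes "d \<ge> 2" "p > 0" "r \<ge> 2 * bindex d k" "r > 0"
  shows "\<bar>radial d k r\<bar> powr p * r ^ (d - 1)
    \<le> (2 * amp_bound d) powr (p / 2) * r powr ((real d - 1) * (1 - p / 2))"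
proof -
  let ?\<mu> = "bindex d k"
  have \<mu>: "?\<mu> \<ge> 0" by (rule bindex_nonneg[OF assms(1)])
  have "(bessel_J ?\<mu> r)\<^sup>2 \<le> amp_bound d / sqrt (r\<^sup>2 - ?\<mu>\<^sup>2)"
    using \<mu> assms by (intro bessel_square_le_bindex) auto
  also have "\<dots> \<le> amp_bound d / (r / 2)"
  proof (intro divide_left_mono amp_bound_nonneg)
    have "(2 * ?\<mu>)\<^sup>2 \<le> r\<^sup>2" using \<mu> assms by (intro power_mono) auto
    then have "4 * ?\<mu>\<^sup>2 \<le> r\<^sup>2" by (simp add: power_mult_distrib)
    moreover have "(r / 2)\<^sup>2 = r\<^sup>2 / 4" by (simp add: power_divide)
    ultimately have "(r / 2)\<^sup>2 \<le> r\<^sup>2 - ?\<mu>\<^sup>2" using zero_le_power2[of r] by linarith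
    then show le: "r / 2 \<le> sqrt (r\<^sup>2 - ?\<mu>\<^sup>2)" by (rule real_le_rsqrt)
    have "r / 2 > 0" using assms by simp
    then show "0 < sqrt (r\<^sup>2 - ?\<mu>\<^sup>2) * (r / 2)" using le by (intro mult_pos_pos) linarith+
  qed
  finally have "(radial d k r)\<^sup>2 * r ^ (d - 2) \<le> 2 * amp_bound d / r"
    unfolding radial_square[OF assms(1,4)] by (simp add: mult.commute)
  moreover have "r ^ (d - 2) = r powr (real d - 2)" using assms by (simp add: powr_realpow[symmetric] of_nat_diff)
  ultimately have "(radial d k r)\<^sup>2 \<le> 2 * amp_bound d / (r * r powr (real d - 2))"
    using assms by (simp add: field_simps)
  also have "r * r powr (real d - 2) = r powr (real d - 1)"
    using assms powr_mult_base[of r "real d - 2"] by simp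
  finally have "(radial d k r)\<^sup>2 \<le> 2 * amp_bound d * r powr (- (real d - 1))"
    using assms by (simp only: powr_minus divide_inverse)
  then have "((radial d k r)\<^sup>2) powr (p / 2) \<le> (2 * amp_bound d * r powr (- (real d - 1))) powr (p / 2)"
    using assms by (intro powr_mono2) auto
  also have "((radial d k r)\<^sup>2) powr (p / 2) = \<bar>radial d k r\<bar> powr p"
  proof -
    have "(radial d k r)\<^sup>2 = \<bar>radial d k r\<bar> powr 2" by simp
    then show ?thesis by (simp only: powr_powr) simp
  qed
  also have "(2 * amp_bound d * r powr (- (real d - 1))) powr (p / 2)
      = (2 * amp_bound d) powr (p / 2) * r powr (- (real d - 1) * (p / 2))"
    by (simp add: powr_mult powr_powr amp_bound_nonneg)
  finally have "\<bar>radial d k r\<bar> powr p * r ^ (d - 1)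
     \<le> (2 * amp_bound d) powr (p / 2) * r powr (- (real d - 1) * (p / 2)) * r ^ (d - 1)"
    using assms by (intro mult_right_mono) auto
  also have e: "r ^ (d - 1) = r powr (real d - 1)" using assms by (simp add: powr_realpow[symmetric] of_nat_diff)
  also have "(2 * amp_bound d) powr (p / 2) * r powr (- (real d - 1) * (p / 2)) * r powr (real d - 1)
     = (2 * amp_bound d) powr (p / 2) * r powr ((real d - 1) * (1 - p / 2))"
  proof -
    have "- (real d - 1) * (p / 2) + (real d - 1) = (real d - 1) * (1 - p / 2)" by (simp add: field_simps)
    then show ?thesis by (metis mult.assoc powr_add)
  qed
  finally show ?thesis unfolding e .
qed

lemma radial_0_integrable:
  assumes "d \<ge> 2" "p > 2 * real d / (real d - 1)"
  shows "set_integrable lborel {0<..} (\<lambda>r. \<bar>radial d 0 r\<bar> powr p * r ^ (d - 1))"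
proof -
  let ?f = "\<lambda>r. \<bar>radial d 0 r\<bar> powr p * r ^ (d - 1)"
  define R where "R = 2 * bindex d 0 + 1"
  have R: "R > 0" using bindex_nonneg[OF assms(1), of 0] by (simp add: R_def)
  have d1: "real d - 1 > 0" using assms by simp
  then have "2 * real d / (real d - 1) \<ge> 0" by simp
  then have p: "p > 0" using assms by linarith
  have "2 * real d < p * (real d - 1)" using assms(2) d1 by (simp add: pos_divide_less_eq)
  then have a: "(real d - 1) * (1 - p / 2) < - 1" by (simp add: algebra_simps)
  have "set_integrable lborel {0<..R} ?f"
  proof (rule set_integral_le_of_nonneg(1))
    show "set_integrable lborel {0<..R} (\<lambda>r. radial_0 d powr p * R ^ (d - 1))"
      by (rule set_integrable_subset[OF borel_integrable_atLeastAtMost'[of 0 R]]) (auto intro: continuous_intros)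
    show "set_borel_measurable lborel {0<..R} ?f" using assms p by (intro set_borel_measurable_radial) auto
    show "?f r \<le> radial_0 d powr p * R ^ (d - 1)" if "r \<in> {0<..R}" for r
      using that abs_radial_0_le[OF assms(1), of r] p by (intro mult_mono powr_mono2 power_mono) auto
  qed simp
  moreover have "set_integrable lborel {R<..} ?f"
  proof (rule set_integral_le_of_nonneg(1))
    show "set_integrable lborel {R<..} (\<lambda>r. (2 * amp_bound d) powr (p / 2) * r powr ((real d - 1) * (1 - p / 2)))"
      using LBINT_powr_tail(1)[OF a R] by simp
    show "set_borel_measurable lborel {R<..} ?f" using assms p R by (intro set_borel_measurable_radial) auto
    show "?f r \<le> (2 * amp_bound d) powr (p / 2) * r powr ((real d - 1) * (1 - p / 2))" if "r \<in> {R<..}" for r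
      using that R by (intro radial_powr_le_tail assms(1) p) (auto simp: R_def)
  qed (use R in simp)
  ultimately have "set_integrable lborel ({0<..R} \<union> {R<..}) ?f" by (intro set_integrable_Un) auto
  moreover have "{0<..R} \<union> {R<..} = {0<..}" using R by auto
  ultimately show ?thesis by simp
qed

section \<open>Lower bounds for the zeroth radial function\<close>

text \<open>The second derivative of \<open>hyp \<nu>\<close> is a positive multiple of
  \<open>hyp (\<nu> + 2)\<close>, so convexity lasts as long as \<open>hyp_pos\<close> covers the
  order \<open>\<nu> + 2\<close>. This range reaches farther than the one on which
  \<open>hyp \<nu>\<close> itself is known to be positive.\<close>

lemma hyp_above_tangent:
  assumes \<nu>: "\<nu> \<ge> 0" and x: "0 \<le> x" "4 * x \<le> (\<nu> + 3)\<^sup>2" and x0: "0 < x0" "4 * x0 < (\<nu> + 3)\<^sup>2"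
  shows "hyp \<nu> x0 - hyp' \<nu> x0 * (x - x0) \<le> hyp \<nu> x"
proof -
  define C where "C = {0..(\<nu> + 3)\<^sup>2 / 4}"
  have "convex_on C (hyp \<nu>)"
  proof (rule f''_ge0_imp_convex)
    fix t assume t: "t \<in> C"
    show "(hyp \<nu> has_real_derivative - hyp' \<nu> t) (at t)" by (rule has_real_derivative_hyp_hyp'[OF \<nu>])
    show "((\<lambda>t. - hyp' \<nu> t) has_real_derivative - (- hyp (\<nu> + 2) t / (\<nu> + 2) / (\<nu> + 1))) (at t)"
      unfolding hyp'_def by (intro DERIV_minus DERIV_cdivide has_real_derivative_hyp_add1[OF \<nu>])
    have "hyp (\<nu> + 2) t > 0" using t \<nu> by (intro hyp_pos) (auto simp: C_def add.commute)
    then show "- (- hyp (\<nu> + 2) t / (\<nu> + 2) / (\<nu> + 1)) \<ge> 0" using \<nu> by simp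
  qed (auto simp: C_def)
  then have "- hyp' \<nu> x0 * (x - x0) \<le> hyp \<nu> x - hyp \<nu> x0"
    by (rule convex_on_imp_above_tangent)
       (use x x0 has_real_derivative_hyp_hyp'[OF \<nu>] in \<open>auto simp: C_def intro: DERIV_subset\<close>)
  then show ?thesis by simp
qed

lemma powr_above_tangent:
  fixes p y t :: real
  assumes "p \<ge> 1" "y > 0" "t \<ge> 0"
  shows "y powr p + p * y powr (p - 1) * (t - y) \<le> t powr p"
proof (cases "t = 0")
  case True
  have "y powr p = y powr (p - 1) * y" using assms powr_mult_base[of y "p - 1"] by (simp add: mult.commute)
  then have "y powr p + p * y powr (p - 1) * (t - y) = (1 - p) * y powr p"
    using True by (simp add: algebra_simps)
  then show ?thesis using True assms by (simp add: mult_nonpos_nonneg)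
next
  case False
  have "(p * y powr (p - 1)) * (t - y) \<le> t powr p - y powr p"
    by (rule convex_on_imp_above_tangent[OF powr_convex[OF assms(1)]])
       (use assms False has_real_derivative_powr[of y p] in \<open>auto simp: interior_open intro: DERIV_subset\<close>)
  then show ?thesis by simp
qed

text \<open>The mean of \<open>r^2 / 4\<close> over \<open>{a..b}\<close> with respect to the weight
  \<open>r^(d - 1)\<close>.\<close>

definition cell_mean :: "nat \<Rightarrow> real \<Rightarrow> real \<Rightarrow> real" where
  "cell_mean d a b = real d * (b ^ (d + 2) - a ^ (d + 2)) / (4 * (real d + 2) * (b ^ d - a ^ d))"

text \<open>The tangent at the barycentre of \<open>r\<^sup>2 / 4\<close> is integrated exactly by its midpoint value.\<close>

lemma cell_integral:
  assumes d: "d \<ge> 2" and p: "p \<ge> 1" and ab: "0 \<le> a" "a < b" "b \<le> real d / 2 + 2"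
    and m: "4 * cell_mean d a b < (real d / 2 + 2)\<^sup>2"
    and y: "0 < y" "y \<le> hyp (real d / 2 - 1) (cell_mean d a b)"
  shows "y powr p * ((b ^ d - a ^ d) / real d) \<le> integral {a..b} (\<lambda>r. \<bar>hyp (real d / 2 - 1) (r\<^sup>2 / 4)\<bar> powr p * r ^ (d - 1))"
proof -
  let ?\<nu> = "real d / 2 - 1"
  let ?h = "\<lambda>r. \<bar>hyp ?\<nu> (r\<^sup>2 / 4)\<bar> powr p * r ^ (d - 1)"
  define x0 where "x0 = cell_mean d a b"
  \<comment> \<open>Two tangents are composed: that of \<open>t powr p\<close> at \<open>y\<close>
    and that of \<open>hyp\<close> at \<open>x0\<close>. Taking the power's slope at
    \<open>y\<close> instead of the exact value at \<open>x0\<close> allows a rational lower bound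
    as height.\<close>
  define A B where "A = y powr p" and "B = p * y powr (p - 1) * (- hyp' ?\<nu> x0)"
  define l where "l = (\<lambda>r. (A + B * (r\<^sup>2 / 4 - x0)) * r ^ (d - 1))"
  have \<nu>: "?\<nu> \<ge> 0" "?\<nu> + 3 = real d / 2 + 2" using d by auto
  have D: "b ^ d - a ^ d > 0" "b ^ (d + 2) - a ^ (d + 2) > 0"
    using power_strict_mono[OF ab(2,1), of d] power_strict_mono[OF ab(2,1), of "d + 2"] d by linarith+
  have x0: "x0 > 0" unfolding x0_def cell_mean_def using D d by (intro divide_pos_pos mult_pos_pos) auto
  have le: "l r \<le> ?h r" if r: "r \<in> {a..b}" for r
  proof -
    have "r\<^sup>2 \<le> (?\<nu> + 3)\<^sup>2" using r ab \<nu> by (intro power_mono) auto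
    then have "hyp ?\<nu> x0 - hyp' ?\<nu> x0 * (r\<^sup>2 / 4 - x0) \<le> hyp ?\<nu> (r\<^sup>2 / 4)"
      using x0 m \<nu>(1) unfolding x0_def \<nu>(2)[symmetric] by (intro hyp_above_tangent) auto
    then have "- hyp' ?\<nu> x0 * (r\<^sup>2 / 4 - x0) \<le> \<bar>hyp ?\<nu> (r\<^sup>2 / 4)\<bar> - y"
      using y by (simp add: x0_def)
    then have "p * y powr (p - 1) * (- hyp' ?\<nu> x0 * (r\<^sup>2 / 4 - x0)) \<le> p * y powr (p - 1) * (\<bar>hyp ?\<nu> (r\<^sup>2 / 4)\<bar> - y)"
      using p y by (intro mult_left_mono) auto
    also have "\<dots> \<le> \<bar>hyp ?\<nu> (r\<^sup>2 / 4)\<bar> powr p - y powr p"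
      using powr_above_tangent[OF p y(1), of "\<bar>hyp ?\<nu> (r\<^sup>2 / 4)\<bar>"] by simp
    finally have "A + B * (r\<^sup>2 / 4 - x0) \<le> \<bar>hyp ?\<nu> (r\<^sup>2 / 4)\<bar> powr p"
      by (simp add: A_def B_def mult.assoc)
    then show ?thesis unfolding l_def using r ab by (intro mult_right_mono) auto
  qed
  define P where "P = (\<lambda>r. (A - B * x0) * (r ^ d / real d) + B / 4 * (r ^ (d + 2) / (real d + 2)))"
  have dP: "(P has_real_derivative l r) (at r)" for r
  proof -
    have "(P has_real_derivative (A - B * x0) * (real d * r ^ (d - 1) / real d)
        + B / 4 * (real (d + 2) * r ^ (d + 1) / (real d + 2))) (at r)"
      unfolding P_def
      by (intro DERIV_cong[OF DERIV_add[OF DERIV_cmult[OF DERIV_cdivide[OF DERIV_pow]] DERIV_cmult[OF DERIV_cdivide[OF DERIV_pow]]]]) simp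
    also have "(A - B * x0) * (real d * r ^ (d - 1) / real d)
        + B / 4 * (real (d + 2) * r ^ (d + 1) / (real d + 2)) = (A - B * x0) * r ^ (d - 1) + B / 4 * r ^ (d + 1)"
    proof -
      have "real (d + 2) * x / (real d + 2) = x" "real d * x / real d = x" for x
        using d by (simp_all add: add.commute)
      then show ?thesis by (simp only:)
    qed
    also have "r ^ (d + 1) = r\<^sup>2 * r ^ (d - 1)"
      using d by (simp add: power_add[symmetric])
    finally show ?thesis by (simp add: l_def algebra_simps)
  qed
  have "(l has_integral (P b - P a)) {a..b}"
    using ab dP by (intro fundamental_theorem_of_calculus)
      (auto simp: has_real_derivative_iff_has_vector_derivative[symmetric] intro: DERIV_subset)
  moreover have "P b - P a = A * ((b ^ d - a ^ d) / real d)"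
  proof -
    have "P b - P a = (A - B * x0) * ((b ^ d - a ^ d) / real d) + B * ((b ^ (d + 2) - a ^ (d + 2)) / (4 * (real d + 2)))"
      unfolding P_def by (simp add: diff_divide_distrib right_diff_distrib)
    moreover have "x0 * ((b ^ d - a ^ d) / real d) = (b ^ (d + 2) - a ^ (d + 2)) / (4 * (real d + 2))"
      unfolding x0_def cell_mean_def using D(1) d by simp
    moreover have "(A - B * x0) * m + B * n = A * m" if "x0 * m = n" for m n
      using that by (simp add: left_diff_distrib mult.assoc)
    ultimately show ?thesis by metis
  qed
  ultimately have li: "l integrable_on {a..b}" "integral {a..b} l = y powr p * ((b ^ d - a ^ d) / real d)"
    by (auto simp: A_def integrable_on_def integral_unique)
  have "?h integrable_on {a..b}"
    using p \<nu> ab by (intro integrable_continuous_real continuous_intros continuous_on_powr'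
        continuous_on_compose2[OF continuous_on_hyp[of _ UNIV]]) auto
  then have "integral {a..b} l \<le> integral {a..b} ?h"
    by (intro integral_le li(1) le)
  then show ?thesis unfolding li .
qed

fun cells_ok :: "nat \<Rightarrow> real \<Rightarrow> (real \<times> real) list \<Rightarrow> bool" where
  "cells_ok d a [] \<longleftrightarrow> True"
| "cells_ok d a ((b, y) # cs) \<longleftrightarrow> a < b \<and> b \<le> real d / 2 + 2 \<and> 4 * cell_mean d a b < (real d / 2 + 2)\<^sup>2
     \<and> 0 < y \<and> y \<le> hyp (real d / 2 - 1) (cell_mean d a b) \<and> cells_ok d b cs"

text \<open>The function of the height is a parameter because three kinds of sums over the same
  cells are compared: the powers \<open>y powr q\<close>, the growth terms
  \<open>y powr (q - 1) * (y - M)\<close>, and their rational forms in \<open>z\<close>.\<close>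

fun cell_sum :: "nat \<Rightarrow> (real \<Rightarrow> real) \<Rightarrow> real \<Rightarrow> (real \<times> real) list \<Rightarrow> real" where
  "cell_sum d f a [] = 0"
| "cell_sum d f a ((b, y) # cs) = f y * ((b ^ d - a ^ d) / real d) + cell_sum d f b cs"

lemma cell_sum_le_integral:
  assumes "d \<ge> 2" "p \<ge> 1" "0 \<le> a" "cells_ok d a cs"
  shows "\<exists>R\<ge>a. cell_sum d (\<lambda>y. y powr p) a cs \<le> integral {a..R} (\<lambda>r. \<bar>hyp (real d / 2 - 1) (r\<^sup>2 / 4)\<bar> powr p * r ^ (d - 1))"
  using assms(3,4)
proof (induction cs arbitrary: a)
  case Nil
  then show ?case by (intro exI[of _ a]) simp
next
  case (Cons c cs)
  obtain b y where c: "c = (b, y)" by (cases c)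
  let ?h = "\<lambda>r. \<bar>hyp (real d / 2 - 1) (r\<^sup>2 / 4)\<bar> powr p * r ^ (d - 1)"
  from Cons.prems c have ab: "a < b" "cells_ok d b cs" by auto
  obtain R where R: "R \<ge> b" "cell_sum d (\<lambda>y. y powr p) b cs \<le> integral {b..R} ?h"
    using Cons.IH[of b] ab Cons.prems by auto
  have "y powr p * ((b ^ d - a ^ d) / real d) \<le> integral {a..b} ?h"
    using Cons.prems c by (intro cell_integral assms(1,2)) auto
  moreover have "?h integrable_on {a..R}"
    using assms Cons.prems by (intro integrable_continuous_real continuous_intros continuous_on_powr'
        continuous_on_compose2[OF continuous_on_hyp[of _ UNIV]]) auto
  then have "integral {a..b} ?h + integral {b..R} ?h = integral {a..R} ?h"
    using ab R by (intro Henstock_Kurzweil_Integration.integral_combine) auto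
  ultimately show ?case using R ab c by (intro exI[of _ R]) auto
qed

lemma cell_sum_le_LBINT:
  assumes d: "d \<ge> 2" and p: "p > 2 * real d / (real d - 1)" and cs: "cells_ok d 0 cs"
  shows "radial_0 d powr p * cell_sum d (\<lambda>y. y powr p) 0 cs \<le> (LBINT r:{0<..}. \<bar>radial d 0 r\<bar> powr p * r ^ (d - 1))"
proof -
  let ?h = "\<lambda>r. \<bar>hyp (real d / 2 - 1) (r\<^sup>2 / 4)\<bar> powr p * r ^ (d - 1)"
  let ?f = "\<lambda>r. \<bar>radial d 0 r\<bar> powr p * r ^ (d - 1)"
  have "real d - 1 > 0" using d by simp
  then have "2 * real d / (real d - 1) \<ge> 2" by (simp add: field_simps)
  then have p1: "p \<ge> 1" using p by simp
  obtain R where R: "R \<ge> 0" "cell_sum d (\<lambda>y. y powr p) 0 cs \<le> integral {0..R} ?h"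
    using cell_sum_le_integral[OF d p1 order_refl cs] by auto
  have int: "set_integrable lborel {0<..} ?f" by (rule radial_0_integrable[OF d p])
  have "continuous_on {0..R} ?h"
    using d p1 by (intro continuous_intros continuous_on_powr' continuous_on_compose2[OF continuous_on_hyp[of _ UNIV]]) auto
  then have hi: "set_integrable lborel {0..R} ?h" by (rule borel_integrable_atLeastAtMost')
  have "integral {0..R} ?h = (LBINT r:{0..R}. ?h r)" by (rule set_borel_integral_eq_integral(2)[OF hi, symmetric])
  also have "\<dots> = (LBINT r:{0<..R}. ?h r)"
    using interval_integral_Icc[of 0 R ?h] interval_integral_Ioc[of 0 R ?h] R by simp
  finally have "radial_0 d powr p * integral {0..R} ?h = (LBINT r:{0<..R}. radial_0 d powr p * ?h r)" by simp
  also have "\<dots> = (LBINT r:{0<..R}. ?f r)"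
    using d radial_0_pos[OF d]
    by (intro set_lebesgue_integral_cong) (auto simp: radial_eq abs_mult powr_mult bindex_def)
  also have "\<dots> \<le> (LBINT r:{0<..R}. ?f r) + (LBINT r:{R<..}. ?f r)"
    using R by (simp add: set_lebesgue_integral_def) (intro integral_nonneg_AE AE_I2, auto simp: indicator_def)
  also have "\<dots> = (LBINT r:{0<..R} \<union> {R<..}. ?f r)"
    using R by (intro set_integral_Un[symmetric] set_integrable_subset[OF int]) auto
  also have "{0<..R} \<union> {R<..} = {0<..}" using R by auto
  finally show ?thesis using R(2) by (smt (verit) mult_left_mono powr_ge_zero)
qed

text \<open>This holds because \<open>t powr s \<ge> 1 + s * ln t \<ge> 1 + s * (1 - 1 / t)\<close> for \<open>t = y / M\<close> and \<open>s = p - q\<close>.\<close>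

lemma powr_growth:
  fixes y M p q :: real
  assumes "y > 0" "M > 0" "q \<le> p"
  shows "M powr (p - q) * (y powr q + (p - q) * (y powr (q - 1) * (y - M))) \<le> y powr p"
proof -
  define t s where "t = y / M" and "s = p - q"
  have t: "t > 0" and s: "s \<ge> 0" using assms by (auto simp: t_def s_def)
  have "1 - 1 / t \<le> ln t" using ln_le_minus_one[of "1 / t"] t by (simp add: ln_div)
  then have "1 + s * (1 - 1 / t) \<le> 1 + s * ln t" using s by (simp add: mult_left_mono)
  also have "\<dots> \<le> exp (s * ln t)" by (rule exp_ge_add_one_self)
  also have "\<dots> = t powr s" using t by (simp add: powr_def)
  finally have "M powr s * y powr q * (1 + s * (1 - 1 / t)) \<le> M powr s * y powr q * t powr s"
    by (intro mult_left_mono) auto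
  also have "M powr s * y powr q * t powr s = y powr p"
    using assms by (simp add: t_def s_def powr_divide powr_diff)
  also have "M powr s * y powr q * (1 + s * (1 - 1 / t)) = M powr (p - q) * (y powr q + (p - q) * (y powr (q - 1) * (y - M)))"
  proof -
    have "y powr q = y powr (q - 1) * y" using assms powr_mult_base[of y "q - 1"] by (simp add: mult.commute)
    then have "y powr q * (1 - 1 / t) = y powr (q - 1) * (y - M)"
      using assms by (simp add: t_def field_simps)
    then have "y powr q * (1 + s * (1 - 1 / t)) = y powr q + s * (y powr (q - 1) * (y - M))"
      by (simp add: distrib_left mult.left_commute[of _ s])
    then show ?thesis by (simp add: s_def mult.assoc)
  qed
  finally show ?thesis .
qed

lemma cell_sum_growth:
  assumes "M > 0" "q \<le> p" "0 \<le> a" "cells_ok d a cs"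
  shows "M powr (p - q) * (cell_sum d (\<lambda>y. y powr q) a cs + (p - q) * cell_sum d (\<lambda>y. y powr (q - 1) * (y - M)) a cs)
    \<le> cell_sum d (\<lambda>y. y powr p) a cs"
  using assms(3,4)
proof (induction cs arbitrary: a)
  case (Cons c cs)
  obtain b y where c: "c = (b, y)" by (cases c)
  from Cons.prems c have ab: "a < b" "cells_ok d b cs" "y > 0" by auto
  let ?m = "(b ^ d - a ^ d) / real d"
  have m: "?m \<ge> 0" using ab Cons.prems by (intro divide_nonneg_nonneg) (auto intro!: power_mono)
  have "M powr (p - q) * (y powr q + (p - q) * (y powr (q - 1) * (y - M))) * ?m \<le> y powr p * ?m"
    by (intro mult_right_mono m powr_growth assms(1,2) ab)
  moreover have "M powr (p - q) * (cell_sum d (\<lambda>y. y powr q) b cs + (p - q) * cell_sum d (\<lambda>y. y powr (q - 1) * (y - M)) b cs)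
    \<le> cell_sum d (\<lambda>y. y powr p) b cs"
    using Cons.IH[of b] ab Cons.prems by simp
  moreover have "w * (u * m + S1 + (p - q) * (v * m + S2)) = w * (u + (p - q) * v) * m + w * (S1 + (p - q) * S2)"
    for u v w m S1 S2 :: real by (simp add: algebra_simps)
  ultimately show ?case unfolding c cell_sum.simps by (simp only: add_mono)
qed simp

section \<open>Criteria for an upper bound on the threshold\<close>

lemma tendsto_radial_at_0:
  assumes "d \<ge> 2"
  shows "(radial d k \<longlongrightarrow> (if k = 0 then radial_0 d else 0)) (at_right 0)"
proof -
  let ?f = "\<lambda>r. radial_0 d * (r / 2) ^ k / pochhammer (real d / 2) k * hyp (bindex d k) (r\<^sup>2 / 4)"
  have "isCont ?f 0"
    using assms pochhammer_pos[of "real d / 2" k]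
    by (intro continuous_intros isCont_o2[OF _ isCont_hyp] bindex_nonneg) auto
  then have "(?f \<longlongrightarrow> ?f 0) (at_right 0)" by (rule isCont_tendsto_at_right)
  also have "?f 0 = (if k = 0 then radial_0 d else 0)" by simp
  finally have "(?f \<longlongrightarrow> (if k = 0 then radial_0 d else 0)) (at_right 0)" .
  moreover have "\<forall>\<^sub>F r in at_right 0. ?f r = radial d k r"
    using eventually_at_right_less[of 0] by eventually_elim (use assms in \<open>simp add: radial_eq\<close>)
  ultimately show ?thesis by (rule Lim_transform_eventually)
qed

text \<open>The infimum yields only \<open>p0 d \<le> q\<close>, so strictness has to come from
  \<open>q < Q\<close>. The exponent infinity is settled by \<open>M\<close> alone, since the
  supremum for \<open>k = 0\<close> is at least the limit \<open>radial_0 d\<close> at the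
  origin.\<close>

lemma p0_less:
  assumes d: "d \<ge> 2" and q: "q \<ge> 2 * real d / (real d - 1)" and Q: "q < Q"
    and int: "\<And>p k. q < p \<Longrightarrow> k \<ge> 1 \<Longrightarrow>
       (LBINT r:{0<..}. \<bar>radial d k r\<bar> powr p * r ^ (d - 1)) < (LBINT r:{0<..}. \<bar>radial d 0 r\<bar> powr p * r ^ (d - 1))"
    and sup: "\<And>k r. k \<ge> 1 \<Longrightarrow> r > 0 \<Longrightarrow> \<bar>radial d k r\<bar> \<le> M" and M: "M < radial_0 d"
  shows "p0 d < ereal Q"
proof -
  have Lim: "radial_ext d k 0 = (if k = 0 then radial_0 d else 0)" for k
    using tendsto_Lim[OF _ tendsto_radial_at_0[OF d, of k]] by (simp add: radial_ext_def)
  have "Lambda d p k < Lambda d p 0" if p: "ereal q < p" and k: "k \<ge> 1" for p k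
  proof (cases "p = \<infinity>")
    case True
    have M0: "M \<ge> 0" using sup[of 1 1] abs_ge_zero[of "radial d 1 1"] by linarith
    have "\<bar>radial_ext d k r\<bar> \<le> M" if "r \<ge> 0" for r
      using sup[OF k, of r] Lim[of k] M0 k that by (cases "r = 0") (simp_all add: radial_ext_def)
    then have "(SUP r\<in>{0..}. \<bar>radial_ext d k r\<bar>) \<le> M" by (intro cSUP_least) auto
    moreover have "\<bar>radial_ext d 0 0\<bar> \<le> (SUP r\<in>{0..}. \<bar>radial_ext d 0 r\<bar>)"
    proof (rule cSUP_upper)
      have "\<bar>radial_ext d 0 r\<bar> \<le> radial_0 d" if "r \<ge> 0" for r
        using abs_radial_0_le[OF d, of r] Lim[of 0] radial_0_pos[OF d] that
        by (cases "r = 0") (simp_all add: radial_ext_def)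
      then show "bdd_above ((\<lambda>r. \<bar>radial_ext d 0 r\<bar>) ` {0..})"
        by (intro bdd_aboveI[of _ "radial_0 d"]) auto
    qed simp
    ultimately show ?thesis using True M Lim[of 0] radial_0_pos[OF d] by (simp add: Lambda_def)
  next
    case False
    then obtain p' where p': "p = ereal p'" "q < p'" using p by (cases p) auto
    have "real d - 1 > 0" using d by simp
    then have "2 * real d / (real d - 1) \<ge> 0" by simp
    then have "p' > 0" using p' q by simp
    moreover have "(LBINT r:{0<..}. \<bar>radial d k r\<bar> powr p' * r ^ (d - 1)) \<ge> 0"
      by (simp add: set_lebesgue_integral_def) (intro integral_nonneg_AE AE_I2, auto simp: indicator_def)
    ultimately show ?thesis using int[OF p'(2) k] p' by (simp add: Lambda_def powr_less_mono2)
  qed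
  then have "q \<in> {q. q \<ge> 2 * real d / (real d - 1) \<and>
     (\<forall>p::ereal. ereal q < p \<longrightarrow> (\<forall>k\<ge>1. Lambda d p k < Lambda d p 0))}" using q by auto
  then have "p0 d \<le> ereal q" unfolding p0_def by (intro Inf_lower imageI)
  then show ?thesis using Q by (simp add: le_less_trans)
qed

text \<open>The last premise on the cells says that \<open>M\<close> is at most the mean of the
  heights with weights \<open>y powr (q - 1)\<close> times the cell masses. It makes the term linear
  in \<open>p - q\<close> in \<open>cell_sum_growth\<close> nonnegative, although single heights may
  lie below \<open>M\<close>.\<close>

lemma radial_integral_less:
  assumes d: "d \<ge> 2" and q: "q > 2 * real d / (real d - 1)" "q \<le> p" and k: "k \<ge> 1"
    and M: "M > 0" and sup: "\<And>r. r > 0 \<Longrightarrow> \<bar>radial d k r\<bar> \<le> M * radial_0 d"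
    and int: "set_integrable lborel {0<..} (\<lambda>r. \<bar>radial d k r\<bar> powr q * r ^ (d - 1))"
      "(LBINT r:{0<..}. \<bar>radial d k r\<bar> powr q * r ^ (d - 1)) \<le> B * radial_0 d powr q"
    and cs: "cells_ok d 0 cs" "B < cell_sum d (\<lambda>y. y powr q) 0 cs"
      "0 \<le> cell_sum d (\<lambda>y. y powr (q - 1) * (y - M)) 0 cs"
  shows "(LBINT r:{0<..}. \<bar>radial d k r\<bar> powr p * r ^ (d - 1)) < (LBINT r:{0<..}. \<bar>radial d 0 r\<bar> powr p * r ^ (d - 1))"
proof -
  let ?F = "radial_0 d" and ?f = "\<lambda>p r. \<bar>radial d k r\<bar> powr p * r ^ (d - 1)"
  have F: "?F > 0" by (rule radial_0_pos[OF d])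
  have "real d - 1 > 0" using d by simp
  then have "2 * real d / (real d - 1) \<ge> 0" by simp
  then have q0: "q > 0" using q by simp
  have le: "?f p r \<le> (M * ?F) powr (p - q) * ?f q r" if "r > 0" for r
  proof -
    have "\<bar>radial d k r\<bar> powr p = \<bar>radial d k r\<bar> powr (p - q) * \<bar>radial d k r\<bar> powr q"
      using q by (simp add: powr_add[symmetric])
    also have "\<dots> \<le> (M * ?F) powr (p - q) * \<bar>radial d k r\<bar> powr q"
      using sup[OF that] q by (intro mult_right_mono powr_mono2) auto
    finally show ?thesis using that by (simp add: mult.assoc[symmetric] mult_right_mono)
  qed
  have gi: "set_integrable lborel {0<..} (\<lambda>r. (M * ?F) powr (p - q) * ?f q r)"
    by (intro set_integrable_mult_right impI int)
  have fm: "set_borel_measurable lborel {0<..} (?f p)" using d q0 q by (intro set_borel_measurable_radial) auto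
  have "(LBINT r:{0<..}. ?f p r) \<le> (LBINT r:{0<..}. (M * ?F) powr (p - q) * ?f q r)"
    by (rule set_integral_le_of_nonneg(2)[OF fm gi _ le]) simp_all
  also have "\<dots> = (M * ?F) powr (p - q) * (LBINT r:{0<..}. ?f q r)" by (rule set_integral_mult_right)
  also have "\<dots> \<le> (M * ?F) powr (p - q) * (B * ?F powr q)" by (intro mult_left_mono int(2)) simp
  also have "\<dots> < (M * ?F) powr (p - q) * (cell_sum d (\<lambda>y. y powr q) 0 cs * ?F powr q)"
    using cs(2) F M by (intro mult_strict_left_mono mult_strict_right_mono) auto
  also have "\<dots> = ?F powr p * (M powr (p - q) * cell_sum d (\<lambda>y. y powr q) 0 cs)"
    using F M by (simp add: powr_mult powr_diff)
  also have "\<dots> \<le> ?F powr p * cell_sum d (\<lambda>y. y powr p) 0 cs"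
  proof (rule mult_left_mono)
    have "M powr (p - q) * cell_sum d (\<lambda>y. y powr q) 0 cs
      \<le> M powr (p - q) * (cell_sum d (\<lambda>y. y powr q) 0 cs + (p - q) * cell_sum d (\<lambda>y. y powr (q - 1) * (y - M)) 0 cs)"
      using cs(3) q by (intro mult_left_mono) auto
    also have "\<dots> \<le> cell_sum d (\<lambda>y. y powr p) 0 cs" by (rule cell_sum_growth[OF M q(2) order_refl cs(1)])
    finally show "M powr (p - q) * cell_sum d (\<lambda>y. y powr q) 0 cs \<le> cell_sum d (\<lambda>y. y powr p) 0 cs" .
  qed simp
  also have "\<dots> \<le> (LBINT r:{0<..}. \<bar>radial d 0 r\<bar> powr p * r ^ (d - 1))"
    using q by (intro cell_sum_le_LBINT d cs) auto
  finally show ?thesis .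
qed

section \<open>Bounds for the normalised squares\<close>

definition rad_sq :: "nat \<Rightarrow> nat \<Rightarrow> real \<Rightarrow> real" where
  "rad_sq d k r = (radial d k r / radial_0 d)\<^sup>2"

text \<open>The constant of every envelope after normalisation. It satisfies
  \<open>rad_K (d + 2) = d^2 * rad_K d\<close>, and in dimension 3 the \<open>pi\<close> of
  \<open>amp_bound\<close> cancels against that of \<open>radial_0\<close>, so it is rational in all
  dimensions used.\<close>

definition rad_K :: "nat \<Rightarrow> real" where
  "rad_K d = amp_bound d / (radial_0 d)\<^sup>2"

lemma rad_sq_nonneg [simp]: "rad_sq d k r \<ge> 0"
  by (simp add: rad_sq_def)

lemma rad_K_pos: "d \<ge> 2 \<Longrightarrow> rad_K d > 0"
  using radial_0_pos[of d] by (simp add: rad_K_def amp_bound_def)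

lemma rad_sq_eq_bessel:
  assumes "d \<ge> 2" "r > 0"
  shows "rad_sq d k r = (bessel_J (bindex d k) r)\<^sup>2 / r ^ (d - 2) / (radial_0 d)\<^sup>2"
  using assms by (simp add: rad_sq_def radial_square power_divide)

lemma rad_sq_le_of_bessel:
  assumes "d \<ge> 2" "r > 0" "(bessel_J (bindex d k) r)\<^sup>2 \<le> amp_bound d * A"
  shows "rad_sq d k r \<le> rad_K d * A / r ^ (d - 2)"
proof -
  have "(bessel_J (bindex d k) r)\<^sup>2 / r ^ (d - 2) / (radial_0 d)\<^sup>2 \<le> amp_bound d * A / r ^ (d - 2) / (radial_0 d)\<^sup>2"
    using assms by (intro divide_right_mono) auto
  then show ?thesis unfolding rad_sq_eq_bessel[OF assms(1,2)] rad_K_def by (simp add: mult.commute)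
qed

lemma rad_sq_le_sqrt:
  assumes "d \<ge> 2" "r > bindex d k"
  shows "rad_sq d k r \<le> rad_K d / (sqrt (r\<^sup>2 - (bindex d k)\<^sup>2) * r ^ (d - 2))"
  using rad_sq_le_of_bessel[of d r k "1 / sqrt (r\<^sup>2 - (bindex d k)\<^sup>2)"] bessel_square_le_bindex[OF assms]
    bindex_nonneg[OF assms(1), of k] assms by simp

lemma rad_sq_le_sup:
  assumes "d \<ge> 2" "k \<ge> 1" "r > 0"
  shows "rad_sq d k r \<le> rad_K d / (sqrt (2 * bindex d k) * r ^ (d - 2))"
  using rad_sq_le_of_bessel[of d r k "1 / sqrt (2 * bindex d k)"] bessel_square_le_bindex_sup[OF assms] assms by simp

lemma rad_sq_le_nicholson:
  assumes "d \<ge> 2" "c = (bindex d k)\<^sup>2 - 1 / 4" "2 \<le> c" "c \<le> 6" "r > 0"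
  shows "rad_sq d k r \<le> rad_K d * (1 + c / (2 * r\<^sup>2) + 3 * c * (c - 2) / (8 * r ^ 4)) / r ^ (d - 1)"
proof -
  let ?N = "1 + c / (2 * r\<^sup>2) + 3 * c * (c - 2) / (8 * r ^ 4)"
  have "(bessel_J (bindex d k) r)\<^sup>2 \<le> amp_bound d * (?N / r)"
    using bessel_square_le_bindex_nicholson[OF assms] assms(5) by (simp add: field_simps)
  from rad_sq_le_of_bessel[OF assms(1,5) this]
  have "rad_sq d k r \<le> rad_K d * (?N / r) / r ^ (d - 2)" .
  also have "\<dots> = rad_K d * ?N / (r * r ^ (d - 2))" by simp
  also have "r * r ^ (d - 2) = r ^ (d - 1)"
  proof -
    have "d - 1 = Suc (d - 2)" using assms(1) by simp
    then show ?thesis by simp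
  qed
  finally show ?thesis .
qed

text \<open>\<open>rad_sq d k r ^ m * r ^ (2 * n)\<close> is a power of \<open>r\<^sup>2 * \<bar>radial d k r\<bar> powr (q - 2)\<close> for \<open>q = 2 + 2 * m / n\<close>.\<close>

lemma rad_sq_power_mono:
  fixes n m :: nat
  assumes d: "d \<ge> 2" and m: "m \<ge> 1" and \<beta>: "\<beta> = real d / 2 - 1 - real n / real m" "- 1 \<le> \<beta>" "\<beta> \<le> bindex d k"
    and r: "0 < r" "r \<le> R" and R: "R\<^sup>2 \<le> (bindex d k - \<beta>) * (bindex d k + 2 + \<beta>)"
  shows "rad_sq d k r ^ m * r ^ (2 * n) \<le> rad_sq d k R ^ m * R ^ (2 * n)"
proof -
  let ?\<mu> = "bindex d k"
  have \<mu>: "?\<mu> \<ge> 0" by (rule bindex_nonneg[OF d])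
  \<comment> \<open>\<open>\<beta>\<close> is chosen such that the power \<open>2 * m\<close> of
    \<open>s powr (- \<beta>)\<close> combines \<open>s^(2 * n)\<close> with the factor
    \<open>s^(- (d - 2) * m)\<close> contained in \<open>rad_sq\<close>.\<close>
  have *: "rad_sq d k s ^ m * s ^ (2 * n) = (bessel_J ?\<mu> s * s powr (- \<beta>)) ^ (2 * m) / (radial_0 d)\<^sup>2 ^ m"
    if s: "s > 0" for s
  proof -
    have "(s powr (- \<beta>)) ^ (2 * m) = s powr (- \<beta> * real (2 * m))" using s by (simp add: powr_power mult.commute)
    also have "- \<beta> * real (2 * m) = real (2 * n) - real (d - 2) * real m"
      using m d by (simp add: \<beta> of_nat_diff field_simps)
    also have "s powr \<dots> = s ^ (2 * n) / (s ^ (d - 2)) ^ m"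
      using s powr_realpow[of s "2 * n"] powr_realpow[of s "(d - 2) * m"] by (simp add: powr_diff power_mult)
    finally have e: "(s powr (- \<beta>)) ^ (2 * m) = s ^ (2 * n) / (s ^ (d - 2)) ^ m" .
    show ?thesis unfolding rad_sq_eq_bessel[OF d s] power_mult_distrib e
      by (simp add: power_divide power_mult power_mult_distrib)
  qed
  have "(?\<mu> - \<beta>) * (?\<mu> + 2 + \<beta>) = (?\<mu> + 1)\<^sup>2 - (\<beta> + 1)\<^sup>2" by (simp add: power2_eq_square algebra_simps)
  then have "R\<^sup>2 \<le> (?\<mu> + 1)\<^sup>2" using R zero_le_power2[of "\<beta> + 1"] by linarith
  then have "R \<le> ?\<mu> + 1" by (rule power2_le_imp_le) (use \<mu> in simp)
  then have "bessel_J ?\<mu> r > 0" using r \<mu> by (intro bessel_J_pos) auto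
  moreover have "bessel_J ?\<mu> r * r powr (- \<beta>) \<le> bessel_J ?\<mu> R * R powr (- \<beta>)"
    by (rule bessel_J_powr_mono[OF \<mu> \<beta>(2,3) r R])
  ultimately have "(bessel_J ?\<mu> r * r powr (- \<beta>)) ^ (2 * m) \<le> (bessel_J ?\<mu> R * R powr (- \<beta>)) ^ (2 * m)"
    by (intro power_mono) auto
  then show ?thesis using r by (simp add: * divide_right_mono)
qed

text \<open>If \<open>2 * n \<le> (d - 2) * m\<close>, the supremum bound of \<open>J^2\<close>
  leaves a nonpositive power of \<open>r\<close>, hence a decreasing majorant beyond
  \<open>R\<close>. Before \<open>R\<close> the weighted function increases, so the value of the
  majorant at \<open>R\<close> bounds it everywhere.\<close>

lemma rad_sq_power_le_sup:
  fixes n m :: nat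
  assumes d: "d \<ge> 2" and k: "k \<ge> 1" and m: "m \<ge> 1" and nm: "2 * n \<le> (d - 2) * m"
    and \<beta>: "\<beta> = real d / 2 - 1 - real n / real m" and R: "R > 0" "R\<^sup>2 \<le> (bindex d k - \<beta>) * (bindex d k + 2 + \<beta>)"
    and r: "r > 0"
  shows "rad_sq d k r ^ m * r ^ (2 * n) \<le> (rad_K d / sqrt (2 * bindex d k)) ^ m / R ^ ((d - 2) * m - 2 * n)"
proof -
  have \<mu>: "bindex d k > 0" by (rule bindex_pos[OF d k])
  have far: "rad_sq d k s ^ m * s ^ (2 * n) \<le> (rad_K d / sqrt (2 * bindex d k)) ^ m / R ^ ((d - 2) * m - 2 * n)"
    if s: "s \<ge> R" for s
  proof -
    have s0: "s > 0" using s R by simp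
    have "rad_sq d k s ^ m \<le> (rad_K d / (sqrt (2 * bindex d k) * s ^ (d - 2))) ^ m"
      by (intro power_mono rad_sq_le_sup d k s0) simp
    then have "rad_sq d k s ^ m * s ^ (2 * n) \<le> (rad_K d / (sqrt (2 * bindex d k) * s ^ (d - 2))) ^ m * s ^ (2 * n)"
      using s0 by (intro mult_right_mono) auto
    also have "\<dots> = (rad_K d / sqrt (2 * bindex d k)) ^ m * (s ^ (2 * n) / s ^ ((d - 2) * m))"
      by (simp add: power_divide power_mult_distrib power_mult)
    also have "s ^ (2 * n) / s ^ ((d - 2) * m) = 1 / s ^ ((d - 2) * m - 2 * n)"
      using s0 nm by (simp add: power_diff)
    also have "(rad_K d / sqrt (2 * bindex d k)) ^ m * (1 / s ^ ((d - 2) * m - 2 * n))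
      \<le> (rad_K d / sqrt (2 * bindex d k)) ^ m * (1 / R ^ ((d - 2) * m - 2 * n))"
      using s R rad_K_pos[OF d] \<mu> by (intro mult_left_mono divide_left_mono power_mono) auto
    finally show ?thesis by simp
  qed
  show ?thesis
  proof (cases "r \<le> R")
    case True
    have "real (2 * n) \<le> real ((d - 2) * m)" using nm by (simp only: of_nat_le_iff)
    then have b: "\<beta> \<ge> 0" unfolding \<beta> using m d by (simp add: of_nat_diff field_simps)
    have "real n / real m \<ge> 0" by simp
    then have b': "\<beta> \<le> bindex d k" unfolding \<beta> bindex_def by linarith
    show ?thesis
      using rad_sq_power_mono[OF d m \<beta> _ b' r True R(2)] far[of R] b by simp
  qed (use far in simp)
qed

text \<open>The right-hand side is the maximum, attained at \<open>y = N / c\<close>; the bound is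
  the \<open>N\<close>-th power of \<open>t \<le> exp (t - 1)\<close> with
  \<open>t = c * y / N\<close>.\<close>

lemma power_times_exp_le:
  fixes y c :: real
  assumes "c > 0" "N \<ge> 1" "y \<ge> 0"
  shows "y ^ N * exp (- c * y) \<le> (real N / (c * exp 1)) ^ N"
proof -
  define t where "t = c * y / real N"
  have "t \<le> exp (t - 1)" using exp_ge_add_one_self[of "t - 1"] by simp
  then have "t * exp (- t) \<le> exp (t - 1) * exp (- t)" by (intro mult_right_mono) auto
  also have "\<dots> = exp (t - 1 + - t)" by (rule exp_add[symmetric])
  also have "\<dots> = 1 / exp 1" by (simp add: exp_minus inverse_eq_divide)
  finally have "(real N / c) * (t * exp (- t)) \<le> (real N / c) * (1 / exp 1)"
    using assms by (intro mult_left_mono) auto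
  then have "y * exp (- t) \<le> real N / (c * exp 1)" using assms by (simp add: t_def)
  then have "(y * exp (- t)) ^ N \<le> (real N / (c * exp 1)) ^ N" using assms by (intro power_mono) auto
  moreover have "exp (- t) ^ N = exp (- c * y)"
    using assms by (simp add: t_def exp_of_nat_mult[symmetric])
  ultimately show ?thesis by (simp add: power_mult_distrib)
qed

lemma rad_sq_1_le_exp:
  assumes d: "d \<ge> 2" and r: "0 < r" "r \<le> real d / 2 + 1"
  shows "rad_sq d 1 r \<le> r\<^sup>2 / (real d)\<^sup>2 * exp (- r\<^sup>2 / (real d + 2))"
proof -
  let ?x = "r\<^sup>2 / 4" and ?\<mu> = "real d / 2"
  have r2: "r\<^sup>2 \<le> (?\<mu> + 1)\<^sup>2" "r\<^sup>2 \<le> (?\<mu> + 3)\<^sup>2" using r by (auto intro!: power_mono)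
  have F: "radial_0 d > 0" by (rule radial_0_pos[OF d])
  have h: "0 \<le> hyp ?\<mu> ?x" "hyp ?\<mu> ?x \<le> exp (- ?x / (?\<mu> + 1))"
    using hyp_pos[of ?\<mu> ?x] hyp_le_exp[of ?\<mu> ?x] r2 by simp_all
  have "radial d 1 r / radial_0 d = r / real d * hyp ?\<mu> ?x"
    using F by (simp add: radial_eq[OF d r(1)] bindex_def)
  then have "rad_sq d 1 r = (r / real d)\<^sup>2 * (hyp ?\<mu> ?x)\<^sup>2" by (simp add: rad_sq_def power_mult_distrib power_divide)
  also have "\<dots> \<le> (r / real d)\<^sup>2 * (exp (- ?x / (?\<mu> + 1)))\<^sup>2"
    using h by (intro mult_left_mono power_mono) auto
  also have "(exp (- ?x / (?\<mu> + 1)))\<^sup>2 = exp (- r\<^sup>2 / (real d + 2))"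
    by (simp add: exp_double[symmetric] field_simps)
  finally show ?thesis by (simp add: power_divide)
qed

text \<open>Up to \<open>r = d / 2 + 1\<close> the Gaussian bound is maximised by
  \<open>power_times_exp_le\<close>, which gives \<open>E\<close>. Beyond that radius
  \<open>r^2 - d^2 / 4 \<ge> d + 1\<close>, and the envelope with a nonpositive power of
  \<open>r\<close> gives \<open>V\<close>.\<close>

lemma rad_sq_1_power_le:
  fixes n m :: nat
  assumes d: "d \<ge> 2" and m: "m \<ge> 1" and nm: "2 * n \<le> (d - 2) * m" and r: "r > 0"
    and E: "((real (n + m) * (real d + 2)) / (real m * exp 1)) ^ (n + m) / real d ^ (2 * m) \<le> C"
    and V: "(rad_K d / sqrt (real d + 1)) ^ m / (real d / 2 + 1) ^ ((d - 2) * m - 2 * n) \<le> C"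
  shows "rad_sq d 1 r ^ m * r ^ (2 * n) \<le> C"
proof (cases "r \<le> real d / 2 + 1")
  case True
  have "rad_sq d 1 r ^ m * r ^ (2 * n) \<le> (r\<^sup>2 / (real d)\<^sup>2 * exp (- r\<^sup>2 / (real d + 2))) ^ m * r ^ (2 * n)"
    using r by (intro mult_right_mono power_mono rad_sq_1_le_exp[OF d r True]) auto
  also have "\<dots> = ((r\<^sup>2) ^ (n + m) * exp (- (real m / (real d + 2)) * r\<^sup>2)) / real d ^ (2 * m)"
    by (simp add: power_mult_distrib power_divide power_add power_mult exp_of_nat_mult[symmetric])
  also have "\<dots> \<le> (real (n + m) / (real m / (real d + 2) * exp 1)) ^ (n + m) / real d ^ (2 * m)"
    using m by (intro divide_right_mono power_times_exp_le) auto
  also have "real (n + m) / (real m / (real d + 2) * exp 1) = (real (n + m) * (real d + 2)) / (real m * exp 1)"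
    by simp
  finally show ?thesis using E by simp
next
  case False
  define R where "R = real d / 2 + 1"
  have \<mu>: "bindex d 1 = real d / 2" by (simp add: bindex_def)
  have R: "R > 0" "r \<ge> R" "r > bindex d 1" using False unfolding \<mu> by (auto simp: R_def)
  have "sqrt (real d + 1) \<le> sqrt (r\<^sup>2 - (real d / 2)\<^sup>2)"
    using power_mono[OF R(2), of 2] R(1) by (simp add: R_def power2_eq_square algebra_simps)
  then have "rad_K d / (sqrt (r\<^sup>2 - (real d / 2)\<^sup>2) * r ^ (d - 2)) \<le> rad_K d / (sqrt (real d + 1) * r ^ (d - 2))"
    using rad_K_pos[OF d] r by (intro divide_left_mono mult_right_mono mult_pos_pos) (auto intro: less_le_trans[rotated])
  then have "rad_sq d 1 r \<le> rad_K d / (sqrt (real d + 1) * r ^ (d - 2))"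
    using rad_sq_le_sqrt[OF d R(3)] unfolding \<mu> by simp
  then have "rad_sq d 1 r ^ m * r ^ (2 * n) \<le> (rad_K d / (sqrt (real d + 1) * r ^ (d - 2))) ^ m * r ^ (2 * n)"
    using r by (intro mult_right_mono power_mono) auto
  also have "\<dots> = (rad_K d / sqrt (real d + 1)) ^ m * (r ^ (2 * n) / r ^ ((d - 2) * m))"
    by (simp add: power_divide power_mult_distrib power_mult)
  also have "r ^ (2 * n) / r ^ ((d - 2) * m) = 1 / r ^ ((d - 2) * m - 2 * n)"
    using r nm by (simp add: power_diff)
  also have "(rad_K d / sqrt (real d + 1)) ^ m * (1 / r ^ ((d - 2) * m - 2 * n))
    \<le> (rad_K d / sqrt (real d + 1)) ^ m * (1 / R ^ ((d - 2) * m - 2 * n))"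
    using R rad_K_pos[OF d] by (intro mult_left_mono divide_left_mono power_mono) auto
  finally show ?thesis using V by (simp add: R_def)
qed

lemma rad_integral_le:
  fixes n m :: nat
  assumes d: "d \<ge> 2" and k: "k \<ge> 1" and nm: "n \<ge> 1" "m \<ge> 1" and q: "q = 2 + 2 * real m / real n" and C: "C \<ge> 0"
    and le: "\<And>r. r > 0 \<Longrightarrow> rad_sq d k r ^ m * r ^ (2 * n) \<le> C ^ n"
  shows "set_integrable lborel {0<..} (\<lambda>r. \<bar>radial d k r\<bar> powr q * r ^ (d - 1))"
    and "(LBINT r:{0<..}. \<bar>radial d k r\<bar> powr q * r ^ (d - 1))
      \<le> (C * rad_K d / (2 * bindex d k * amp_bound d)) * radial_0 d powr q"
proof -
  let ?F = "radial_0 d"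
  have F: "?F > 0" by (rule radial_0_pos[OF d])
  have amp: "amp_bound d > 0" by (simp add: amp_bound_def)
  have *: "r\<^sup>2 * \<bar>radial d k r\<bar> powr (q - 2) \<le> C * ?F powr (q - 2)" if r: "r > 0" for r
  proof -
    define w where "w = rad_sq d k r"
    have w: "w \<ge> 0" by (simp add: w_def)
    have "\<bar>radial d k r\<bar> = ?F * sqrt w"
      using F by (simp add: w_def rad_sq_def)
    then have "\<bar>radial d k r\<bar> powr (q - 2) = ?F powr (q - 2) * sqrt w powr (q - 2)"
      using F w by (simp add: powr_mult)
    also have "sqrt w powr (q - 2) = w powr (real m / real n)"
      using w q by (simp add: powr_half_sqrt[symmetric] powr_powr)
    finally have e: "\<bar>radial d k r\<bar> powr (q - 2) = ?F powr (q - 2) * w powr (real m / real n)" .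
    have "(w powr (real m / real n)) ^ n = w ^ m"
    proof (cases "w = 0")
      case False
      then have "(w powr (real m / real n)) ^ n = w powr real m" using w nm by (simp add: powr_power)
      then show ?thesis using False w by (simp add: powr_realpow)
    qed (use nm in \<open>simp add: power_0_left\<close>)
    then have "(r\<^sup>2 * w powr (real m / real n)) ^ n = w ^ m * r ^ (2 * n)"
      by (simp add: power_mult_distrib power_mult)
    also have "\<dots> \<le> C ^ n" unfolding w_def by (rule le[OF r])
    finally have le': "(r\<^sup>2 * w powr (real m / real n)) ^ n \<le> C ^ n" .
    obtain n' where "n = Suc n'" using nm by (cases n) auto
    then have "r\<^sup>2 * w powr (real m / real n) \<le> C"
      using power_le_imp_le_base[of _ n' C] le' C by blast
    then show ?thesis unfolding e using F by (simp add: mult.left_commute)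
  qed
  have q2: "q > 2" using nm q by simp
  show "set_integrable lborel {0<..} (\<lambda>r. \<bar>radial d k r\<bar> powr q * r ^ (d - 1))"
    by (rule radial_integral_le(1)[OF d k q2 *])
  have "(LBINT r:{0<..}. \<bar>radial d k r\<bar> powr q * r ^ (d - 1)) \<le> C * ?F powr (q - 2) / (2 * bindex d k)"
    by (rule radial_integral_le(2)[OF d k q2 *])
  also have "\<dots> = (C * rad_K d / (2 * bindex d k * amp_bound d)) * ?F powr q"
  proof -
    have "?F powr q = ?F powr (q - 2) * ?F\<^sup>2" using F powr_add[of ?F "q - 2" 2] by simp
    then show ?thesis using F amp by (simp add: rad_K_def)
  qed
  finally show "(LBINT r:{0<..}. \<bar>radial d k r\<bar> powr q * r ^ (d - 1))
      \<le> (C * rad_K d / (2 * bindex d k * amp_bound d)) * radial_0 d powr q" .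
qed

lemma abs_radial_le_of_rad_sq:
  assumes "d \<ge> 2" "M \<ge> 0" "rad_sq d k r \<le> M\<^sup>2"
  shows "\<bar>radial d k r\<bar> \<le> M * radial_0 d"
proof -
  have "\<bar>radial d k r / radial_0 d\<bar> \<le> M" 
    using abs_le_square_iff[of "radial d k r / radial_0 d" M] assms(2,3) by (simp add: rad_sq_def)
  then show ?thesis using radial_0_pos[OF assms(1)] by (simp add: abs_divide pos_divide_le_eq)
qed

lemma bindex_ge:
  assumes "k \<ge> 2"
  shows "bindex d k \<ge> real d / 2 + 1"
  using assms by (simp add: bindex_def)

text \<open>The weighted estimates with \<open>m = 1\<close> and \<open>n = 0\<close>. For
  \<open>k \<ge> 2\<close> the exponent is \<open>\<beta> = d / 2 - 1\<close>, and the monotone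
  range extends to \<open>k * (k + d) \<ge> 2 * d + 4\<close>.\<close>

lemma rad_sq_le_square:
  assumes d: "d \<ge> 2" and k: "k \<ge> 1" and r: "r > 0"
    and M: "(real d + 2) / (exp 1 * (real d)\<^sup>2) \<le> M\<^sup>2" "rad_K d / sqrt (real d + 1) / (real d / 2 + 1) ^ (d - 2) \<le> M\<^sup>2"
      "rad_K d / sqrt (real d + 2) / R ^ (d - 2) \<le> M\<^sup>2" and R: "R > 0" "R\<^sup>2 \<le> 2 * real d + 4"
  shows "rad_sq d k r \<le> M\<^sup>2"
proof (cases "k = 1")
  case True
  have "rad_sq d 1 r ^ 1 * r ^ (2 * 0) \<le> M\<^sup>2"
    using M by (intro rad_sq_1_power_le[OF d _ _ r]) (auto simp: mult.commute)
  then show ?thesis using True by simp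
next
  case False
  then have k2: "k \<ge> 2" using k by simp
  have "2 * real d + 4 \<le> (bindex d k - (real d / 2 - 1)) * (bindex d k + 2 + (real d / 2 - 1))"
  proof -
    have "2 * (real d + 2) \<le> real k * (real k + real d)" using k2 by (intro mult_mono) auto
    then show ?thesis by (simp add: bindex_def algebra_simps)
  qed
  then have "rad_sq d k r ^ 1 * r ^ (2 * 0) \<le> (rad_K d / sqrt (2 * bindex d k)) ^ 1 / R ^ ((d - 2) * 1 - 2 * 0)"
    using R by (intro rad_sq_power_le_sup[OF d k _ _ refl _ _ r]) auto
  also have "\<dots> \<le> rad_K d / sqrt (real d + 2) / R ^ (d - 2)"
    using bindex_ge[OF k2, of d] R rad_K_pos[OF d] by (simp, intro divide_right_mono divide_left_mono) auto
  finally show ?thesis using M(3) by simp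
qed

section \<open>Rational certificates and dimensions six to ten\<close>

lemma radial_0_add2:
  assumes "d \<ge> 2"
  shows "radial_0 (d + 2) = radial_0 d / real d"
proof -
  have "Gamma (real d / 2 + 1) = real d / 2 * Gamma (real d / 2)"
    using assms by (intro Gamma_plus1) (auto elim!: nonpos_Ints_cases)
  moreover have "2 powr (real d / 2) = 2 * 2 powr (real d / 2 - 1)" by (simp add: powr_diff)
  moreover have "real (d + 2) / 2 - 1 = real d / 2" "real (d + 2) / 2 = real d / 2 + 1" by (simp_all add: field_simps)
  ultimately show ?thesis unfolding radial_0_def by (simp only:) simp
qed

lemma rad_K_add2: "d \<ge> 2 \<Longrightarrow> rad_K (d + 2) = (real d)\<^sup>2 * rad_K d"
  unfolding rad_K_def radial_0_add2 amp_bound_def by (simp add: power_divide)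

lemma rad_K_2: "rad_K 2 = 16 / 25"
  by (simp add: rad_K_def amp_bound_def radial_0_def)

lemma rad_K_3: "rad_K 3 = 1"
proof -
  have "radial_0 3 = 1 / (sqrt 2 * (sqrt pi / 2))"
    by (simp add: radial_0_def Gamma_3_half powr_half_sqrt)
  then show ?thesis by (simp add: rad_K_def amp_bound_def power_mult_distrib power_divide)
qed

lemma rad_K_values:
  "rad_K 4 = 64 / 25" "rad_K 5 = 9" "rad_K 6 = 1024 / 25" "rad_K 7 = 225" "rad_K 8 = 36864 / 25"
  "rad_K 9 = 11025" "rad_K 10 = 2359296 / 25"
  using rad_K_2 rad_K_3 rad_K_add2[of 2] rad_K_add2[of 3] rad_K_add2[of 4] rad_K_add2[of 5]
    rad_K_add2[of 6] rad_K_add2[of 7] rad_K_add2[of 8] by simp_all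

lemma hyp_horner_numeral:
  "hyp_horner \<mu> x j (numeral n) = 1 - x / (j * (\<mu> + j)) * hyp_horner \<mu> x (j + 1) (pred_numeral n)"
  by (simp add: numeral_eq_Suc)

text \<open>Cell heights \<open>y = z ^ a\<close> make \<open>y powr q = z ^ N\<close> rational for \<open>q = N / a\<close>.\<close>

fun zcells_ok :: "nat \<Rightarrow> nat \<Rightarrow> nat \<Rightarrow> real \<Rightarrow> (real \<times> real) list \<Rightarrow> bool" where
  "zcells_ok d a j x [] \<longleftrightarrow> True"
| "zcells_ok d a j x ((b, z) # cs) \<longleftrightarrow> x < b \<and> b \<le> real d / 2 + 2 \<and> 4 * cell_mean d x b < (real d / 2 + 2)\<^sup>2
     \<and> 0 < z \<and> z ^ a \<le> hyp_horner (real d / 2 - 1) (cell_mean d x b) 1 j \<and> zcells_ok d a j b cs"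

lemma cell_mean_nonneg:
  assumes "0 \<le> a" "a < b" "d \<ge> 2"
  shows "cell_mean d a b \<ge> 0"
  unfolding cell_mean_def using assms
  using power_mono[of a b d] power_mono[of a b "d + 2"]
  by (intro divide_nonneg_nonneg mult_nonneg_nonneg) simp_all

lemma cells_ok_of_zcells_ok:
  assumes "d \<ge> 2" "even j" "j > 0" "0 \<le> x" "zcells_ok d a j x cs"
  shows "cells_ok d x (map (\<lambda>(b, z). (b, z ^ a)) cs)"
  using assms(4,5)
proof (induction cs arbitrary: x)
  case (Cons c cs)
  obtain b z where c: "c = (b, z)" by (cases c)
  have "hyp_horner (real d / 2 - 1) (cell_mean d x b) 1 j \<le> hyp (real d / 2 - 1) (cell_mean d x b)"
    unfolding hyp_partial_eq_horner[symmetric] using assms Cons.prems c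
    by (intro hyp_partial_le_hyp cell_mean_nonneg) auto
  moreover have "cells_ok d b (map (\<lambda>(b, z). (b, z ^ a)) cs)" using Cons.IH[of b] Cons.prems c by simp
  ultimately show ?case using Cons.prems c by simp
qed simp

lemma cell_sum_zcells:
  assumes "zcells_ok d a j x cs" "\<And>z. z > 0 \<Longrightarrow> f (z ^ a) = g z"
  shows "cell_sum d f x (map (\<lambda>(b, z). (b, z ^ a)) cs) = cell_sum d g x cs"
  using assms(1)
proof (induction cs arbitrary: x)
  case (Cons c cs)
  then show ?case using assms(2) by (cases c) simp
qed simp

lemma radial_integral_less_zcells:
  fixes n m a N j :: nat
  assumes d: "d \<ge> 2" and k: "k \<ge> 1" and a: "a \<ge> 1" "real a * q = real N" "a \<le> N"
    and q: "q > 2 * real d / (real d - 1)" "q \<le> p"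
    and M: "M > 0" and sup: "\<And>r. r > 0 \<Longrightarrow> rad_sq d k r \<le> M\<^sup>2"
    and int: "set_integrable lborel {0<..} (\<lambda>r. \<bar>radial d k r\<bar> powr q * r ^ (d - 1))"
      "(LBINT r:{0<..}. \<bar>radial d k r\<bar> powr q * r ^ (d - 1)) \<le> B * radial_0 d powr q"
    and cs: "even j" "j > 0" "zcells_ok d a j 0 cs" "B < cell_sum d (\<lambda>z. z ^ N) 0 cs"
      "0 \<le> cell_sum d (\<lambda>z. z ^ (N - a) * (z ^ a - M)) 0 cs"
  shows "(LBINT r:{0<..}. \<bar>radial d k r\<bar> powr p * r ^ (d - 1)) < (LBINT r:{0<..}. \<bar>radial d 0 r\<bar> powr p * r ^ (d - 1))"
proof (rule radial_integral_less[OF d q k M _ int cells_ok_of_zcells_ok[OF d cs(1,2) order_refl cs(3)]])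
  show "\<bar>radial d k r\<bar> \<le> M * radial_0 d" if "r > 0" for r
    using M sup[OF that] by (intro abs_radial_le_of_rad_sq d) auto
  have p1: "(z ^ a) powr q = z ^ N" if "z > 0" for z
    using that a by (simp add: powr_realpow[symmetric] powr_powr)
  have p2: "(z ^ a) powr (q - 1) = z ^ (N - a)" if "z > 0" for z
    using that a by (simp add: powr_realpow[symmetric] powr_powr right_diff_distrib of_nat_diff)
  have "cell_sum d (\<lambda>y. y powr q) 0 (map (\<lambda>(b, z). (b, z ^ a)) cs) = cell_sum d (\<lambda>z. z ^ N) 0 cs"
    by (rule cell_sum_zcells[OF cs(3)]) (rule p1)
  then show "B < cell_sum d (\<lambda>y. y powr q) 0 (map (\<lambda>(b, z). (b, z ^ a)) cs)" using cs(4) by simp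
  have "cell_sum d (\<lambda>y. y powr (q - 1) * (y - M)) 0 (map (\<lambda>(b, z). (b, z ^ a)) cs)
      = cell_sum d (\<lambda>z. z ^ (N - a) * (z ^ a - M)) 0 cs"
    by (rule cell_sum_zcells[OF cs(3)]) (simp add: p2)
  then show "0 \<le> cell_sum d (\<lambda>y. y powr (q - 1) * (y - M)) 0 (map (\<lambda>(b, z). (b, z ^ a)) cs)"
    using cs(5) by simp
qed

text \<open>The allowance \<open>2 * bindex d k / d\<close> equals 1 for \<open>k = 1\<close> and
  grows with \<open>k\<close>; it cancels the mass \<open>1 / (2 * bindex d k)\<close>, so the
  resulting bound does not depend on \<open>k\<close>.\<close>

lemma rad_integral_le_const:
  fixes n m :: nat
  assumes d: "d \<ge> 2" and k: "k \<ge> 1" and nm: "n \<ge> 1" "m \<ge> 1" and q: "q = 2 + 2 * real m / real n" and C: "C \<ge> 0"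
    and le: "\<And>r. r > 0 \<Longrightarrow> rad_sq d k r ^ m * r ^ (2 * n) \<le> (C * (2 * bindex d k / real d)) ^ n"
  shows "set_integrable lborel {0<..} (\<lambda>r. \<bar>radial d k r\<bar> powr q * r ^ (d - 1))"
    and "(LBINT r:{0<..}. \<bar>radial d k r\<bar> powr q * r ^ (d - 1)) \<le> (C * rad_K d / (real d * amp_bound d)) * radial_0 d powr q"
proof -
  have \<mu>: "bindex d k > 0" by (rule bindex_pos[OF d k])
  have C': "C * (2 * bindex d k / real d) \<ge> 0" using C \<mu> by simp
  note * = rad_integral_le[OF d k nm q C' le]
  then show "set_integrable lborel {0<..} (\<lambda>r. \<bar>radial d k r\<bar> powr q * r ^ (d - 1))" by simp
  have "C * (2 * bindex d k / real d) * rad_K d / (2 * bindex d k * amp_bound d) = C * rad_K d / (real d * amp_bound d)"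
    using \<mu> by simp
  then show "(LBINT r:{0<..}. \<bar>radial d k r\<bar> powr q * r ^ (d - 1)) \<le> (C * rad_K d / (real d * amp_bound d)) * radial_0 d powr q"
    using *(2) by simp
qed

lemma p0_less_zcells:
  fixes n m a N j :: nat
  assumes d: "d \<ge> 2" and nm: "n \<ge> 1" "m \<ge> 1" and q: "q = 2 + 2 * real m / real n" and C: "C \<ge> 0"
    and a: "a \<ge> 1" "real a * q = real N" "a \<le> N"
    and q': "q > 2 * real d / (real d - 1)" "q < Q" and M: "0 < M" "M < 1"
    and sup: "\<And>k r. k \<ge> 1 \<Longrightarrow> r > 0 \<Longrightarrow> rad_sq d k r \<le> M\<^sup>2"
    and le: "\<And>k r. k \<ge> 1 \<Longrightarrow> r > 0 \<Longrightarrow> rad_sq d k r ^ m * r ^ (2 * n) \<le> (C * (2 * bindex d k / real d)) ^ n"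
    and cs: "even j" "j > 0" "zcells_ok d a j 0 cs" "C * rad_K d / (real d * amp_bound d) < cell_sum d (\<lambda>z. z ^ N) 0 cs"
      "0 \<le> cell_sum d (\<lambda>z. z ^ (N - a) * (z ^ a - M)) 0 cs"
  shows "p0 d < ereal Q"
proof (rule p0_less[OF d _ q'(2)])
  show "q \<ge> 2 * real d / (real d - 1)" using q' by simp
  show "M * radial_0 d < radial_0 d" using M radial_0_pos[OF d] by simp
  show "\<bar>radial d k r\<bar> \<le> M * radial_0 d" if "k \<ge> 1" "r > 0" for k r
    using M sup[OF that] by (intro abs_radial_le_of_rad_sq d) auto
  show "(LBINT r:{0<..}. \<bar>radial d k r\<bar> powr p * r ^ (d - 1)) < (LBINT r:{0<..}. \<bar>radial d 0 r\<bar> powr p * r ^ (d - 1))"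
    if p: "q < p" and k: "k \<ge> 1" for p k
    using p by (intro radial_integral_less_zcells[OF d k a q'(1) _ M(1) sup[OF k] rad_integral_le_const[OF d k nm q C le[OF k]] cs]) auto
qed

lemma exp_1_ge: "exp 1 \<ge> (2718 / 1000 :: real)"
proof -
  have "- (exp 1 - 5837465777 / 2147483648) \<le> (inverse (2 ^ 32) :: real)" by (rule abs_le_D2[OF e_approx_32])
  then show ?thesis by simp
qed

text \<open>\<open>amp_bound\<close> occurs in a denominator of the upper bound and therefore needs
  a rational lower bound. The value \<open>2500 / 3927\<close> is \<open>2 / 3.1416\<close>.\<close>

definition amp_lower :: "nat \<Rightarrow> real" where
  "amp_lower d = (if even d then 16 / 25 else 2500 / 3927)"

lemma amp_lower: "amp_lower d \<le> amp_bound d" "amp_lower d > 0"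
proof -
  have "2500 / 3927 \<le> 2 / pi" using pi_approx(2) by (simp add: field_simps)
  then show "amp_lower d \<le> amp_bound d" "amp_lower d > 0" by (simp_all add: amp_lower_def amp_bound_def)
qed

lemma rad_sq_le_square_rational:
  assumes d: "d \<ge> 2" and s: "s1 > 0" "s1\<^sup>2 \<le> real d + 1" "s2 > 0" "s2\<^sup>2 \<le> real d + 2"
    and M1: "(real d + 2) / (2718 / 1000 * (real d)\<^sup>2) \<le> M\<^sup>2" "rad_K d / s1 / (real d / 2 + 1) ^ (d - 2) \<le> M\<^sup>2"
      "rad_K d / s2 / R ^ (d - 2) \<le> M\<^sup>2" and R: "R > 0" "R\<^sup>2 \<le> 2 * real d + 4"
    and k: "k \<ge> 1" and r: "r > 0"
  shows "rad_sq d k r \<le> M\<^sup>2"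
proof (rule rad_sq_le_square[OF d k r _ _ _ R])
  have s': "s1 \<le> sqrt (real d + 1)" "s2 \<le> sqrt (real d + 2)" using s by (auto intro: real_le_rsqrt)
  have k1: "rad_K d / sqrt (real d + 1) \<le> rad_K d / s1" "rad_K d / sqrt (real d + 2) \<le> rad_K d / s2"
    using rad_K_pos[OF d] s s' by (auto intro!: divide_left_mono mult_pos_pos)
  have "(real d + 2) / (exp 1 * (real d)\<^sup>2) \<le> (real d + 2) / (2718 / 1000 * (real d)\<^sup>2)"
    using exp_1_ge d by (intro divide_left_mono mult_right_mono mult_pos_pos) auto
  then show "(real d + 2) / (exp 1 * (real d)\<^sup>2) \<le> M\<^sup>2" using M1(1) by linarith
  have "rad_K d / sqrt (real d + 1) / (real d / 2 + 1) ^ (d - 2) \<le> rad_K d / s1 / (real d / 2 + 1) ^ (d - 2)"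
    by (intro divide_right_mono k1) auto
  then show "rad_K d / sqrt (real d + 1) / (real d / 2 + 1) ^ (d - 2) \<le> M\<^sup>2" using M1(2) by linarith
  have "rad_K d / sqrt (real d + 2) / R ^ (d - 2) \<le> rad_K d / s2 / R ^ (d - 2)"
    using R by (intro divide_right_mono k1) auto
  then show "rad_K d / sqrt (real d + 2) / R ^ (d - 2) \<le> M\<^sup>2" using M1(3) by linarith
qed

text \<open>Two conditions for \<open>k = 1\<close> (below and above \<open>r = d / 2 + 1\<close>), one for \<open>k \<ge> 2\<close>.\<close>

lemma p0_less_high:
  fixes n m a N j :: nat
  assumes d: "d \<ge> 2" and nm: "n \<ge> 1" "m \<ge> 1" "2 * n \<le> (d - 2) * m" and q: "q = 2 + 2 * real m / real n" and C: "C \<ge> 0"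
    and a: "a \<ge> 1" "real a * q = real N" "a \<le> N"
    and q': "q > 2 * real d / (real d - 1)" "q < Q" and M: "0 < M" "M < 1"
    and s: "s1 > 0" "s1\<^sup>2 \<le> real d + 1" "s2 > 0" "s2\<^sup>2 \<le> real d + 2"
    and M1: "(real d + 2) / (2718 / 1000 * (real d)\<^sup>2) \<le> M\<^sup>2" "rad_K d / s1 / (real d / 2 + 1) ^ (d - 2) \<le> M\<^sup>2"
      "rad_K d / s2 / R' ^ (d - 2) \<le> M\<^sup>2" and R': "R' > 0" "R'\<^sup>2 \<le> 2 * real d + 4"
    and E: "((real (n + m) * (real d + 2)) / (real m * (2718 / 1000))) ^ (n + m) / real d ^ (2 * m) \<le> C ^ n"
    and V: "(rad_K d / s1) ^ m / (real d / 2 + 1) ^ ((d - 2) * m - 2 * n) \<le> C ^ n"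
    and V2: "(rad_K d / s2) ^ m / R ^ ((d - 2) * m - 2 * n) \<le> C ^ n"
    and R: "R > 0" "R\<^sup>2 \<le> (2 + real n / real m) * (real d + 2 - real n / real m)"
    and cs: "even j" "j > 0" "zcells_ok d a j 0 cs" "C * rad_K d / (real d * amp_lower d) < cell_sum d (\<lambda>z. z ^ N) 0 cs"
      "0 \<le> cell_sum d (\<lambda>z. z ^ (N - a) * (z ^ a - M)) 0 cs"
  shows "p0 d < ereal Q"
proof -
  have K: "rad_K d > 0" by (rule rad_K_pos[OF d])
  have s': "s1 \<le> sqrt (real d + 1)" "s2 \<le> sqrt (real d + 2)" using s by (auto intro: real_le_rsqrt)
  have k1: "rad_K d / sqrt (real d + 1) \<le> rad_K d / s1" "rad_K d / sqrt (real d + 2) \<le> rad_K d / s2"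
    using K s s' by (auto intro!: divide_left_mono mult_pos_pos)
  have "C * rad_K d / (real d * amp_bound d) \<le> C * rad_K d / (real d * amp_lower d)"
    using amp_lower[of d] C K d by (intro divide_left_mono mult_left_mono mult_pos_pos) auto
  then have cs4: "C * rad_K d / (real d * amp_bound d) < cell_sum d (\<lambda>z. z ^ N) 0 cs" using cs(4) by simp
  have "((real (n + m) * (real d + 2)) / (real m * exp 1)) ^ (n + m) / real d ^ (2 * m)
      \<le> ((real (n + m) * (real d + 2)) / (real m * (2718 / 1000))) ^ (n + m) / real d ^ (2 * m)"
    using exp_1_ge nm by (intro divide_right_mono power_mono divide_left_mono mult_left_mono mult_pos_pos) auto
  then have E': "((real (n + m) * (real d + 2)) / (real m * exp 1)) ^ (n + m) / real d ^ (2 * m) \<le> C ^ n" using E by linarith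
  have "(rad_K d / sqrt (real d + 1)) ^ m / (real d / 2 + 1) ^ ((d - 2) * m - 2 * n)
      \<le> (rad_K d / s1) ^ m / (real d / 2 + 1) ^ ((d - 2) * m - 2 * n)"
    using K by (intro divide_right_mono power_mono k1) auto
  then have V': "(rad_K d / sqrt (real d + 1)) ^ m / (real d / 2 + 1) ^ ((d - 2) * m - 2 * n) \<le> C ^ n" using V by linarith
  have "(rad_K d / sqrt (real d + 2)) ^ m / R ^ ((d - 2) * m - 2 * n) \<le> (rad_K d / s2) ^ m / R ^ ((d - 2) * m - 2 * n)"
    using K R by (intro divide_right_mono power_mono k1) auto
  then have V2': "(rad_K d / sqrt (real d + 2)) ^ m / R ^ ((d - 2) * m - 2 * n) \<le> C ^ n" using V2 by linarith
  show ?thesis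
  proof (rule p0_less_zcells[OF d nm(1,2) q C a q' M _ _ cs(1,2,3) cs4 cs(5)])
  fix k r assume k: "k \<ge> (1 :: nat)" and r: "r > (0 :: real)"
  show "rad_sq d k r \<le> M\<^sup>2" by (rule rad_sq_le_square_rational[OF d s M1 R' k r])
  have "rad_sq d k r ^ m * r ^ (2 * n) \<le> C ^ n"
  proof (cases "k = 1")
    case True
    then show ?thesis using rad_sq_1_power_le[OF d nm(2,3) r E' V'] by simp
  next
    case False
    then have k2: "k \<ge> 2" using k by simp
    define \<beta> where "\<beta> = real d / 2 - 1 - real n / real m"
    \<comment> \<open>The right-hand side is \<open>(k + n / m) * (d + k - n / m)\<close>; among
      \<open>k \<ge> 2\<close> it is least at \<open>k = 2\<close>, which is the premise on
      \<open>R\<close>.\<close>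
    have "R\<^sup>2 \<le> (bindex d k - \<beta>) * (bindex d k + 2 + \<beta>)"
    proof -
      have "real (2 * n) \<le> real ((d - 2) * m)" using nm by (simp only: of_nat_le_iff)
      then have "real n / real m \<le> real d / 2 - 1" using nm d by (simp add: of_nat_diff field_simps)
      then have "(2 + real n / real m) * (real d + 2 - real n / real m) \<le> (real k + real n / real m) * (real d + real k - real n / real m)"
        using k2 d by (intro mult_mono) auto
      then show ?thesis using R(2) by (simp add: bindex_def \<beta>_def algebra_simps)
    qed
    then have "rad_sq d k r ^ m * r ^ (2 * n) \<le> (rad_K d / sqrt (2 * bindex d k)) ^ m / R ^ ((d - 2) * m - 2 * n)"
      by (rule rad_sq_power_le_sup[OF d k nm(2,3) \<beta>_def R(1) _ r])
    also have "\<dots> \<le> (rad_K d / sqrt (real d + 2)) ^ m / R ^ ((d - 2) * m - 2 * n)"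
      using bindex_ge[OF k2, of d] R rad_K_pos[OF d]
      by (intro divide_right_mono power_mono divide_left_mono) auto
    finally show ?thesis using V2' by simp
  qed
  also have "C ^ n \<le> (C * (2 * bindex d k / real d)) ^ n"
  proof (rule power_mono)
    have "1 \<le> 2 * bindex d k / real d" using k d by (simp add: bindex_def field_simps)
    then show "C \<le> C * (2 * bindex d k / real d)" using mult_left_mono[OF _ C] by fastforce
  qed (rule C)
  finally show "rad_sq d k r ^ m * r ^ (2 * n) \<le> (C * (2 * bindex d k / real d)) ^ n" .
  qed
qed

text \<open>Here and in the next four lemmas the test exponent \<open>q\<close> lies strictly below
  the claimed bound, \<open>C\<close> is rounded up from the \<open>n\<close>-th root of the
  Gaussian condition \<open>E\<close> for \<open>k = 1\<close>, the binding one of the three, and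
  \<open>s1\<close>, \<open>s2\<close>, \<open>R\<close>, \<open>R'\<close> are rational lower
  bounds for the square roots that they replace. An even \<open>j\<close> makes the Horner sum a
  lower bound. For \<open>q = 7 / 2\<close> the heights are squares, so that
  \<open>y powr q = z^7\<close>.\<close>

lemma p0_6: "p0 6 < ereal (179 / 50)"
  by (rule p0_less_high[where n = 4 and m = 3 and q = "7 / 2" and a = 2 and N = 7 and j = 6 and C = "1983 / 1000"
        and M = "29 / 100" and ?s1.0 = "66 / 25" and ?s2.0 = "141 / 50" and R = "471 / 100" and R' = "4"
        and cs = "[(7 / 10, 123 / 125), (7 / 5, 469 / 500), (21 / 10, 859 / 1000), (14 / 5, 187 / 250), (7 / 2, 61 / 100), (21 / 5, 449 / 1000)]"])
     (simp_all add: rad_K_values amp_lower_def cell_mean_def hyp_horner_numeral power_divide)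

lemma p0_7: "p0 7 < ereal (37 / 10)"
  by (rule p0_less_high[where n = 4 and m = 3 and q = "7 / 2" and a = 2 and N = 7 and j = 8 and C = "97 / 50"
        and M = "27 / 100" and ?s1.0 = "141 / 50" and ?s2.0 = "3" and R = "101 / 20" and R' = "106 / 25"
        and cs = "[(3 / 5, 99 / 100), (6 / 5, 24 / 25), (9 / 5, 909 / 1000), (12 / 5, 837 / 1000), (3, 149 / 200), (18 / 5, 319 / 500), (21 / 5, 519 / 1000), (24 / 5, 39 / 100)]"])
     (simp_all add: rad_K_values amp_lower_def cell_mean_def hyp_horner_numeral power_divide)

lemma p0_8: "p0 8 < ereal (193 / 50)"
  by (rule p0_less_high[where n = 4 and m = 3 and q = "7 / 2" and a = 2 and N = 7 and j = 8 and C = "191 / 100"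
        and M = "1 / 4" and ?s1.0 = "3" and ?s2.0 = "79 / 25" and R = "537 / 100" and R' = "447 / 100"
        and cs = "[(13 / 20, 989 / 1000), (13 / 10, 479 / 500), (39 / 20, 181 / 200), (13 / 5, 831 / 1000), (13 / 4, 739 / 1000), (39 / 10, 79 / 125), (91 / 20, 257 / 500), (26 / 5, 97 / 250)]"])
     (simp_all add: rad_K_values amp_lower_def cell_mean_def hyp_horner_numeral power_divide)

lemma p0_9: "p0 9 < ereal (203 / 50)"
  by (rule p0_less_high[where n = 1 and m = 1 and q = "4" and a = 1 and N = 4 and j = 8 and C = "41 / 50"
        and M = "13 / 50" and ?s1.0 = "79 / 25" and ?s2.0 = "331 / 100" and R = "547 / 100" and R' = "469 / 100"
        and cs = "[(9 / 10, 963 / 1000), (9 / 5, 861 / 1000), (27 / 10, 353 / 500), (18 / 5, 261 / 500), (9 / 2, 339 / 1000), (27 / 5, 183 / 1000)]"])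
     (simp_all add: rad_K_values amp_lower_def cell_mean_def hyp_horner_numeral power_divide)

lemma p0_10: "p0 10 < ereal (223 / 50)"
  by (rule p0_less_high[where n = 1 and m = 1 and q = "4" and a = 1 and N = 4 and j = 8 and C = "79 / 100"
        and M = "29 / 100" and ?s1.0 = "331 / 100" and ?s2.0 = "173 / 50" and R = "287 / 50" and R' = "489 / 100"
        and cs = "[(1, 959 / 1000), (2, 211 / 250), (3, 27 / 40), (4, 241 / 500), (5, 297 / 1000), (6, 37 / 250)]"])
     (simp_all add: rad_K_values amp_lower_def cell_mean_def hyp_horner_numeral power_divide)

section \<open>Dimensions four and five\<close>

text \<open>For \<open>k = 1\<close> the order is \<open>d / 2\<close>, and
  \<open>c = (d^2 - 1) / 4\<close> takes the values 2, 15/4 and 6 for \<open>d = 3, 4, 5\<close>, so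
  the refined envelope applies in just these dimensions. Its product with a nonpositive power of
  \<open>r\<close> decreases beyond \<open>R\<close>; before \<open>R\<close> the weighted function
  increases.\<close>

lemma rad_sq_1_power_le_nicholson:
  fixes n m :: nat
  assumes d: "d \<ge> 2" and m: "m \<ge> 1" and nm: "2 * n \<le> (d - 1) * m" "2 * n \<le> d * m"
    and c: "c = ((real d)\<^sup>2 - 1) / 4" "2 \<le> c" "c \<le> 6"
    and R: "R > 0" "R\<^sup>2 \<le> (1 + real n / real m) * (real d + 1 - real n / real m)" and r: "r > 0"
  shows "rad_sq d 1 r ^ m * r ^ (2 * n)
    \<le> (rad_K d * (1 + c / (2 * R\<^sup>2) + 3 * c * (c - 2) / (8 * R ^ 4))) ^ m / R ^ ((d - 1) * m - 2 * n)"
proof -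
  define N where "N = (\<lambda>s :: real. 1 + c / (2 * s\<^sup>2) + 3 * c * (c - 2) / (8 * s ^ 4))"
  have \<mu>: "bindex d 1 = real d / 2" by (simp add: bindex_def)
  have K: "rad_K d > 0" by (rule rad_K_pos[OF d])
  have far: "rad_sq d 1 s ^ m * s ^ (2 * n) \<le> (rad_K d * N R) ^ m / R ^ ((d - 1) * m - 2 * n)"
    if s: "s \<ge> R" for s
  proof -
    have s0: "s > 0" using s R by simp
    have N: "N s \<le> N R" "N s \<ge> 0"
      unfolding N_def using s s0 R c
      by (auto intro!: add_mono divide_left_mono mult_left_mono power_mono add_nonneg_nonneg mult_nonneg_nonneg)
    have "c = (bindex d 1)\<^sup>2 - 1 / 4" unfolding \<mu> c(1) by (simp add: power_divide)
    from rad_sq_le_nicholson[OF d this c(2,3) s0]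
    have "rad_sq d 1 s ^ m \<le> (rad_K d * N s / s ^ (d - 1)) ^ m"
      unfolding N_def by (intro power_mono) simp_all
    then have "rad_sq d 1 s ^ m * s ^ (2 * n) \<le> (rad_K d * N s / s ^ (d - 1)) ^ m * s ^ (2 * n)"
      using s0 by (intro mult_right_mono) auto
    also have "\<dots> = (rad_K d * N s) ^ m * (s ^ (2 * n) / s ^ ((d - 1) * m))"
      by (simp add: power_divide power_mult)
    also have "s ^ (2 * n) / s ^ ((d - 1) * m) = 1 / s ^ ((d - 1) * m - 2 * n)"
      using s0 nm by (simp add: power_diff)
    also have "(rad_K d * N s) ^ m * (1 / s ^ ((d - 1) * m - 2 * n))
      \<le> (rad_K d * N R) ^ m * (1 / R ^ ((d - 1) * m - 2 * n))"
      using s R K N by (intro mult_mono power_mono divide_left_mono mult_left_mono) auto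
    finally show ?thesis by simp
  qed
  have "rad_sq d 1 r ^ m * r ^ (2 * n) \<le> (rad_K d * N R) ^ m / R ^ ((d - 1) * m - 2 * n)"
  proof (cases "r \<le> R")
    case True
    define \<beta> where "\<beta> = real d / 2 - 1 - real n / real m"
    have "real (2 * n) \<le> real (d * m)" using nm by (simp only: of_nat_le_iff)
    then have "- 1 \<le> \<beta>" unfolding \<beta>_def using m by (simp add: field_simps)
    moreover have "real n / real m \<ge> 0" by simp
    then have "\<beta> \<le> bindex d 1" unfolding \<beta>_def \<mu> by linarith
    moreover have "bindex d 1 - \<beta> = 1 + real n / real m" "bindex d 1 + 2 + \<beta> = real d + 1 - real n / real m"
      unfolding \<mu> \<beta>_def by simp_all
    then have "R\<^sup>2 \<le> (bindex d 1 - \<beta>) * (bindex d 1 + 2 + \<beta>)" using R(2) by metis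
    ultimately show ?thesis using rad_sq_power_mono[OF d m \<beta>_def _ _ r True, of 1] far[of R] by linarith
  qed (use far in simp)
  then show ?thesis by (simp add: N_def)
qed

text \<open>The intermediate weights \<open>(d - 2) * m \<le> 2 * n \<le> (d - 1) * m\<close> leave
  \<open>s^e / t^m\<close> with \<open>t = sqrt (s^2 - \<mu>^2)\<close>. Written as
  \<open>(s / t)^e / t^f\<close> with \<open>e + f = m\<close>, both factors decrease in
  \<open>s\<close>, so the worst point is \<open>R^2 = \<mu> * (\<mu> + 2)\<close>, where
  \<open>t^2 = 2 * \<mu>\<close>. The weights also force \<open>- 1 \<le> \<beta> \<le> 0\<close>,
  so the monotone range includes \<open>R\<close>.\<close>

lemma rad_sq_power_le_sqrt:
  fixes n m :: nat
  assumes d: "d \<ge> 2" and k: "k \<ge> 1" and m: "m \<ge> 1" and nm: "(d - 2) * m \<le> 2 * n" "2 * n \<le> (d - 1) * m"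
    and r: "r > 0"
  shows "rad_sq d k r ^ m * r ^ (2 * n)
    \<le> rad_K d ^ m * sqrt ((bindex d k + 2) / 2) ^ (2 * n - (d - 2) * m) / sqrt (2 * bindex d k) ^ ((d - 1) * m - 2 * n)"
proof -
  let ?\<mu> = "bindex d k"
  have \<mu>: "?\<mu> > 0" by (rule bindex_pos[OF d k])
  have K: "rad_K d > 0" by (rule rad_K_pos[OF d])
  define R where "R = sqrt (?\<mu> * (?\<mu> + 2))"
  have R: "R > 0" "R\<^sup>2 = ?\<mu> * (?\<mu> + 2)" using \<mu> by (auto simp: R_def)
  obtain e where e: "2 * n = (d - 2) * m + e" using nm(1) le_Suc_ex by blast
  have "(d - 1) * m = (d - 2) * m + m"
  proof -
    have "d - 1 = Suc (d - 2)" using d by simp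
    then show ?thesis by (simp only: mult_Suc)
  qed
  then obtain f where f: "m = e + f" "(d - 1) * m - 2 * n = f" "2 * n - (d - 2) * m = e"
    using e nm(2) le_Suc_ex[of e m] by auto
  have far: "rad_sq d k s ^ m * s ^ (2 * n) \<le> rad_K d ^ m * sqrt ((?\<mu> + 2) / 2) ^ e / sqrt (2 * ?\<mu>) ^ f"
    if s: "s \<ge> R" for s
  proof -
    have s0: "s > 0" using s R by simp
    define t where "t = sqrt (s\<^sup>2 - ?\<mu>\<^sup>2)"
    have s2: "s\<^sup>2 \<ge> ?\<mu> * (?\<mu> + 2)" using power_mono[OF s, of 2] R by simp
    then have t2: "s\<^sup>2 - ?\<mu>\<^sup>2 \<ge> 2 * ?\<mu>" by (simp add: power2_eq_square algebra_simps)
    then have t: "t \<ge> sqrt (2 * ?\<mu>)" by (simp add: t_def)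
    have t0: "t > 0" using t2 \<mu> by (simp add: t_def)
    have "s > ?\<mu>" using t2 \<mu> by (intro power2_less_imp_less[of ?\<mu> s]) (use s0 in auto)
    from rad_sq_le_sqrt[OF d this] have "rad_sq d k s \<le> rad_K d / (t * s ^ (d - 2))" by (simp add: t_def)
    then have "rad_sq d k s ^ m * s ^ (2 * n) \<le> (rad_K d / (t * s ^ (d - 2))) ^ m * s ^ (2 * n)"
      using s0 by (intro mult_right_mono power_mono) auto
    also have "\<dots> = rad_K d ^ m * (s ^ e / t ^ m)"
      using s0 by (simp add: e power_divide power_mult_distrib power_mult power_add)
    also have "s ^ e / t ^ m = (s / t) ^ e * (1 / t ^ f)"
      by (simp add: f(1) power_add power_divide)
    also have "rad_K d ^ m * ((s / t) ^ e * (1 / t ^ f)) \<le> rad_K d ^ m * (sqrt ((?\<mu> + 2) / 2) ^ e * (1 / sqrt (2 * ?\<mu>) ^ f))"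
    proof (intro mult_left_mono mult_mono power_mono divide_left_mono)
      have "s\<^sup>2 / (s\<^sup>2 - ?\<mu>\<^sup>2) \<le> (?\<mu> + 2) / 2"
      proof -
        have "s\<^sup>2 * 2 \<le> (?\<mu> + 2) * (s\<^sup>2 - ?\<mu>\<^sup>2)"
          using mult_left_mono[OF s2, of ?\<mu>] \<mu> by (simp add: power2_eq_square algebra_simps)
        then show ?thesis using t2 \<mu> by (simp add: field_simps)
      qed
      then have "sqrt (s\<^sup>2 / (s\<^sup>2 - ?\<mu>\<^sup>2)) \<le> sqrt ((?\<mu> + 2) / 2)" by (rule real_sqrt_le_mono)
      then show "s / t \<le> sqrt ((?\<mu> + 2) / 2)" using s0 by (simp add: t_def real_sqrt_divide)
    qed (use s0 t0 t \<mu> K in auto)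
    finally show ?thesis by simp
  qed
  have "rad_sq d k r ^ m * r ^ (2 * n) \<le> rad_K d ^ m * sqrt ((?\<mu> + 2) / 2) ^ e / sqrt (2 * ?\<mu>) ^ f"
  proof (cases "r \<le> R")
    case True
    define \<beta> where "\<beta> = real d / 2 - 1 - real n / real m"
    have "real (2 * n) \<le> real ((d - 1) * m)" using nm by (simp only: of_nat_le_iff)
    then have b1: "- 1 \<le> \<beta>" unfolding \<beta>_def using m d by (simp add: of_nat_diff field_simps)
    have "real ((d - 2) * m) \<le> real (2 * n)" using nm by (simp only: of_nat_le_iff)
    then have b2: "\<beta> \<le> 0" unfolding \<beta>_def using m d by (simp add: of_nat_diff field_simps)
    have "0 \<le> - \<beta> * (2 + \<beta>)" using b1 b2 by (intro mult_nonneg_nonneg) auto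
    then have "R\<^sup>2 \<le> (?\<mu> - \<beta>) * (?\<mu> + 2 + \<beta>)" unfolding R(2) by (simp add: algebra_simps)
    moreover have "\<beta> \<le> ?\<mu>" using b2 \<mu> by simp
    ultimately show ?thesis using rad_sq_power_mono[OF d m \<beta>_def b1 _ r True, of k] far[of R] by linarith
  qed (use far in simp)
  then show ?thesis unfolding f(2,3) .
qed

text \<open>The exponent \<open>10 / 3 = 2 + 2 * 2 / 3\<close> makes cubes the natural heights.
  \<open>C\<close> is rounded up from the cube root of the Nicholson bound for \<open>k = 1\<close>;
  larger \<open>k\<close> leave ample room.\<close>

lemma p0_5: "p0 5 < ereal (7 / 2)"
proof (rule p0_less_zcells[where n = 3 and m = 2 and q = "10 / 3" and a = 3 and N = 10 and j = 6 and C = "2345 / 1000"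
        and M = "33 / 100" and cs = "[(39 / 100, 249 / 250), (39 / 50, 197 / 200), (117 / 100, 241 / 250), (39 / 25, 467 / 500),
          (39 / 20, 447 / 500), (117 / 50, 211 / 250), (273 / 100, 783 / 1000), (78 / 25, 89 / 125), (351 / 100, 629 / 1000), (39 / 10, 53 / 100)]"])
  show "2345 / 1000 * rad_K 5 / (real 5 * amp_bound 5) < cell_sum 5 (\<lambda>z. z ^ 10) 0 [(39 / 100, 249 / 250), (39 / 50, 197 / 200), (117 / 100, 241 / 250), (39 / 25, 467 / 500),
          (39 / 20, 447 / 500), (117 / 50, 211 / 250), (273 / 100, 783 / 1000), (78 / 25, 89 / 125), (351 / 100, 629 / 1000), (39 / 10, 53 / 100)]"
    (is "_ < ?S")
  proof -
    have "2345 / 1000 * rad_K 5 / (real 5 * amp_bound 5) \<le> 2345 / 1000 * rad_K 5 / (real 5 * amp_lower 5)"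
      using amp_lower[of 5] by (intro divide_left_mono mult_left_mono mult_pos_pos) (auto simp: rad_K_values)
    also have "\<dots> < ?S" by (simp add: rad_K_values amp_lower_def power_divide)
    finally show ?thesis .
  qed
  fix k r assume k: "k \<ge> (1 :: nat)" and r: "r > (0 :: real)"
  show "rad_sq 5 k r \<le> (33 / 100)\<^sup>2"
    by (rule rad_sq_le_square_rational[where ?s1.0 = "12 / 5" and ?s2.0 = "13 / 5" and R = "37 / 10"])
       (use k r in \<open>simp_all add: rad_K_values power_divide\<close>)
  show "rad_sq 5 k r ^ 2 * r ^ (2 * 3) \<le> (2345 / 1000 * (2 * bindex 5 k / real 5)) ^ 3"
  proof (cases "k = 1")
    case True
    \<comment> \<open>The radius is just below \<open>sqrt (5 / 2 * (9 / 2))\<close>, the end of the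
      monotone range for \<open>n / m = 3 / 2\<close>.\<close>
    have "rad_sq 5 1 r ^ 2 * r ^ (2 * 3) \<le> (rad_K 5 * (1 + 6 / (2 * (3354 / 1000)\<^sup>2) + 3 * 6 * (6 - 2) / (8 * (3354 / 1000) ^ 4))) ^ 2 / (3354 / 1000) ^ ((5 - 1) * 2 - 2 * 3)"
      by (rule rad_sq_1_power_le_nicholson) (use r in \<open>simp_all add: power_divide\<close>)
    also have "\<dots> \<le> (2345 / 1000) ^ 3" by (simp add: rad_K_values power_divide)
    finally show ?thesis using True by (simp add: bindex_def)
  next
    case False
    then have k2: "k \<ge> 2" using k by simp
    have \<mu>: "bindex 5 k \<ge> 7 / 2" using k2 by (simp add: bindex_def)
    \<comment> \<open>Since \<open>(d - 2) * m = 2 * n\<close>, both \<open>\<beta>\<close> and the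
      exponent of \<open>R\<close> are zero; any radius in the monotone range serves, for instance
      1.\<close>
    have "rad_sq 5 k r ^ 2 * r ^ (2 * 3) \<le> (rad_K 5 / sqrt (2 * bindex 5 k)) ^ 2 / 1 ^ ((5 - 2) * 2 - 2 * 3)"
    proof (rule rad_sq_power_le_sup[OF _ k, where \<beta> = 0])
      show "1\<^sup>2 \<le> (bindex 5 k - 0) * (bindex 5 k + 2 + 0)" using mult_mono[of 1 "bindex 5 k" 1 "bindex 5 k + 2"] \<mu> by simp
    qed (use r in simp_all)
    also have "\<dots> = 81 / (2 * bindex 5 k)" using \<mu> by (simp add: power_divide rad_K_values)
    also have "\<dots> \<le> 81 / 7" using \<mu> by (intro divide_left_mono) auto
    also have "\<dots> \<le> (2345 / 1000 * 1) ^ 3" by (simp add: power_divide)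
    also have "\<dots> \<le> (2345 / 1000 * (2 * bindex 5 k / real 5)) ^ 3" using \<mu> by (intro power_mono mult_left_mono) auto
    finally show ?thesis .
  qed
qed (simp_all add: cell_mean_def hyp_horner_numeral power_divide)

text \<open>Here \<open>q = 24 / 7\<close> lies between \<open>p_st 4 = 10 / 3\<close> and the
  claimed bound. As \<open>2 * n = 14\<close> exceeds \<open>(d - 2) * m = 10\<close>, the supremum
  bound of \<open>J^2\<close> is too weak at infinity, and \<open>k \<ge> 2\<close> is treated by
  the square root envelope.\<close>

lemma p0_4: "p0 4 < ereal (87 / 25)"
proof (rule p0_less_zcells[where n = 7 and m = 5 and q = "24 / 7" and a = 7 and N = 24 and j = 8 and C = "1968 / 1000"
        and M = "38 / 100" and cs = "[(7/25,999/1000),(14/25,249/250),(21/25,9903/10000),(28/25,4909/5000),(7/5,4851/5000),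
          (42/25,4777/5000),(49/25,9371/10000),(56/25,183/200),(63/25,1777/2000),(14/5,2141/2500),(77/25,817/1000),(84/25,7663/10000)]"])
  fix k r assume k: "k \<ge> (1 :: nat)" and r: "r > (0 :: real)"
  show "rad_sq 4 k r \<le> (38 / 100)\<^sup>2"
    by (rule rad_sq_le_square_rational[where ?s1.0 = "2" and ?s2.0 = "12 / 5" and R = "33 / 10"])
       (use k r in \<open>simp_all add: rad_K_values power_divide\<close>)
  show "rad_sq 4 k r ^ 5 * r ^ (2 * 7) \<le> (1968 / 1000 * (2 * bindex 4 k / real 4)) ^ 7"
  proof (cases "k = 1")
    case True
    \<comment> \<open>The radius is just below \<open>sqrt (12 / 5 * (18 / 5))\<close>, the end of
      the monotone range for \<open>n / m = 7 / 5\<close>; \<open>C\<close> is rounded up from the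
      seventh root of this bound.\<close>
    have "rad_sq 4 1 r ^ 5 * r ^ (2 * 7) \<le> (rad_K 4 * (1 + (15 / 4) / (2 * (2939 / 1000)\<^sup>2) + 3 * (15 / 4) * (15 / 4 - 2) / (8 * (2939 / 1000) ^ 4))) ^ 5 / (2939 / 1000) ^ ((4 - 1) * 5 - 2 * 7)"
      by (rule rad_sq_1_power_le_nicholson) (use r in \<open>simp_all add: power_divide\<close>)
    also have "\<dots> \<le> (1968 / 1000) ^ 7" by (simp add: rad_K_values power_divide)
    finally show ?thesis using True by (simp add: bindex_def)
  next
    case False
    then have k2: "k \<ge> 2" using k by simp
    have \<mu>: "bindex 4 k \<ge> 3" using k2 by (simp add: bindex_def)
    have "rad_sq 4 k r ^ 5 * r ^ (2 * 7) \<le> rad_K 4 ^ 5 * sqrt ((bindex 4 k + 2) / 2) ^ (2 * 7 - (4 - 2) * 5) / sqrt (2 * bindex 4 k) ^ ((4 - 1) * 5 - 2 * 7)"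
      by (rule rad_sq_power_le_sqrt) (use k r in simp_all)
    also have "\<dots> = rad_K 4 ^ 5 * ((bindex 4 k + 2) / 2)\<^sup>2 / sqrt (2 * bindex 4 k)"
      using \<mu> power_mult[of "sqrt ((bindex 4 k + 2) / 2)" 2 2] by simp
    also have "\<dots> \<le> rad_K 4 ^ 5 * (bindex 4 k)\<^sup>2 / 1"
    proof (intro frac_le mult_left_mono power_mono)
      have "sqrt (2 * bindex 4 k) \<ge> sqrt 1" using \<mu> by (intro real_sqrt_le_mono) simp
      then show "1 \<le> sqrt (2 * bindex 4 k)" by simp
    qed (use \<mu> in \<open>auto simp: rad_K_values\<close>)
    \<comment> \<open>The target equals \<open>(246 / 250 * \<mu>)^7\<close>. Splitting
      \<open>\<mu>^7 = \<mu>^5 * \<mu>^2\<close> reduces the claim to a numerical inequality at the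
      least order \<open>\<mu> = 3\<close>.\<close>
    also have "\<dots> \<le> (246 / 250) ^ 7 * 3 ^ 5 * (bindex 4 k)\<^sup>2"
      using \<mu> by (simp add: rad_K_values power_divide)
    also have "\<dots> \<le> (246 / 250) ^ 7 * bindex 4 k ^ 5 * (bindex 4 k)\<^sup>2"
      using \<mu> by (intro mult_right_mono mult_left_mono power_mono) auto
    also have "\<dots> = (1968 / 1000 * (2 * bindex 4 k / real 4)) ^ 7"
      by (simp add: power_mult_distrib power_divide flip: power_add)
    finally show ?thesis .
  qed
qed (simp_all add: rad_K_values amp_bound_def cell_mean_def hyp_horner_numeral power_divide)

section \<open>Dimensions two and three\<close>

lemma continuous_on_bessel_J:
  assumes "\<mu> \<ge> 0" "A \<subseteq> {0<..}"
  shows "continuous_on A (bessel_J \<mu>)" "continuous_on A (bessel_D \<mu>)"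
proof -
  have "isCont (bessel_J \<mu>) r" "isCont (bessel_D \<mu>) r" if "r \<in> A" for r
    using assms(2) that DERIV_isCont[OF has_real_derivative_bessel_J_theta[OF assms(1), of r]]
      DERIV_isCont[OF has_real_derivative_bessel_D[OF assms(1), of r]] by (simp_all add: subset_eq)
  then show "continuous_on A (bessel_J \<mu>)" "continuous_on A (bessel_D \<mu>)"
    by (simp_all add: continuous_at_imp_continuous_on)
qed

lemma bessel_J_mono_of_D:
  assumes \<mu>: "\<mu> \<ge> 0" and s: "0 < s" "s \<le> r" and D: "\<And>t. s \<le> t \<Longrightarrow> t < r \<Longrightarrow> 0 \<le> bessel_D \<mu> t"
  shows "bessel_J \<mu> s \<le> bessel_J \<mu> r"
proof (rule DERIV_nonneg_imp_increasing_open[OF s(2)])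
  show "\<exists>y. (bessel_J \<mu> has_real_derivative y) (at x) \<and> 0 \<le> y" if "s < x" "x < r" for x
    using has_real_derivative_bessel_J_theta[OF \<mu>, of x] D[of x] s that
    by (intro exI[of _ "bessel_D \<mu> x / x"]) auto
  show "continuous_on {s..r} (bessel_J \<mu>)" using \<mu> s by (intro continuous_on_bessel_J) auto
qed

text \<open>Up to \<open>r0 = sqrt (\<mu> * (\<mu> + 2))\<close> the function is positive and
  nondecreasing. As it tends to 0 at infinity, its derivative cannot stay positive beyond
  \<open>r0\<close>; the first point where \<open>bessel_D\<close> is nonpositive is the maximum,
  and \<open>\<rho> \<ge> r0\<close> yields
  \<open>\<rho>^2 - \<mu>^2 \<ge> 2 * \<mu>\<close>.\<close>

lemma bessel_J_first_max:
  assumes \<mu>: "\<mu> > 0" and amp: "amp \<mu> L"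
  obtains \<rho> where "\<rho> > 0" "2 * \<mu> \<le> \<rho>\<^sup>2 - \<mu>\<^sup>2" "bessel_D \<mu> \<rho> = 0"
    "\<And>r. 0 < r \<Longrightarrow> r \<le> \<rho> \<Longrightarrow> 0 < bessel_J \<mu> r" "\<And>r. 0 < r \<Longrightarrow> r \<le> \<rho> \<Longrightarrow> bessel_J \<mu> r \<le> bessel_J \<mu> \<rho>"
proof -
  have \<mu>0: "\<mu> \<ge> 0" using \<mu> by simp
  define r0 where "r0 = sqrt (\<mu> * (\<mu> + 2))"
  have r0: "r0 > 0" "r0\<^sup>2 = \<mu> * (\<mu> + 2)" using \<mu> by (auto simp: r0_def)
  have "r0\<^sup>2 \<le> (\<mu> + 1)\<^sup>2" unfolding r0(2) by (simp add: power2_eq_square algebra_simps)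
  then have r0': "r0 \<le> \<mu> + 1" using \<mu> by (intro power2_le_imp_le[of r0]) auto
  have D0: "bessel_D \<mu> t \<ge> 0" if "0 < t" "t \<le> r0" for t
  proof -
    have "t\<^sup>2 \<le> (\<mu> - 0) * (\<mu> + 2 + 0)" using power_mono[OF that(2), of 2] that r0 by simp
    then show ?thesis using bessel_D_ge[of \<mu> 0 t] \<mu> that by simp
  qed
  have J0: "bessel_J \<mu> t > 0" if "0 < t" "t \<le> r0" for t using that r0' \<mu> by (intro bessel_J_pos) auto
  have "\<exists>r1\<ge>r0. bessel_D \<mu> r1 \<le> 0"
  proof (rule ccontr)
    assume "\<not> ?thesis"
    then have D: "bessel_D \<mu> t > 0" if "t \<ge> r0" for t using that by (meson not_le)
    have "bessel_J \<mu> r0 \<le> bessel_J \<mu> r" if "r \<ge> r0" for r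
      using that r0 D by (intro bessel_J_mono_of_D \<mu>0) (auto intro: less_imp_le)
    then have "\<forall>\<^sub>F r in at_top. bessel_J \<mu> r0 \<le> bessel_J \<mu> r"
      unfolding eventually_at_top_linorder by (intro exI[of _ r0]) simp
    from tendsto_lowerbound[OF amp_tendsto_0(1)[OF amp] this] have "bessel_J \<mu> r0 \<le> 0" by simp
    with J0[of r0] r0 show False by simp
  qed
  then obtain r1 where r1: "r1 \<ge> r0" "bessel_D \<mu> r1 \<le> 0" by auto
  define S where "S = {r0..r1} \<inter> bessel_D \<mu> -` {..0}"
  have "closed S" unfolding S_def
    using \<mu>0 r0 by (intro continuous_closed_preimage continuous_on_bessel_J) auto
  then have "compact ({r0..r1} \<inter> S)" by (intro compact_Int_closed) auto
  moreover have "r1 \<in> {r0..r1} \<inter> S" using r1 by (auto simp: S_def)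
  ultimately obtain \<rho> where \<rho>: "\<rho> \<in> {r0..r1} \<inter> S" "\<And>t. t \<in> {r0..r1} \<inter> S \<Longrightarrow> \<rho> \<le> t"
    using compact_attains_inf[of "{r0..r1} \<inter> S"] by blast
  have \<rho>': "r0 \<le> \<rho>" "\<rho> \<le> r1" "bessel_D \<mu> \<rho> \<le> 0" using \<rho>(1) by (auto simp: S_def)
  have D: "bessel_D \<mu> t > 0" if "r0 \<le> t" "t < \<rho>" for t
    using \<rho>(2)[of t] that \<rho>' by (force simp: S_def)
  have "bessel_D \<mu> \<rho> = 0"
  proof -
    have "continuous_on {r0..\<rho>} (bessel_D \<mu>)" using \<mu>0 r0 by (intro continuous_on_bessel_J) auto
    then obtain x where x: "r0 \<le> x" "x \<le> \<rho>" "bessel_D \<mu> x = 0"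
      using IVT2'[of "bessel_D \<mu>" \<rho> 0 r0] \<rho>' D0[of r0] r0 by auto
    then show ?thesis using D[of x] by (cases "x = \<rho>") auto
  qed
  moreover have Jm: "bessel_J \<mu> r \<le> bessel_J \<mu> \<rho>" if "0 < r" "r \<le> \<rho>" for r
  proof (rule bessel_J_mono_of_D[OF \<mu>0 that])
    show "0 \<le> bessel_D \<mu> t" if "r \<le> t" "t < \<rho>" for t
      using D0[of t] D[of t] \<open>0 < r\<close> that by (cases "t \<le> r0") auto
  qed
  moreover have "0 < bessel_J \<mu> r" if r: "0 < r" "r \<le> \<rho>" for r
  proof (cases "r \<le> r0")
    case False
    then have "bessel_J \<mu> r0 \<le> bessel_J \<mu> r" using D r r0 by (intro bessel_J_mono_of_D \<mu>0) (auto intro: less_imp_le)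
    then show ?thesis using J0[of r0] r0 by simp
  qed (use J0 r in simp)
  moreover have "2 * \<mu> \<le> \<rho>\<^sup>2 - \<mu>\<^sup>2"
    using power_mono[OF \<rho>'(1), of 2] r0 by (simp add: power2_eq_square algebra_simps)
  ultimately show ?thesis using that[of \<rho>] \<rho>' r0 by simp
qed

text \<open>Lommel's integral: differentiating \<open>D^2 + (r^2 - \<mu>^2) * J^2\<close> along
  Bessel's equation, everything cancels except the contribution \<open>2 * r * J^2\<close> of the
  coefficient. At a critical point the term \<open>D^2\<close> drops out.\<close>

lemma bessel_J_square_integral:
  assumes \<mu>: "\<mu> > 0" and \<rho>: "\<rho> > 0"
  shows "set_integrable lborel {0<..<\<rho>} (\<lambda>r. r * (bessel_J \<mu> r)\<^sup>2)"
    and "(LBINT r:{0<..<\<rho>}. r * (bessel_J \<mu> r)\<^sup>2) = ((bessel_D \<mu> \<rho>)\<^sup>2 + (\<rho>\<^sup>2 - \<mu>\<^sup>2) * (bessel_J \<mu> \<rho>)\<^sup>2) / 2"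
proof -
  have \<mu>0: "\<mu> \<ge> 0" using \<mu> by simp
  define T where "T = (\<lambda>r. ((bessel_D \<mu> r)\<^sup>2 + (r\<^sup>2 - \<mu>\<^sup>2) * (bessel_J \<mu> r)\<^sup>2) / 2)"
  have dT: "(T has_real_derivative r * (bessel_J \<mu> r)\<^sup>2) (at r)" if r: "r > 0" for r
  proof -
    let ?J = "bessel_J \<mu> r" and ?D = "bessel_D \<mu> r"
    have "((\<lambda>r. r\<^sup>2 - \<mu>\<^sup>2) has_real_derivative 2 * r) (at r)" by (auto intro!: derivative_eq_intros)
    from DERIV_cdivide[OF DERIV_add[OF DERIV_power[OF has_real_derivative_bessel_D[OF \<mu>0 r], of 2]
        DERIV_mult[OF this DERIV_power[OF has_real_derivative_bessel_J_theta[OF \<mu>0 r], of 2]]], of 2]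
    have "(T has_real_derivative (2 * (- (r\<^sup>2 - \<mu>\<^sup>2) * ?J / r * ?D) + (2 * r * ?J\<^sup>2 + 2 * (?D / r * ?J) * (r\<^sup>2 - \<mu>\<^sup>2))) / 2) (at r)"
      unfolding T_def by simp
    moreover have "(2 * (- K * j / s * D) + (2 * s * j\<^sup>2 + 2 * (D / s * j) * K)) / 2 = s * j\<^sup>2" for K j D s :: real
      by (simp add: field_simps)
    ultimately show ?thesis by metis
  qed
  have t0: "(bessel_J \<mu> \<longlongrightarrow> 0) (at_right 0)" "(bessel_J (\<mu> + 1) \<longlongrightarrow> 0) (at_right 0)"
    using \<mu> by (auto intro: tendsto_bessel_J_at_0)
  have "(T \<longlongrightarrow> ((\<mu> * 0 - 0 * 0)\<^sup>2 + (0\<^sup>2 - \<mu>\<^sup>2) * 0\<^sup>2) / 2) (at_right 0)"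
    unfolding T_def bessel_D_def by (intro tendsto_intros t0) auto
  then have T0: "((T \<circ> real_of_ereal) \<longlongrightarrow> 0) (at_right 0)"
    unfolding zero_ereal_def ereal_tendsto_simps by simp
  have "isCont T \<rho>" by (rule DERIV_isCont[OF dT[OF \<rho>]])
  then have "(T \<longlongrightarrow> T \<rho>) (at_left \<rho>)" unfolding isCont_def by (rule tendsto_within_subset[where S = UNIV]) simp
  then have T1: "((T \<circ> real_of_ereal) \<longlongrightarrow> T \<rho>) (at_left (ereal \<rho>))"
    unfolding ereal_tendsto_simps .
  have cont: "isCont (\<lambda>r. r * (bessel_J \<mu> r)\<^sup>2) r" if "r > 0" for r
    using that DERIV_isCont[OF has_real_derivative_bessel_J_theta[OF \<mu>0 that]] by (intro continuous_intros) auto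
  have prem: "(0 :: ereal) < ereal \<rho>"
    "\<And>x. 0 < ereal x \<Longrightarrow> ereal x < ereal \<rho> \<Longrightarrow> (T has_real_derivative x * (bessel_J \<mu> x)\<^sup>2) (at x)"
    "\<And>x. 0 < ereal x \<Longrightarrow> ereal x < ereal \<rho> \<Longrightarrow> isCont (\<lambda>r. r * (bessel_J \<mu> r)\<^sup>2) x"
    "AE x in lborel. 0 < ereal x \<longrightarrow> ereal x < ereal \<rho> \<longrightarrow> 0 \<le> x * (bessel_J \<mu> x)\<^sup>2"
    using dT cont \<rho> by auto
  note ftc = interval_integral_FTC_nonneg[OF prem T0 T1]
  have "einterval 0 (ereal \<rho>) = {0<..<\<rho>}" by (auto simp: einterval_def)
  with ftc \<rho> show "set_integrable lborel {0<..<\<rho>} (\<lambda>r. r * (bessel_J \<mu> r)\<^sup>2)"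
    "(LBINT r:{0<..<\<rho>}. r * (bessel_J \<mu> r)\<^sup>2) = ((bessel_D \<mu> \<rho>)\<^sup>2 + (\<rho>\<^sup>2 - \<mu>\<^sup>2) * (bessel_J \<mu> \<rho>)\<^sup>2) / 2"
    by (simp_all add: interval_lebesgue_integral_def T_def)
qed

text \<open>The integral is split at the first maximum \<open>\<rho>\<close> of \<open>J\<close>; below it \<open>J powr p \<le> J \<rho> powr (p - 2) * J\<^sup>2\<close>.\<close>

lemma radial_2_integral_le:
  assumes k: "k \<ge> 1" and p: "p > 4"
  shows "set_integrable lborel {0<..} (\<lambda>r. \<bar>radial 2 k r\<bar> powr p * r ^ (2 - 1))" (is "set_integrable _ _ ?f")
    and "(LBINT r:{0<..}. \<bar>radial 2 k r\<bar> powr p * r ^ (2 - 1))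
      \<le> (16 / 25) powr (p / 2) * (2 * real k) powr (1 - p / 4) * (p / (2 * (p - 4)))"
proof -
  define \<mu> where "\<mu> = real k"
  have \<mu>: "\<mu> > 0" "bindex 2 k = \<mu>" using k by (auto simp: \<mu>_def bindex_def)
  obtain L where L: "L \<le> amp_bound 2" "\<And>k. amp (bindex 2 k) L" using ex_amp_bindex[of 2] by auto
  have amp: "amp \<mu> L" using L(2)[of k] \<mu> by simp
  have L0: "L \<ge> 0" by (rule amp_nonneg[OF amp])
  obtain \<rho> where \<rho>: "\<rho> > 0" "2 * \<mu> \<le> \<rho>\<^sup>2 - \<mu>\<^sup>2" "bessel_D \<mu> \<rho> = 0"
    "\<And>r. 0 < r \<Longrightarrow> r \<le> \<rho> \<Longrightarrow> 0 < bessel_J \<mu> r" "\<And>r. 0 < r \<Longrightarrow> r \<le> \<rho> \<Longrightarrow> bessel_J \<mu> r \<le> bessel_J \<mu> \<rho>"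
    using bessel_J_first_max[OF \<mu>(1) amp] by metis
  define \<Delta> where "\<Delta> = \<rho>\<^sup>2 - \<mu>\<^sup>2"
  have \<Delta>: "\<Delta> > 0" "2 * \<mu> \<le> \<Delta>" using \<rho> \<mu> by (auto simp: \<Delta>_def)
  have rad: "radial 2 k r = bessel_J \<mu> r" if "r > 0" for r using that \<mu>(2) by (simp add: radial_def bindex_def)
  have bound: "\<bar>bessel_J \<mu> r\<bar> powr p \<le> L powr (p / 2) * (r\<^sup>2 - \<mu>\<^sup>2) powr (- p / 4)" if r: "r \<ge> \<rho>" for r
  proof -
    have r2: "r\<^sup>2 - \<mu>\<^sup>2 > 0" using power_mono[OF r, of 2] \<rho> \<Delta> by (simp add: \<Delta>_def)
    then have "r > \<mu>" using r \<rho> by (intro power2_less_imp_less[of \<mu> r]) auto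
    then have "(bessel_J \<mu> r)\<^sup>2 \<le> L / sqrt (r\<^sup>2 - \<mu>\<^sup>2)" using \<mu> by (intro bessel_J_square_le amp) auto
    then have "((bessel_J \<mu> r)\<^sup>2) powr (p / 2) \<le> (L / sqrt (r\<^sup>2 - \<mu>\<^sup>2)) powr (p / 2)"
      using p by (intro powr_mono2) auto
    also have "((bessel_J \<mu> r)\<^sup>2) powr (p / 2) = \<bar>bessel_J \<mu> r\<bar> powr p"
    proof -
      have "(bessel_J \<mu> r)\<^sup>2 = \<bar>bessel_J \<mu> r\<bar> powr 2" by simp
      then show ?thesis by (simp only: powr_powr) simp
    qed
    also have "(L / sqrt (r\<^sup>2 - \<mu>\<^sup>2)) powr (p / 2) = L powr (p / 2) * (r\<^sup>2 - \<mu>\<^sup>2) powr (- p / 4)"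
    proof -
      have "sqrt (r\<^sup>2 - \<mu>\<^sup>2) powr (p / 2) = ((r\<^sup>2 - \<mu>\<^sup>2) powr (1 / 2)) powr (p / 2)"
        using r2 by (simp only: powr_half_sqrt less_imp_le)
      also have "\<dots> = (r\<^sup>2 - \<mu>\<^sup>2) powr (p / 4)" by (simp only: powr_powr) simp
      finally have "(L / sqrt (r\<^sup>2 - \<mu>\<^sup>2)) powr (p / 2) = L powr (p / 2) / (r\<^sup>2 - \<mu>\<^sup>2) powr (p / 4)"
        using L0 r2 by (simp only: powr_divide)
      moreover have "- p / 4 = - (p / 4)" by simp
      ultimately show ?thesis by (simp only: powr_minus divide_inverse)
    qed
    finally show ?thesis .
  qed
  \<comment> \<open>The common scale of the two parts: the part below \<open>\<rho>\<close>
    contributes \<open>A / 2\<close>, the tail \<open>2 * A / (p - 4)\<close>, together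
    \<open>A * p / (2 * (p - 4))\<close>.\<close>
  define A where "A = L powr (p / 2) * \<Delta> powr (1 - p / 4)"
  have i1: "set_integrable lborel {0<..<\<rho>} ?f" "(LBINT r:{0<..<\<rho>}. ?f r) \<le> A / 2"
  proof -
    let ?m = "bessel_J \<mu> \<rho>"
    let ?g = "\<lambda>r. ?m powr (p - 2) * (r * (bessel_J \<mu> r)\<^sup>2)"
    have m: "?m > 0" using \<rho> by simp
    have g: "set_integrable lborel {0<..<\<rho>} ?g"
      using bessel_J_square_integral(1)[OF \<mu>(1) \<rho>(1)] by (intro set_integrable_mult_right impI)
    have le: "?f r \<le> ?g r" if "r \<in> {0<..<\<rho>}" for r
    proof -
      have J: "0 < bessel_J \<mu> r" "bessel_J \<mu> r \<le> ?m" using that \<rho>(4,5)[of r] by auto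
      have "bessel_J \<mu> r powr p = bessel_J \<mu> r powr (p - 2) * (bessel_J \<mu> r)\<^sup>2"
        using J powr_add[of "bessel_J \<mu> r" "p - 2" 2] by simp
      also have "\<dots> \<le> ?m powr (p - 2) * (bessel_J \<mu> r)\<^sup>2"
        using J p by (intro mult_right_mono powr_mono2) auto
      finally have "bessel_J \<mu> r powr p * r \<le> ?m powr (p - 2) * (bessel_J \<mu> r)\<^sup>2 * r"
        using that by (intro mult_right_mono) auto
      then show ?thesis using J that rad[of r] by (simp add: mult.assoc mult.commute[of _ r])
    qed
    have fm: "set_borel_measurable lborel {0<..<\<rho>} ?f" using p by (intro set_borel_measurable_radial) auto
    show "set_integrable lborel {0<..<\<rho>} ?f"
      by (rule set_integral_le_of_nonneg(1)[OF fm g _ le]) simp_all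
    have "(LBINT r:{0<..<\<rho>}. ?f r) \<le> (LBINT r:{0<..<\<rho>}. ?g r)"
      by (rule set_integral_le_of_nonneg(2)[OF fm g _ le]) simp_all
    also have "\<dots> = ?m powr (p - 2) * (\<Delta> * ?m\<^sup>2 / 2)"
      using bessel_J_square_integral(2)[OF \<mu>(1) \<rho>(1)] \<rho>(3) by (simp add: \<Delta>_def)
    also have "\<dots> = ?m powr p * \<Delta> / 2"
      using m powr_add[of ?m "p - 2" 2] by simp
    \<comment> \<open>The envelope is applied at the maximum itself, which expresses the peak height
      through \<open>\<Delta>\<close>.\<close>
    also have "\<dots> \<le> L powr (p / 2) * \<Delta> powr (- p / 4) * \<Delta> / 2"
      using bound[of \<rho>] m \<Delta> by (intro divide_right_mono mult_right_mono) (auto simp: \<Delta>_def)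
    also have "\<dots> = A / 2"
    proof -
      have "\<Delta> powr (- p / 4) * \<Delta> = \<Delta> powr (1 - p / 4)" using \<Delta> powr_mult_base[of \<Delta> "- p / 4"] by (simp add: mult.commute)
      then show ?thesis by (simp add: A_def mult.assoc)
    qed
    finally show "(LBINT r:{0<..<\<rho>}. ?f r) \<le> A / 2" .
  qed
  have i2: "set_integrable lborel {\<rho><..} ?f" "(LBINT r:{\<rho><..}. ?f r) \<le> A * (2 / (p - 4))"
  proof -
    let ?g = "\<lambda>r. L powr (p / 2) * ((r\<^sup>2 - \<mu>\<^sup>2) powr (- p / 4) * r)"
    have a: "- p / 4 < - 1" "\<mu>\<^sup>2 < \<rho>\<^sup>2" using p \<Delta> by (auto simp: \<Delta>_def)
    have g: "set_integrable lborel {\<rho><..} ?g"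
      using LBINT_sqrt_tail(1)[OF a(1) \<rho>(1) a(2)] by (intro set_integrable_mult_right impI)
    have le: "?f r \<le> ?g r" if "r \<in> {\<rho><..}" for r
      using mult_right_mono[OF bound[of r], of r] that \<rho> rad[of r] by (simp add: mult.assoc)
    have fm: "set_borel_measurable lborel {\<rho><..} ?f" using p \<rho> by (intro set_borel_measurable_radial) auto
    show "set_integrable lborel {\<rho><..} ?f"
      by (rule set_integral_le_of_nonneg(1)[OF fm g _ le]) (use \<rho> in simp_all)
    have "(LBINT r:{\<rho><..}. ?f r) \<le> (LBINT r:{\<rho><..}. ?g r)"
      by (rule set_integral_le_of_nonneg(2)[OF fm g _ le]) (use \<rho> in simp_all)
    also have "\<dots> = L powr (p / 2) * (\<Delta> powr (- p / 4 + 1) / (- (2 * (- p / 4 + 1))))"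
      using LBINT_sqrt_tail(2)[OF a(1) \<rho>(1) a(2)] by (simp add: \<Delta>_def)
    also have "- p / 4 + 1 = 1 - p / 4" by simp
    also have "L powr (p / 2) * (\<Delta> powr (1 - p / 4) / (- (2 * (1 - p / 4)))) = A * (2 / (p - 4))"
      using p by (simp add: A_def field_simps)
    finally show "(LBINT r:{\<rho><..}. ?f r) \<le> A * (2 / (p - 4))" .
  qed
  have un: "set_integrable lborel ({0<..<\<rho>} \<union> {\<rho><..}) ?f"
    using i1 i2 by (intro set_integrable_Un) auto
  have fm: "set_borel_measurable lborel {0<..} ?f" using p by (intro set_borel_measurable_radial) auto
  \<comment> \<open>The two open pieces omit the null set consisting of the point
    \<open>\<rho>\<close>.\<close>
  have ae: "AE r in lborel. indicator {0<..} r *\<^sub>R ?f r = indicator ({0<..<\<rho>} \<union> {\<rho><..}) r *\<^sub>R ?f r"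
    using AE_lborel_singleton[of \<rho>] by eventually_elim (use \<rho> in \<open>auto simp: indicator_def\<close>)
  show "set_integrable lborel {0<..} ?f"
    using un fm ae unfolding set_integrable_def set_borel_measurable_def
    by (subst integrable_cong_AE) (auto intro: borel_measurable_integrable)
  have "(LBINT r:{0<..}. ?f r) = (LBINT r:{0<..<\<rho>} \<union> {\<rho><..}. ?f r)"
    using un fm ae unfolding set_lebesgue_integral_def set_integrable_def set_borel_measurable_def
    by (intro integral_cong_AE) (auto intro: borel_measurable_integrable)
  also have "\<dots> = (LBINT r:{0<..<\<rho>}. ?f r) + (LBINT r:{\<rho><..}. ?f r)"
    using i1 i2 by (intro set_integral_Un) auto
  also have "\<dots> \<le> A / 2 + A * (2 / (p - 4))" using i1(2) i2(2) by (rule add_mono)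
  also have "\<dots> = A * (p / (2 * (p - 4)))" using p by (simp add: field_simps)
  also have "\<dots> \<le> (16 / 25) powr (p / 2) * (2 * real k) powr (1 - p / 4) * (p / (2 * (p - 4)))"
  proof (intro mult_right_mono)
    show "A \<le> (16 / 25) powr (p / 2) * (2 * real k) powr (1 - p / 4)" unfolding A_def
    proof (rule mult_mono)
      show "L powr (p / 2) \<le> (16 / 25) powr (p / 2)" using L L0 p by (intro powr_mono2) (auto simp: amp_bound_def)
      show "\<Delta> powr (1 - p / 4) \<le> (2 * real k) powr (1 - p / 4)"
        using \<Delta> \<mu> p by (intro powr_mono2') (auto simp: \<mu>_def)
    qed auto
  qed (use p in simp)
  finally show "(LBINT r:{0<..}. ?f r) \<le> (16 / 25) powr (p / 2) * (2 * real k) powr (1 - p / 4) * (p / (2 * (p - 4)))" .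
qed

text \<open>The heights lie below values of \<open>hyp\<close> and hence below 1, so their powers
  decrease in the exponent. Below the endpoint the lower bound for \<open>k = 0\<close> thus only
  improves.\<close>

lemma cell_sum_antimono:
  assumes "d \<ge> 2" "0 \<le> a" "cells_ok d a cs" "p \<le> q"
  shows "cell_sum d (\<lambda>y. y powr q) a cs \<le> cell_sum d (\<lambda>y. y powr p) a cs"
  using assms(2,3)
proof (induction cs arbitrary: a)
  case (Cons c cs)
  obtain b y where c: "c = (b, y)" by (cases c)
  from Cons.prems c have ab: "a < b" "cells_ok d b cs" "0 < y" "y \<le> hyp (real d / 2 - 1) (cell_mean d a b)" by auto
  have "\<bar>hyp (real d / 2 - 1) (cell_mean d a b)\<bar> \<le> 1"
    using assms(1) Cons.prems ab by (intro abs_hyp_le_1 cell_mean_nonneg) auto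
  then have "y \<le> 1" using ab by linarith
  then have "y powr q \<le> y powr p" using ab assms(4) by (intro powr_mono') auto
  moreover have "(b ^ d - a ^ d) / real d \<ge> 0" using ab Cons.prems by (auto intro!: divide_nonneg_nonneg power_mono)
  moreover have "cell_sum d (\<lambda>y. y powr q) b cs \<le> cell_sum d (\<lambda>y. y powr p) b cs"
    using Cons.IH[of b] ab Cons.prems by simp
  ultimately show ?case unfolding c cell_sum.simps by (intro add_mono mult_right_mono)
qed simp

lemma powr_le_convex_comb:
  fixes x :: real
  assumes "x \<ge> 0" "0 \<le> s" "s \<le> 1" "p = (1 - s) * q + s * q1"
  shows "x powr p \<le> (1 - s) * x powr q + s * x powr q1"
proof (cases "x = 0")
  case False
  then have "(x powr q) powr (1 - s) * (x powr q1) powr s \<le> (1 - s) * x powr q + s * x powr q1"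
    using assms by (intro Youngs_inequality_0) auto
  moreover have "q * (1 - s) + q1 * s = p" using assms(4) by (simp add: mult.commute)
  ultimately show ?thesis by (simp only: powr_powr powr_add[symmetric])
qed (use assms in simp)

text \<open>Below \<open>q\<close> the integrals are interpolated between \<open>q\<close> and \<open>q1\<close>, uniformly in \<open>k\<close>.\<close>

lemma p0_less_of_uniform_bound:
  fixes a N j :: nat
  assumes d: "d \<ge> 2" and a: "a \<ge> 1" "real a * q = real N" "a \<le> N"
    and q: "2 * real d / (real d - 1) < q1" "q1 < q" and M: "0 < M" "M < 1"
    and sup: "\<And>k r. k \<ge> 1 \<Longrightarrow> r > 0 \<Longrightarrow> rad_sq d k r \<le> M\<^sup>2"
    and int: "\<And>k. k \<ge> 1 \<Longrightarrow> set_integrable lborel {0<..} (\<lambda>r. \<bar>radial d k r\<bar> powr q * r ^ (d - 1))"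
      "\<And>k. k \<ge> 1 \<Longrightarrow> (LBINT r:{0<..}. \<bar>radial d k r\<bar> powr q * r ^ (d - 1)) \<le> B * radial_0 d powr q"
    and int1: "\<And>k. k \<ge> 1 \<Longrightarrow> set_integrable lborel {0<..} (\<lambda>r. \<bar>radial d k r\<bar> powr q1 * r ^ (d - 1))"
      "\<And>k. k \<ge> 1 \<Longrightarrow> (LBINT r:{0<..}. \<bar>radial d k r\<bar> powr q1 * r ^ (d - 1)) \<le> D"
    and cs: "even j" "j > 0" "zcells_ok d a j 0 cs" "B < cell_sum d (\<lambda>z. z ^ N) 0 cs"
      "0 \<le> cell_sum d (\<lambda>z. z ^ (N - a) * (z ^ a - M)) 0 cs"
  shows "p0 d < ereal q"
proof -
  let ?F = "radial_0 d" and ?f = "\<lambda>k p r. \<bar>radial d k r\<bar> powr p * r ^ (d - 1)"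
  let ?S = "cell_sum d (\<lambda>z. z ^ N) 0 cs" and ?cs = "map (\<lambda>(b, z). (b, z ^ a)) cs"
  have F: "?F > 0" by (rule radial_0_pos[OF d])
  have I0: "(LBINT r:{0<..}. ?f k p r) \<ge> 0" for k p
    by (simp add: set_lebesgue_integral_def) (intro integral_nonneg_AE AE_I2, auto simp: indicator_def)
  have D: "D \<ge> 0" using I0[of 1 q1] int1(2)[of 1] by simp
  have "0 \<le> B * ?F powr q" using I0[of 1 q] int(2)[of 1] by simp
  then have B: "B \<ge> 0" using F by (simp add: zero_le_mult_iff)
  define D' where "D' = D / ?F powr q1"
  have D': "D' \<ge> 0" using D by (simp add: D'_def)
  \<comment> \<open>For interpolation parameters \<open>s < e\<close> the crude bound contributes at
    most half of the gap between \<open>B\<close> and the cell sum. The \<open>+ 1\<close> keeps the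
    denominator positive.\<close>
  define e where "e = min 1 ((?S - B) / (2 * (D' + 1)))"
  have e: "0 < e" "e \<le> 1" using cs(4) D' by (auto simp: e_def)
  have "e * (D' + 1) \<le> (?S - B) / (2 * (D' + 1)) * (D' + 1)"
    using D' by (intro mult_right_mono) (auto simp: e_def)
  also have "\<dots> = (?S - B) / 2"
  proof -
    have "u / (2 * v) * v = u / 2" if "v \<noteq> 0" for u v :: real using that by simp
    moreover have "D' + 1 \<noteq> 0" using D' by simp
    ultimately show ?thesis by metis
  qed
  finally have eD: "e * (D' + 1) \<le> (?S - B) / 2" .
  define q2 where "q2 = q - e * (q - q1)"
  have "0 < e * (q - q1)" "e * (q - q1) \<le> 1 * (q - q1)" using e q by (intro mult_pos_pos mult_right_mono; simp)+
  then have q2: "q1 \<le> q2" "q2 < q" unfolding q2_def mult_1_left by linarith+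
  have q1: "q1 > 0"
  proof -
    have "real d - 1 > 0" using d by simp
    then have "2 * real d / (real d - 1) \<ge> 0" by simp
    then show ?thesis using q by simp
  qed
  show ?thesis
  proof (rule p0_less[OF d _ q2(2)])
    show "2 * real d / (real d - 1) \<le> q2" using q q2 by simp
    show "M * ?F < ?F" using M F by simp
    show "\<bar>radial d k r\<bar> \<le> M * ?F" if "k \<ge> 1" "r > 0" for k r
      using M sup[OF that] by (intro abs_radial_le_of_rad_sq d) auto
    fix p k assume p: "q2 < p" and k: "k \<ge> (1 :: nat)"
    show "(LBINT r:{0<..}. ?f k p r) < (LBINT r:{0<..}. ?f 0 p r)"
    proof (cases "q \<le> p")
      case True
      show ?thesis
        using q by (intro radial_integral_less_zcells[OF d k a _ True M(1) sup[OF k] int[OF k] cs]) auto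
    next
      case False
      define s where "s = (q - p) / (q - q1)"
      have s: "0 \<le> s" "s < e" "p = (1 - s) * q + s * q1"
      proof -
        have "s * (q - q1) = q - p" using q by (simp add: s_def)
        then show "p = (1 - s) * q + s * q1" by (simp add: algebra_simps)
        show "0 \<le> s" "s < e" using q False p by (auto simp: s_def q2_def field_simps)
      qed
      define c where "c = (\<lambda>t. ?F powr p / ?F powr t)"
      let ?g = "\<lambda>r. (1 - s) * c q * ?f k q r + s * c q1 * ?f k q1 r"
      have le: "?f k p r \<le> ?g r" if "r \<in> {0<..}" for r
      proof -
        let ?x = "\<bar>radial d k r\<bar> / ?F"
        have x: "\<bar>radial d k r\<bar> powr t = ?F powr t * ?x powr t" for t using F by (simp add: powr_divide)
        have "?x powr p \<le> (1 - s) * ?x powr q + s * ?x powr q1"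
          using s e F by (intro powr_le_convex_comb) auto
        then have "?F powr p * ?x powr p \<le> ?F powr p * ((1 - s) * ?x powr q + s * ?x powr q1)"
          by (intro mult_left_mono) auto
        also have "\<dots> = (1 - s) * c q * \<bar>radial d k r\<bar> powr q + s * c q1 * \<bar>radial d k r\<bar> powr q1"
          using F unfolding x[of q] x[of q1] c_def by (simp add: distrib_left)
        finally have "\<bar>radial d k r\<bar> powr p * r ^ (d - 1)
            \<le> ((1 - s) * c q * \<bar>radial d k r\<bar> powr q + s * c q1 * \<bar>radial d k r\<bar> powr q1) * r ^ (d - 1)"
          unfolding x[of p, symmetric] using that by (intro mult_right_mono) auto
        then show ?thesis by (simp add: distrib_right mult.assoc)
      qed
      have g: "set_integrable lborel {0<..} (\<lambda>r. (1 - s) * c q * ?f k q r)" "set_integrable lborel {0<..} (\<lambda>r. s * c q1 * ?f k q1 r)"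
        by (intro set_integrable_mult_right impI int[OF k] int1[OF k])+
      have fm: "set_borel_measurable lborel {0<..} (?f k p)"
        using d q1 q2 p by (intro set_borel_measurable_radial) auto
      have "(LBINT r:{0<..}. ?f k p r) \<le> (LBINT r:{0<..}. ?g r)"
        by (rule set_integral_le_of_nonneg(2)[OF fm set_integral_add(1)[OF g] _ le]) simp_all
      also have "\<dots> = (1 - s) * c q * (LBINT r:{0<..}. ?f k q r) + s * c q1 * (LBINT r:{0<..}. ?f k q1 r)"
        unfolding set_integral_add(2)[OF g] by (simp only: set_integral_mult_right)
      also have "\<dots> \<le> (1 - s) * c q * (B * ?F powr q) + s * c q1 * D"
        using s e by (intro add_mono mult_left_mono int(2)[OF k] int1(2)[OF k]) (auto simp: c_def)
      also have "\<dots> = ?F powr p * ((1 - s) * B + s * D')"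
        using F by (simp add: c_def D'_def distrib_left)
      also have "\<dots> < ?F powr p * ?S"
      proof (rule mult_strict_left_mono)
        have "(1 - s) * B \<le> B" using mult_nonneg_nonneg[OF s(1) B] by (simp add: left_diff_distrib)
        moreover have "s * D' \<le> e * (D' + 1)" using s D' by (intro mult_mono) auto
        moreover have "u + v < S" if "u \<le> B" "v \<le> w" "w \<le> (S - B) / 2" "B < S" for u v w S :: real
          using that by argo
        ultimately show "(1 - s) * B + s * D' < ?S" using eD cs(4) by blast
      qed (use F in simp)
      also have "?S = cell_sum d (\<lambda>y. y powr q) 0 ?cs"
        using a by (intro cell_sum_zcells[OF cs(3), symmetric]) (simp add: powr_realpow[symmetric] powr_powr)
      also have "?F powr p * cell_sum d (\<lambda>y. y powr q) 0 ?cs \<le> ?F powr p * cell_sum d (\<lambda>y. y powr p) 0 ?cs"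
        using False by (intro mult_left_mono cell_sum_antimono d cells_ok_of_zcells_ok[OF d cs(1,2) order_refl cs(3)]) auto
      also have "\<dots> \<le> (LBINT r:{0<..}. ?f 0 p r)"
        using q q2 p by (intro cell_sum_le_LBINT d cells_ok_of_zcells_ok[OF d cs(1,2) order_refl cs(3)]) auto
      finally show ?thesis .
    qed
  qed
qed

lemma radial_0_2: "radial_0 2 = 1"
  by (simp add: radial_0_def)

text \<open>For \<open>p = 6\<close> the split integral is at most
  \<open>(16 / 25)^3 / sqrt 2 * (3 / 2)\<close> in the worst case \<open>k = 1\<close>, which is
  below \<open>29 / 100\<close>. The auxiliary exponent 5 lies between the critical value 4 and 6;
  there the same formula gives the uniform bound \<open>5 / 2\<close>.\<close>

lemma p0_2: "p0 2 < ereal 6"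
proof (rule p0_less_of_uniform_bound[where q = 6 and ?q1.0 = 5 and a = 1 and N = 6 and j = 4 and M = "61 / 100" and B = "29 / 100"
      and D = "5 / 2" and cs = "[(7 / 25, 99 / 100), (14 / 25, 951 / 1000), (21 / 25, 219 / 250), (28 / 25, 769 / 1000), (7 / 5, 159 / 250), (42 / 25, 97 / 200)]"])
  show "rad_sq 2 k r \<le> (61 / 100)\<^sup>2" if "k \<ge> 1" "r > 0" for k r
    by (rule rad_sq_le_square_rational[where ?s1.0 = "1732 / 1000" and ?s2.0 = "2" and R = "2"])
       (use that in \<open>simp_all add: rad_K_2 power_divide\<close>)
  fix k assume k: "k \<ge> (1 :: nat)"
  show "set_integrable lborel {0<..} (\<lambda>r. \<bar>radial 2 k r\<bar> powr 6 * r ^ (2 - 1))"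
    "set_integrable lborel {0<..} (\<lambda>r. \<bar>radial 2 k r\<bar> powr 5 * r ^ (2 - 1))"
    using k by (intro radial_2_integral_le; simp)+
  have p: "(2 * real k) powr (1 - p / 4) \<le> 2 powr (1 - p / 4)" if "p > 4" for p
    using k that by (intro powr_mono2') auto
  have "(LBINT r:{0<..}. \<bar>radial 2 k r\<bar> powr 6 * r ^ (2 - 1)) \<le> (16 / 25) powr (6 / 2) * (2 * real k) powr (1 - 6 / 4) * (6 / (2 * (6 - 4)))"
    using k by (intro radial_2_integral_le) auto
  also have "\<dots> \<le> (16 / 25) powr (6 / 2) * 2 powr (1 - 6 / 4) * (6 / (2 * (6 - 4)))"
    using p[of 6] by (intro mult_right_mono mult_left_mono) auto
  also have "\<dots> \<le> (16 / 25) ^ 3 * (71 / 100) * (3 / 2)"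
  proof (intro mult_mono)
    have "(16 / 25 :: real) powr 3 = (16 / 25) ^ 3" using powr_realpow[of "16 / 25" 3] by simp
    then show "(16 / 25 :: real) powr (6 / 2) \<le> (16 / 25) ^ 3" by simp
    have "(2 :: real) powr (1 - 6 / 4) = 1 / sqrt 2" by (simp add: powr_minus_divide powr_half_sqrt)
    \<comment> \<open>A rational number between \<open>100 / 71\<close> and
      \<open>sqrt 2\<close>.\<close>
    moreover have "1408451 / 1000000 \<le> sqrt 2" by (rule real_le_rsqrt) (simp add: power_divide)
    then have "1 / sqrt 2 \<le> 1 / (1408451 / 1000000)" by (intro divide_left_mono) auto
    ultimately show "(2 :: real) powr (1 - 6 / 4) \<le> 71 / 100" by simp
  qed auto
  also have "\<dots> \<le> 29 / 100 * radial_0 2 powr 6" by (simp add: radial_0_2 power_divide)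
  finally show "(LBINT r:{0<..}. \<bar>radial 2 k r\<bar> powr 6 * r ^ (2 - 1)) \<le> 29 / 100 * radial_0 2 powr 6" .
  have "(LBINT r:{0<..}. \<bar>radial 2 k r\<bar> powr 5 * r ^ (2 - 1)) \<le> (16 / 25) powr (5 / 2) * (2 * real k) powr (1 - 5 / 4) * (5 / (2 * (5 - 4)))"
    using k by (intro radial_2_integral_le) auto
  also have "\<dots> \<le> 1 * 1 * (5 / 2)"
  proof (intro mult_mono)
    show "(16 / 25 :: real) powr (5 / 2) \<le> 1" by (intro powr_le1) auto
    have "(2 :: real) powr (1 - 5 / 4) \<le> 2 powr 0" by (intro powr_mono) auto
    then show "(2 * real k) powr (1 - 5 / 4) \<le> 1" using p[of 5] by simp
  qed auto
  finally show "(LBINT r:{0<..}. \<bar>radial 2 k r\<bar> powr 5 * r ^ (2 - 1)) \<le> 5 / 2" by simp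
qed (simp_all add: cell_mean_def hyp_horner_numeral power_divide)

text \<open>Below the exponent 4 the mass argument works only on a bounded interval, here up to
  \<open>R = 2 * \<mu>\<close>: the weight is at most \<open>R powr (7 / 8) \<le> R\<close>, and
  \<open>R\<close> times the mass \<open>1 / (2 * \<mu>)\<close> is 1. Beyond \<open>R\<close> the
  integrand is at most a multiple of \<open>r powr (- 3 / 2)\<close>. Both bounds are uniform in
  \<open>k\<close>.\<close>

lemma radial_3_integral_le:
  assumes k: "k \<ge> 1"
  shows "set_integrable lborel {0<..} (\<lambda>r. \<bar>radial 3 k r\<bar> powr (7 / 2) * r ^ (3 - 1))" (is "set_integrable _ _ ?f")
    and "(LBINT r:{0<..}. \<bar>radial 3 k r\<bar> powr (7 / 2) * r ^ (3 - 1)) \<le> 9"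
proof -
  let ?\<mu> = "bindex 3 k" and ?L = "amp_bound 3"
  define R where "R = 2 * ?\<mu>"
  have R: "R \<ge> 3" using k by (simp add: R_def bindex_def)
  have L: "0 \<le> ?L" "?L \<le> 1" using pi_gt3 by (simp_all add: amp_bound_def field_simps)
  have i1: "set_integrable lborel {0<..R} ?f" "(LBINT r:{0<..R}. ?f r) \<le> 1"
  proof -
    let ?g = "\<lambda>r. R * ((bessel_J ?\<mu> r)\<^sup>2 / r)"
    have le: "?f r \<le> ?g r" if r: "r \<in> {0<..R}" for r
    proof -
      let ?w = "(radial 3 k r)\<^sup>2" and ?J2 = "(bessel_J ?\<mu> r)\<^sup>2"
      have J: "?J2 = ?w * r" using radial_square[of 3 r k] r by simp
      have "?J2 \<le> ?L / sqrt R" unfolding R_def using k r by (intro bessel_square_le_bindex_sup) auto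
      also have "\<dots> \<le> 1 / sqrt R" using L R by (intro divide_right_mono) auto
      finally have J1: "?J2 \<le> R powr (- 1 / 2)"
        using R powr_minus_divide[of R "1 / 2"] by (simp add: powr_half_sqrt)
      have e: "\<bar>radial 3 k r\<bar> powr (7 / 2) = ?w powr (3 / 4) * ?w"
      proof -
        have w: "?w = \<bar>radial 3 k r\<bar> powr 2" by simp
        show ?thesis unfolding w powr_powr powr_add[symmetric] by simp
      qed
      have "r powr (5 / 4) * ?J2 powr (3 / 4) \<le> R powr (5 / 4) * (R powr (- 1 / 2)) powr (3 / 4)"
        using r J1 by (intro mult_mono powr_mono2) auto
      also have "\<dots> = R powr (7 / 8)" by (simp add: powr_powr powr_add[symmetric])
      also have "\<dots> \<le> R powr 1" using R by (intro powr_mono) auto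
      finally have b: "r powr (5 / 4) * ?J2 powr (3 / 4) \<le> R" using R by simp
      have "r powr (5 / 4) * ?J2 powr (3 / 4) = r\<^sup>2 * ?w powr (3 / 4)"
      proof -
        have "r powr (5 / 4) * r powr (3 / 4) = r\<^sup>2" using r by (simp add: powr_add[symmetric])
        then show ?thesis unfolding J powr_mult[of ?w r "3 / 4"] by (simp add: mult.commute mult.left_commute)
      qed
      with b have "r\<^sup>2 * ?w powr (3 / 4) * (?J2 / r) \<le> R * (?J2 / r)" using r by (intro mult_right_mono) auto
      moreover have "?f r = r\<^sup>2 * ?w powr (3 / 4) * (?J2 / r)" unfolding e J using r by simp
      ultimately show ?thesis by simp
    qed
    have i: "set_integrable lborel {0<..} ?g" by (intro set_integrable_mult_right impI bessel_mass k) simp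
    then have g: "set_integrable lborel {0<..R} ?g" by (rule set_integrable_subset) auto
    have fm: "set_borel_measurable lborel {0<..R} ?f" by (intro set_borel_measurable_radial) auto
    show "set_integrable lborel {0<..R} ?f"
      by (rule set_integral_le_of_nonneg(1)[OF fm g _ le]) simp_all
    have "(LBINT r:{0<..R}. ?f r) \<le> (LBINT r:{0<..R}. ?g r)"
      by (rule set_integral_le_of_nonneg(2)[OF fm g _ le]) simp_all
    also have "\<dots> \<le> (LBINT r:{0<..}. ?g r)"
      using i g R unfolding set_integrable_def set_lebesgue_integral_def
      by (intro integral_mono) (auto simp: indicator_def)
    also have "\<dots> = R * (1 / (2 * ?\<mu>))" using bessel_mass(2)[of 3 k] k by (subst set_integral_mult_right) simp
    also have "\<dots> = 1" using R by (simp add: R_def)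
    finally show "(LBINT r:{0<..R}. ?f r) \<le> 1" .
  qed
  have i2: "set_integrable lborel {R<..} ?f" "(LBINT r:{R<..}. ?f r) \<le> 8"
  proof -
    have a: "- (3 / 2) < (- 1 :: real)" "R > 0" using R by auto
    let ?c = "(2 * ?L) powr (7 / 2 / 2)"
    let ?g = "\<lambda>r. ?c * r powr (- (3 / 2))"
    have g: "set_integrable lborel {R<..} ?g"
      by (intro set_integrable_mult_right impI LBINT_powr_tail(1) a)
    have le: "?f r \<le> ?g r" if "r \<in> {R<..}" for r
      using radial_powr_le_tail[of 3 "7 / 2" k r] that R by (simp add: R_def)
    have fm: "set_borel_measurable lborel {R<..} ?f" using R by (intro set_borel_measurable_radial) auto
    show "set_integrable lborel {R<..} ?f"
      by (rule set_integral_le_of_nonneg(1)[OF fm g _ le]) (use R in simp_all)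
    have "(LBINT r:{R<..}. ?f r) \<le> (LBINT r:{R<..}. ?g r)"
      by (rule set_integral_le_of_nonneg(2)[OF fm g _ le]) (use R in simp_all)
    also have "\<dots> = ?c * (2 * R powr (- (1 / 2)))"
      using LBINT_powr_tail(2)[OF a] by simp
    also have "\<dots> \<le> 2 powr 2 * (2 * 1)"
    proof (intro mult_mono)
      have "?c \<le> 2 powr (7 / 2 / 2)" using L by (intro powr_mono2) auto
      also have "\<dots> \<le> 2 powr 2" by (intro powr_mono) auto
      finally show "?c \<le> 2 powr 2" .
      have "R powr (- (1 / 2)) \<le> R powr 0" using R by (intro powr_mono) auto
      then show "R powr (- (1 / 2)) \<le> 1" using R by simp
    qed auto
    finally show "(LBINT r:{R<..}. ?f r) \<le> 8" by simp
  qed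
  have un: "{0<..} = {0<..R} \<union> {R<..}" using R by auto
  show "set_integrable lborel {0<..} ?f" unfolding un using i1 i2 by (intro set_integrable_Un) auto
  have "(LBINT r:{0<..}. ?f r) = (LBINT r:{0<..R}. ?f r) + (LBINT r:{R<..}. ?f r)"
    unfolding un using i1 i2 by (intro set_integral_Un) auto
  then show "(LBINT r:{0<..}. ?f r) \<le> 9" using i1(2) i2(2) by linarith
qed

text \<open>At \<open>q = 4\<close> the weight is \<open>r^2 * rad_sq\<close>, whose Nicholson
  majorant keeps no power of \<open>r\<close> outside the bracket:
  \<open>(d - 1) * m = 2 * n\<close>. \<open>C\<close> is rounded up from \<open>1 + 1 / R^2\<close>
  with \<open>R\<close> just below \<open>sqrt 6\<close>.\<close>

lemma p0_3: "p0 3 < ereal 4"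
proof (rule p0_less_of_uniform_bound[where q = 4 and ?q1.0 = "7 / 2" and a = 1 and N = 4 and j = 6 and M = "46 / 100"
      and B = "1167 / 1000 * rad_K 3 / (real 3 * amp_bound 3)" and D = 9
      and cs = "[(21/50,491/500),(21/25,923/1000),(63/50,163/200),(42/25,667/1000),(21/10,247/500),(63/25,313/1000)]"])
  show "rad_sq 3 k r \<le> (46 / 100)\<^sup>2" if "k \<ge> 1" "r > 0" for k r
    by (rule rad_sq_le_square_rational[where ?s1.0 = "2" and ?s2.0 = "11 / 5" and R = "3"])
       (use that in \<open>simp_all add: rad_K_3 power_divide\<close>)
  show "set_integrable lborel {0<..} (\<lambda>r. \<bar>radial 3 k r\<bar> powr (7 / 2) * r ^ (3 - 1))"
    "(LBINT r:{0<..}. \<bar>radial 3 k r\<bar> powr (7 / 2) * r ^ (3 - 1)) \<le> 9" if "k \<ge> 1" for k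
    using radial_3_integral_le[OF that] by auto
  have le: "rad_sq 3 k r ^ 1 * r ^ (2 * 1) \<le> (1167 / 1000 * (2 * bindex 3 k / real 3)) ^ 1"
    if k: "k \<ge> 1" and r: "r > 0" for k r
  proof (cases "k = 1")
    case True
    have "rad_sq 3 1 r ^ 1 * r ^ (2 * 1) \<le> (rad_K 3 * (1 + 2 / (2 * (2449 / 1000)\<^sup>2) + 3 * 2 * (2 - 2) / (8 * (2449 / 1000) ^ 4))) ^ 1 / (2449 / 1000) ^ ((3 - 1) * 1 - 2 * 1)"
      by (rule rad_sq_1_power_le_nicholson) (use r in \<open>simp_all add: power_divide\<close>)
    also have "\<dots> \<le> 1167 / 1000" by (simp add: rad_K_3 power_divide)
    finally show ?thesis using True by (simp add: bindex_def)
  next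
    case False
    then have \<mu>: "bindex 3 k \<ge> 5 / 2" using k by (simp add: bindex_def)
    have "rad_sq 3 k r ^ 1 * r ^ (2 * 1) \<le> rad_K 3 ^ 1 * sqrt ((bindex 3 k + 2) / 2) ^ (2 * 1 - (3 - 2) * 1) / sqrt (2 * bindex 3 k) ^ ((3 - 1) * 1 - 2 * 1)"
      by (rule rad_sq_power_le_sqrt) (use k r in simp_all)
    also have "\<dots> = sqrt ((bindex 3 k + 2) / 2)" by (simp add: rad_K_3)
    \<comment> \<open>For \<open>k \<ge> 2\<close> even the smaller allowance
      \<open>2 * \<mu> / 3\<close> suffices, because
      \<open>9 * (\<mu> + 2) \<le> 8 * \<mu>^2\<close> for \<open>\<mu> \<ge> 5 / 2\<close>.\<close>
    also have "\<dots> \<le> sqrt ((2 / 3 * bindex 3 k)\<^sup>2)"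
    proof (rule real_sqrt_le_mono)
      have "5 * bindex 3 k \<le> 2 * (bindex 3 k * bindex 3 k)" using mult_right_mono[OF \<mu>, of "bindex 3 k"] \<mu> by simp
      moreover have "9 * (u + 2) \<le> 8 * v" if "5 * u \<le> 2 * v" "5 / 2 \<le> u" for u v :: real using that by simp
      ultimately have "9 * (bindex 3 k + 2) \<le> 8 * (bindex 3 k * bindex 3 k)" using \<mu> by metis
      then show "(bindex 3 k + 2) / 2 \<le> (2 / 3 * bindex 3 k)\<^sup>2" by (simp add: power2_eq_square)
    qed
    also have "\<dots> \<le> (1167 / 1000 * (2 * bindex 3 k / real 3)) ^ 1" using \<mu> by simp
    finally show ?thesis .
  qed
  show "set_integrable lborel {0<..} (\<lambda>r. \<bar>radial 3 k r\<bar> powr 4 * r ^ (3 - 1))"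
    "(LBINT r:{0<..}. \<bar>radial 3 k r\<bar> powr 4 * r ^ (3 - 1)) \<le> 1167 / 1000 * rad_K 3 / (real 3 * amp_bound 3) * radial_0 3 powr 4"
    if k: "k \<ge> 1" for k
    by (rule rad_integral_le_const[OF _ k _ _ _ _ le[OF k]]; simp)+
  have "1167 / 1000 * rad_K 3 / (real 3 * amp_bound 3) \<le> 1167 / 1000 * rad_K 3 / (real 3 * amp_lower 3)"
    using amp_lower[of 3] by (intro divide_left_mono mult_left_mono mult_pos_pos) (auto simp: rad_K_3)
  also have "\<dots> < cell_sum 3 (\<lambda>z. z ^ 4) 0 [(21/50,491/500),(21/25,923/1000),(63/50,163/200),(42/25,667/1000),(21/10,247/500),(63/25,313/1000)]"
    by (simp add: rad_K_3 amp_lower_def power_divide)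
  finally show "1167 / 1000 * rad_K 3 / (real 3 * amp_bound 3)
    < cell_sum 3 (\<lambda>z. z ^ 4) 0 [(21/50,491/500),(21/25,923/1000),(63/50,163/200),(42/25,667/1000),(21/10,247/500),(63/25,313/1000)]" .
qed (simp_all add: cell_mean_def hyp_horner_numeral power_divide)

theorem theorem1:
  shows "p0 2 < ereal 6 \<and> p0 3 < ereal 4 \<and> p0 4 < ereal 3.48 \<and> p0 5 < ereal 3.50 \<and>
         p0 6 < ereal 3.58 \<and> p0 7 < ereal 3.7 \<and> p0 8 < ereal 3.86 \<and> p0 9 < ereal 4.06 \<and>
         p0 10 < ereal 4.46 \<and>
         (\<forall>d\<in>{2, 3}. p0 d < ereal (p_st d))"
  using p0_2 p0_3 p0_4 p0_5 p0_6 p0_7 p0_8 p0_9 p0_10 by (simp add: p_st_def)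

end
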